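(* Let $N\ge 0$ be an integer, let $g,f_0,\dots,f_N:\mathbb{R}\to\mathbb{R}$ be Lipschitz functions with $f_0,\dots,f_N$ linearly independent, and put $\mu(x,\theta):=g(x)+\sum_{i=0}^{N}a_if_i(x)$ for $x\in\mathbb{R}$, $\theta=(a_0,\dots,a_N)\in\mathbb{R}^{N+1}$. Assume that $g,f_0,\dots,f_N$ satisfy the linear growth condition and are twice differentiable with bounded second derivatives. Let $M\in\mathbb{N}$ and let $G:\mathbb{R}^M\to\mathbb{R}$ be a polynomially bounded measurable function. Let $\Delta>0$, $x,y\in\mathbb{R}$ and $\theta=(a_0,\dots,a_N)\in\mathbb{R}^{N+1}$. Let $\mathbb{Q}_\theta^{\Delta,x,y}$ and $\mathbb{W}^{\Delta,x,y}$ be the laws of the diffusion bridge and of the Brownian bridge defined in the context. Then $\mathbb{Q}_\theta^{\Delta,x,y}$ is absolutely continuous with respect to $\mathbb{W}^{\Delta,x,y}$ and the Radon--Nikodym derivative is given by $$\frac{d\mathbb{Q}_\theta^{\Delta,x,y}}{d\mathbb{W}^{\Delta,x,y}}=\frac{L_\theta^\Delta}{\mathbb{E}_{\mathbb{W}^{\Delta,x,y}}[L_\theta^\Delta]},\qquad\text{where } L_\theta^\Delta:=\exp\left(-\frac12\int_0^\Delta\left(\mu(W_s,\theta)^2+\mu'(W_s,\theta)\right)ds\right).$$ (a) For all $x,y\in\mathbb{R}$ and all times $0<t_1<\cdots<t_M<\Delta$, $$\left|\mathbb{E}_{\mathbb{Q}_\theta^{\Delta,x,y}}[G(X_{t_1},\dots,X_{t_M})]-\mathbb{E}_{\mathbb{W}^{\Delta,x,y}}[G(W_{t_1},\dots,W_{t_M})]\right|^2\le\mathbb{E}_{\mathbb{W}^{\Delta,x,y}}\left[\left(\frac{L_\theta^\Delta}{\mathbb{E}_{\mathbb{W}^{\Delta,x,y}}[L_\theta^\Delta]}-1\right)^2\right]\|G\|_2^2,$$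 where $\|G\|_2:=\mathbb{E}_{\mathbb{W}^{\Delta,x,y}}[G(W_{t_1},\dots,W_{t_M})^2]^{1/2}$ is the $L^2$-norm of the random variable $G(W_{t_1},\dots,W_{t_M})$. (b) Let $S(\theta):=\sup_{z\in\mathbb{R}}\{\mu(z,\theta)^2+\mu'(z,\theta)\}$ and $I(\theta):=\inf_{z\in\mathbb{R}}\{\mu(z,\theta)^2+\mu'(z,\theta)\}$. Then, for all $x,y\in\mathbb{R}$ and all times $0<t_1<\cdots<t_M<\Delta$, $$\left|\mathbb{E}_{\mathbb{Q}_\theta^{\Delta,x,y}}[G(X_{t_1},\dots,X_{t_M})]-\mathbb{E}_{\mathbb{W}^{\Delta,x,y}}[G(W_{t_1},\dots,W_{t_M})]\right|\le\frac12\left(\exp\left(\frac{\Delta}{2}\left(S(\theta)-I(\theta)\right)\right)-1\right)\|G\|_2.$$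
   Context: $\mu'(z,\theta)$ denotes the derivative of $\mu(\cdot,\theta)$ with respect to the state variable $z$. $\mathbb{Q}_\theta^{\Delta,x,y}$ denotes the law (on paths over $[0,\Delta]$) of the bridge, starting at $x$ at time $0$ and finishing at $y$ at time $\Delta$, of the diffusion $X$ that solves $dX_t=\mu(X_t,\theta)\,dt+dW_t$ ($W$ a standard Brownian motion) with parameter value $\theta$; that is, the law of $(X_t)_{t\in[0,\Delta]}$ conditioned on $X_0=x$ and $X_\Delta=y$. $\mathbb{W}^{\Delta,x,y}$ denotes the law of the corresponding Brownian bridge, i.e. of a standard Brownian motion $(W_t)_{t\in[0,\Delta]}$ conditioned on $W_0=x$ and $W_\Delta=y$. Under these laws $X$, respectively $W$, denotes the coordinate (canonical) process on path space. In part (b), if $S(\theta)=+\infty$ the right-hand side is understood as $+\infty$ (and the inequality is vacuous). *)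

theory Defs
  imports "HOL-Probability.Probability"
begin

text \<open>
  The metric space C([0,T], R) with the supremum distance; its points are extensional on [0,T].
  The sigma-algebra generated by the coordinate maps coincides with its Borel sigma-algebra.
\<close>

definition path_metric :: "real \<Rightarrow> (real \<Rightarrow> real) metric" where
  "path_metric T = cfunspace (top_of_set {0..T}) euclidean_metric"

definition path_space :: "real \<Rightarrow> (real \<Rightarrow> real) measure" where
  "path_space T =
     restrict_space (Pi\<^sub>M {0..T} (\<lambda>_. borel)) (mspace (path_metric T))"

definition path_law :: "'a measure \<Rightarrow> real \<Rightarrow> (real \<Rightarrow> 'a \<Rightarrow> real) \<Rightarrow> (real \<Rightarrow> real) measure" where
  "path_law \<Omega> T X = distr \<Omega> (path_space T) (\<lambda>\<omega>. \<lambda>t\<in>{0..T}. X t \<omega>)"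

definition continuous_process :: "'a measure \<Rightarrow> real \<Rightarrow> (real \<Rightarrow> 'a \<Rightarrow> real) \<Rightarrow> bool" where
  "continuous_process \<Omega> T X \<longleftrightarrow>
     (\<forall>t\<in>{0..T}. X t \<in> borel_measurable \<Omega>) \<and>
     (\<forall>\<omega>\<in>space \<Omega>. continuous_on {0..T} (\<lambda>t. X t \<omega>))"

definition standard_brownian_motion :: "'a measure \<Rightarrow> real \<Rightarrow> (real \<Rightarrow> 'a \<Rightarrow> real) \<Rightarrow> bool" where
  "standard_brownian_motion \<Omega> T W \<longleftrightarrow>
     prob_space \<Omega> \<and>
     continuous_process \<Omega> T W \<and>
     (AE \<omega> in \<Omega>. W 0 \<omega> = 0) \<and>
     (\<forall>s t. 0 \<le> s \<and> s < t \<and> t \<le> T \<longrightarrow>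
        distributed \<Omega> lborel (\<lambda>\<omega>. W t \<omega> - W s \<omega>) (\<lambda>z. ennreal (normal_density 0 (sqrt (t - s)) z))) \<and>
     (\<forall>n (t :: nat \<Rightarrow> real). 0 \<le> t 0 \<and> (\<forall>i<n. t i < t (Suc i)) \<and> t n \<le> T \<longrightarrow>
        prob_space.indep_vars \<Omega> (\<lambda>_. borel) (\<lambda>i \<omega>. W (t (Suc i)) \<omega> - W (t i) \<omega>) {..<n})"

text \<open>
  Solutions on [0,T] of dX = m(X) dt + dW with X(0) = x. As the noise is additive, the equation
  is a pathwise integral equation. For Lipschitz m its solution is a functional of the path of W,
  so no adaptedness condition is needed.
\<close>

definition solves_sde ::
    "'a measure \<Rightarrow> real \<Rightarrow> (real \<Rightarrow> real) \<Rightarrow> real \<Rightarrow> (real \<Rightarrow> 'a \<Rightarrow> real) \<Rightarrow> (real \<Rightarrow> 'a \<Rightarrow> real) \<Rightarrow> bool"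
  where
  "solves_sde \<Omega> T m x W X \<longleftrightarrow>
     standard_brownian_motion \<Omega> T W \<and>
     continuous_process \<Omega> T X \<and>
     (AE \<omega> in \<Omega>. \<forall>t\<in>{0..T}. X t \<omega> = x + integral {0..t} (\<lambda>s. m (X s \<omega>)) + W t \<omega>)"

text \<open>
  Let P be the law of a process on [0,T] started at a fixed point. Its law conditioned on the
  value y at time T is the value at y of the regular conditional distribution given the endpoint.
  Since a single endpoint is a null event, that distribution is by itself determined only up to
  null sets of endpoints. As usual, the weakly continuous version is taken; it is unique whenever
  the endpoint law has full support, as it has for Brownian motion and for the diffusions here.
\<close>

definition endpoint_kernel ::
    "real \<Rightarrow> (real \<Rightarrow> real) measure \<Rightarrow> (real \<Rightarrow> (real \<Rightarrow> real) measure) \<Rightarrow> bool" where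
  "endpoint_kernel T P \<kappa> \<longleftrightarrow>
     \<kappa> \<in> borel \<rightarrow>\<^sub>M prob_algebra (path_space T) \<and>
     (\<forall>A\<in>sets (path_space T). \<forall>B\<in>sets borel.
        emeasure P {\<omega>\<in>A. \<omega> T \<in> B} =
        (\<integral>\<^sup>+z\<in>B. emeasure (\<kappa> z) A \<partial>(distr P borel (\<lambda>\<omega>. \<omega> T)))) \<and>
     (\<forall>F. continuous_map (mtopology_of (path_metric T)) euclideanreal F \<and>
          bounded (F ` mspace (path_metric T)) \<longrightarrow>
          continuous_on UNIV (\<lambda>z. \<integral>\<omega>. F \<omega> \<partial>(\<kappa> z)))"

definition bridge_law ::
    "real \<Rightarrow> (real \<Rightarrow> real) measure \<Rightarrow> real \<Rightarrow> (real \<Rightarrow> real) measure \<Rightarrow> bool" where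
  "bridge_law T P y Q \<longleftrightarrow> (\<exists>\<kappa>. endpoint_kernel T P \<kappa> \<and> Q = \<kappa> y)"

definition diffusion_bridge_law ::
    "'a measure \<Rightarrow> (real \<Rightarrow> 'a \<Rightarrow> real) \<Rightarrow> (real \<Rightarrow> 'a \<Rightarrow> real) \<Rightarrow>
     (real \<Rightarrow> real) \<Rightarrow> real \<Rightarrow> real \<Rightarrow> real \<Rightarrow> (real \<Rightarrow> real) measure \<Rightarrow> bool" where
  "diffusion_bridge_law \<Omega> W X m T x y Q \<longleftrightarrow>
     solves_sde \<Omega> T m x W X \<and> bridge_law T (path_law \<Omega> T X) y Q"

definition brownian_bridge_law ::
    "'a measure \<Rightarrow> (real \<Rightarrow> 'a \<Rightarrow> real) \<Rightarrow> real \<Rightarrow> real \<Rightarrow> real \<Rightarrow> (real \<Rightarrow> real) measure \<Rightarrow> bool" where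
  "brownian_bridge_law \<Omega> B T x y Q \<longleftrightarrow>
     standard_brownian_motion \<Omega> T B \<and> bridge_law T (path_law \<Omega> T (\<lambda>t \<omega>. x + B t \<omega>)) y Q"

definition admissible_coefficient :: "(real \<Rightarrow> real) \<Rightarrow> bool" where
  "admissible_coefficient h \<longleftrightarrow>
     (\<exists>C. C-lipschitz_on UNIV h) \<and>
     (\<exists>K. \<forall>x. \<bar>h x\<bar> \<le> K * (1 + \<bar>x\<bar>)) \<and>
     (\<forall>x. h differentiable (at x)) \<and>
     (\<forall>x. deriv h differentiable (at x)) \<and>
     (\<exists>K. \<forall>x. \<bar>deriv (deriv h) x\<bar> \<le> K)"

definition lin_indep_family :: "nat \<Rightarrow> (nat \<Rightarrow> real \<Rightarrow> real) \<Rightarrow> bool" where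
  "lin_indep_family N f \<longleftrightarrow>
     (\<forall>c :: nat \<Rightarrow> real. (\<forall>x. (\<Sum>i\<le>N. c i * f i x) = 0) \<longrightarrow> (\<forall>i\<le>N. c i = 0))"

text \<open>The parameter vector is the restriction of a to the indices 0, ..., N.\<close>

definition drift ::
    "(real \<Rightarrow> real) \<Rightarrow> (nat \<Rightarrow> real \<Rightarrow> real) \<Rightarrow> nat \<Rightarrow> (nat \<Rightarrow> real) \<Rightarrow> real \<Rightarrow> real" where
  "drift g f N a x = g x + (\<Sum>i\<le>N. a i * f i x)"

definition drift_potential :: "(real \<Rightarrow> real) \<Rightarrow> real \<Rightarrow> real" where
  "drift_potential m z = (m z)\<^sup>2 + deriv m z"

definition weight :: "(real \<Rightarrow> real) \<Rightarrow> real \<Rightarrow> (real \<Rightarrow> real) \<Rightarrow> real" where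
  "weight m T \<omega> = exp (- (1/2) * integral {0..T} (\<lambda>s. drift_potential m (\<omega> s)))"

definition normalised_weight ::
    "(real \<Rightarrow> real) measure \<Rightarrow> (real \<Rightarrow> real) \<Rightarrow> real \<Rightarrow> (real \<Rightarrow> real) \<Rightarrow> real" where
  "normalised_weight \<W> m T \<omega> = weight m T \<omega> / (\<integral>\<eta>. weight m T \<eta> \<partial>\<W>)"

text \<open>Vectors with M real entries are functions that are extensional on {1..M}.\<close>

definition poly_bounded :: "nat \<Rightarrow> ((nat \<Rightarrow> real) \<Rightarrow> real) \<Rightarrow> bool" where
  "poly_bounded M G \<longleftrightarrow>
     (\<exists>C (p::nat). \<forall>v\<in>{1..M} \<rightarrow>\<^sub>E UNIV. \<bar>G v\<bar> \<le> C * (1 + L2_set v {1..M}) ^ p)"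

definition sample :: "nat \<Rightarrow> (nat \<Rightarrow> real) \<Rightarrow> (real \<Rightarrow> real) \<Rightarrow> nat \<Rightarrow> real" where
  "sample M t \<omega> = (\<lambda>i\<in>{1..M}. \<omega> (t i))"

definition admissible_times :: "nat \<Rightarrow> real \<Rightarrow> (nat \<Rightarrow> real) \<Rightarrow> bool" where
  "admissible_times M T t \<longleftrightarrow> strict_mono_on {1..M} t \<and> (\<forall>i\<in>{1..M}. 0 < t i \<and> t i < T)"

definition L2_rv_norm :: "'a measure \<Rightarrow> ('a \<Rightarrow> real) \<Rightarrow> real" where
  "L2_rv_norm P Y = sqrt (\<integral>\<omega>. (Y \<omega>)\<^sup>2 \<partial>P)"

end

theory Submission
  imports Defs
begin

text \<open>
  Girsanov's theorem for additive noise is proved without stochastic integrals. Let A be a primitive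
  of the drift m, and let m(u,v) be the mean of m over the segment from u to v, so that
  (v - u) m(u,v) = A v - A u. Discretise the equation by the implicit scheme
  v = u + h m(u,v) + w with Gaussian increments w. By a triangular change of variables, its law has
  with respect to the Gaussian random walk the density that is the product of the factors
  exp (A v - A u - h m(u,v)^2 / 2) (1 - h d/dv m(u,v)). The first terms telescope, and along every
  continuous path the product converges to
  exp (A (w T) - A (w 0)) exp (- (1/2) int_0^T (m^2 + m') (w s) ds), because d/dv m(u,v) tends to m'/2
  on the diagonal. After a cut-off at the endpoint the densities are uniformly bounded, and the
  solutions of the scheme converge to X on almost every path.

  The exponential of A depends on the endpoint only. Disintegrating with respect to the endpoint
  therefore leaves the weight, first for almost every endpoint and, by weak continuity of both
  kernels, for every endpoint. Part (a) is the Cauchy-Schwarz inequality for (Z - 1) G, where Z is the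
  normalised weight, and part (b) bounds the variance of Z by its range (Popoviciu).
\<close>

section \<open>The implicit scheme\<close>

text \<open>The explicit Euler scheme would put the sum of m(u) (v - u) into the density, a
  discretised Ito integral, which need not converge along an individual path. With the chord mean
  this sum is an exact difference, and the Ito correction reappears as the Jacobian of the implicit
  step. As the noise is additive, the scheme can be driven by the very path of W that drives X, so
  limits are taken path by path and pass to expectations by dominated convergence. The obstacle is
  domination: m may grow linearly, so A may grow quadratically, while the other factors are bounded
  because m' is. The cut-off depends on the endpoint alone and can therefore be divided out when the
  endpoint is fixed. The law of the endpoint of X is never computed; it is eliminated by evaluating
  one integral against it in two ways. A fixed endpoint y also demands moments of the bridge to y
  itself, not to almost every endpoint; they come from a bound on the joint law of the value at time
  s and the endpoint that is uniform in the endpoint.\<close>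

lemma continuous_on_DERIV_compose:
  fixes f f' :: "real \<Rightarrow> real"
  assumes "\<And>u. (f has_real_derivative f' u) (at u)" "continuous_on S g"
  shows "continuous_on S (\<lambda>x. f (g x))"
proof (rule continuous_on_compose2[OF _ assms(2)])
  show "continuous_on UNIV f" by (rule DERIV_continuous_on[OF assms(1)])
qed simp

lemma convex_combination_diff_le:
  fixes u v u' v' s :: real
  assumes "s \<in> {0..1}"
  shows "\<bar>(u + s * (v - u)) - (u' + s * (v' - u'))\<bar> \<le> \<bar>u - u'\<bar> + \<bar>v - v'\<bar>"
proof -
  have "(u + s * (v - u)) - (u' + s * (v' - u')) = (1 - s) * (u - u') + s * (v - v')"
    by (simp add: algebra_simps)
  then have "\<bar>(u + s * (v - u)) - (u' + s * (v' - u'))\<bar> \<le> \<bar>(1 - s) * (u - u')\<bar> + \<bar>s * (v - v')\<bar>"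
    by (simp only: abs_triangle_ineq)
  also have "\<dots> = (1 - s) * \<bar>u - u'\<bar> + s * \<bar>v - v'\<bar>"
    using assms by (simp add: abs_mult)
  also have "\<dots> \<le> 1 * \<bar>u - u'\<bar> + 1 * \<bar>v - v'\<bar>"
    using assms by (intro add_mono mult_right_mono) auto
  finally show ?thesis by simp
qed

lemma integral_unit_diff_le:
  fixes f g :: "real \<Rightarrow> real"
  assumes "continuous_on {0..1} f" "continuous_on {0..1} g"
    and "\<And>s. s \<in> {0..1} \<Longrightarrow> \<bar>f s - g s\<bar> \<le> C"
  shows "\<bar>integral {0..1} f - integral {0..1} g\<bar> \<le> C"
proof -
  have "norm (integral {0..1} (\<lambda>s. f s - g s)) \<le> C * (1 - 0)"
    using assms by (intro integral_bound) (auto intro!: continuous_intros)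
  then show ?thesis
    using assms by (simp add: integral_diff integrable_continuous_real)
qed

text \<open>Supplies joint continuity of \<open>chord_mean\<close>, \<open>chord_slope\<close> and
  \<open>step\<close> from their Lipschitz bounds.\<close>

lemma continuous_on_Lipschitz2:
  fixes q :: "real \<Rightarrow> real \<Rightarrow> real"
  assumes lip: "\<And>u v u' v'. \<bar>q u v - q u' v'\<bar> \<le> C * (\<bar>u - u'\<bar> + \<bar>v - v'\<bar>)"
    and fg: "continuous_on S f" "continuous_on S g"
  shows "continuous_on S (\<lambda>x. q (f x) (g x))"
  unfolding continuous_on_def
proof
  fix x assume x: "x \<in> S"
  have "((\<lambda>y. C * (\<bar>f y - f x\<bar> + \<bar>g y - g x\<bar>)) \<longlongrightarrow> C * (\<bar>f x - f x\<bar> + \<bar>g x - g x\<bar>)) (at x within S)"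
    using fg x by (intro tendsto_intros) (auto simp: continuous_on_def)
  then have "((\<lambda>y. C * (\<bar>f y - f x\<bar> + \<bar>g y - g x\<bar>)) \<longlongrightarrow> 0) (at x within S)" by simp
  then have "((\<lambda>y. q (f y) (g y) - q (f x) (g x)) \<longlongrightarrow> 0) (at x within S)"
    by (rule Lim_null_comparison[rotated]) (auto intro!: always_eventually lip)
  then show "((\<lambda>y. q (f y) (g y)) \<longlongrightarrow> q (f x) (g x)) (at x within S)"
    by (rule iffD2[OF Lim_null])
qed

text \<open>One constant \<open>K\<close> serves as Lipschitz constant of the drift and of its
  derivative and as a bound of the derivative. The bounded second derivatives of the coefficients
  enter through the Lipschitz bound on \<open>\<mu>'\<close>. The primitive \<open>A\<close> is
  fixed only up to a constant: the densities contain differences of \<open>A\<close>, and only the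
  cut-off at the endpoint depends on the choice.\<close>

locale smooth_drift =
  fixes \<mu> \<mu>' A :: "real \<Rightarrow> real" and K :: real
  assumes lip: "\<bar>\<mu> u - \<mu> v\<bar> \<le> K * \<bar>u - v\<bar>"
    and deriv: "(\<mu> has_real_derivative \<mu>' u) (at u)"
    and deriv_bound: "\<bar>\<mu>' u\<bar> \<le> K"
    and deriv_lip: "\<bar>\<mu>' u - \<mu>' v\<bar> \<le> K * \<bar>u - v\<bar>"
    and primitive: "(A has_real_derivative \<mu> u) (at u)"
begin

lemma K_nonneg: "0 \<le> K"
  using deriv_bound[of 0] by linarith

lemma cont_mu [continuous_intros]:
  "continuous_on S f \<Longrightarrow> continuous_on S (\<lambda>x. \<mu> (f x))"
  by (rule continuous_on_DERIV_compose[OF deriv])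

lemma cont_mu' [continuous_intros]:
  assumes "continuous_on S f"
  shows "continuous_on S (\<lambda>x. \<mu>' (f x))"
proof -
  have "K-lipschitz_on UNIV \<mu>'"
    using deriv_lip K_nonneg by (intro lipschitz_onI) (auto simp: dist_real_def)
  from continuous_on_compose2[OF lipschitz_on_continuous_on[OF this] assms] show ?thesis by simp
qed

lemma cont_A [continuous_intros]:
  "continuous_on S f \<Longrightarrow> continuous_on S (\<lambda>x. A (f x))"
  by (rule continuous_on_DERIV_compose[OF primitive])

section \<open>Averages of the drift over a segment\<close>

definition chord_mean :: "real \<Rightarrow> real \<Rightarrow> real" where
  "chord_mean u v = integral {0..1} (\<lambda>s. \<mu> (u + s * (v - u)))"

text \<open>This is the derivative of \<open>chord_mean u v\<close> in \<open>v\<close>, see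
  \<open>chord_mean_deriv\<close>; the factor \<open>s\<close> is the derivative of the evaluation
  point \<open>u + s * (v - u)\<close>.\<close>

definition chord_slope :: "real \<Rightarrow> real \<Rightarrow> real" where
  "chord_slope u v = integral {0..1} (\<lambda>s. s * \<mu>' (u + s * (v - u)))"

lemma chord_mean_same [simp]: "chord_mean u u = \<mu> u"
  by (simp add: chord_mean_def)

text \<open>The integral of \<open>s\<close> over the unit interval is 1/2; it becomes the
  coefficient of \<open>\<mu>'\<close> in the exponent of the weight.\<close>

lemma chord_slope_same: "chord_slope u u = \<mu>' u / 2"
proof -
  have "((\<lambda>s. s * \<mu>' u) has_integral (1\<^sup>2/2 * \<mu>' u - 0\<^sup>2/2 * \<mu>' u)) {0..1::real}"
    by (intro fundamental_theorem_of_calculus)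
      (auto intro!: derivative_eq_intros simp flip: has_real_derivative_iff_has_vector_derivative)
  then show ?thesis by (simp add: chord_slope_def integral_unique)
qed

text \<open>The fundamental theorem of calculus along the segment. It takes the place of Ito's
  formula: drift times increment is an exact difference of \<open>A\<close>, with no second-order
  term.\<close>

lemma chord_mean_primitive: "(v - u) * chord_mean u v = A v - A u"
proof -
  have "((\<lambda>s. (v - u) * \<mu> (u + s * (v - u))) has_integral
      (A (u + 1 * (v - u)) - A (u + 0 * (v - u)))) {0..1}"
  proof (intro fundamental_theorem_of_calculus)
    fix s :: real
    have "((\<lambda>s. A (u + s * (v - u))) has_real_derivative \<mu> (u + s * (v - u)) * (v - u)) (at s)"
      by (rule DERIV_chain2[OF primitive]) (auto intro!: derivative_eq_intros)
    then show "((\<lambda>s. A (u + s * (v - u))) has_vector_derivative (v - u) * \<mu> (u + s * (v - u)))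
        (at s within {0..1})"
      by (simp add: mult.commute has_real_derivative_iff_has_vector_derivative has_vector_derivative_at_within)
  qed simp
  from integral_unique[OF this] show ?thesis
    by (simp add: chord_mean_def)
qed

lemma chord_mean_lip: "\<bar>chord_mean u v - chord_mean u' v'\<bar> \<le> K * (\<bar>u - u'\<bar> + \<bar>v - v'\<bar>)"
  unfolding chord_mean_def
proof (rule integral_unit_diff_le)
  fix s :: real assume s: "s \<in> {0..1}"
  show "\<bar>\<mu> (u + s * (v - u)) - \<mu> (u' + s * (v' - u'))\<bar> \<le> K * (\<bar>u - u'\<bar> + \<bar>v - v'\<bar>)"
    by (rule order_trans[OF lip mult_left_mono[OF convex_combination_diff_le[OF s] K_nonneg]])
qed (auto intro!: continuous_intros)

lemma chord_slope_lip: "\<bar>chord_slope u v - chord_slope u' v'\<bar> \<le> K * (\<bar>u - u'\<bar> + \<bar>v - v'\<bar>)"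
  unfolding chord_slope_def
proof (rule integral_unit_diff_le)
  fix s :: real assume s: "s \<in> {0..1}"
  have "\<bar>s * \<mu>' (u + s * (v - u)) - s * \<mu>' (u' + s * (v' - u'))\<bar>
      = s * \<bar>\<mu>' (u + s * (v - u)) - \<mu>' (u' + s * (v' - u'))\<bar>"
    using s by (simp only: abs_mult flip: right_diff_distrib) simp
  also have "\<dots> \<le> 1 * (K * (\<bar>u - u'\<bar> + \<bar>v - v'\<bar>))"
    using s by (intro mult_mono order_trans[OF deriv_lip mult_left_mono[OF convex_combination_diff_le[OF s] K_nonneg]]) auto
  finally show "\<bar>s * \<mu>' (u + s * (v - u)) - s * \<mu>' (u' + s * (v' - u'))\<bar> \<le> K * (\<bar>u - u'\<bar> + \<bar>v - v'\<bar>)"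
    by simp
qed (auto intro!: continuous_intros)

lemma chord_slope_bound: "\<bar>chord_slope u v\<bar> \<le> K"
proof -
  have "\<bar>integral {0..1} (\<lambda>s. s * \<mu>' (u + s * (v - u))) - integral {0..1} (\<lambda>s::real. 0)\<bar> \<le> K"
  proof (rule integral_unit_diff_le)
    fix s :: real assume s: "s \<in> {0..1}"
    have "\<bar>s\<bar> * \<bar>\<mu>' (u + s * (v - u))\<bar> \<le> 1 * K"
      using s deriv_bound by (intro mult_mono) auto
    then show "\<bar>s * \<mu>' (u + s * (v - u)) - 0\<bar> \<le> K" by (simp add: abs_mult)
  qed (auto intro!: continuous_intros)
  then show ?thesis by (simp add: chord_slope_def)
qed

lemma chord_mean_deriv: "(chord_mean u has_real_derivative chord_slope u v) (at v)"
proof -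
  have "((\<lambda>v. integral (cbox 0 1) (\<lambda>s. \<mu> (u + s * (v - u)))) has_real_derivative
      integral (cbox 0 1) (\<lambda>s. s * \<mu>' (u + s * (v - u)))) (at v within UNIV)"
  proof (rule leibniz_rule_field_derivative)
    fix v s :: real
    have "((\<lambda>v. \<mu> (u + s * (v - u))) has_real_derivative \<mu>' (u + s * (v - u)) * s) (at v)"
      by (rule DERIV_chain2[OF deriv]) (auto intro!: derivative_eq_intros)
    then show "((\<lambda>v. \<mu> (u + s * (v - u))) has_real_derivative s * \<mu>' (u + s * (v - u))) (at v within UNIV)"
      by (simp add: mult.commute)
  next
    show "(\<lambda>s. \<mu> (u + s * (v - u))) integrable_on cbox 0 1" for v
      by (auto intro!: integrable_continuous_real continuous_intros)
    show "continuous_on (UNIV \<times> cbox 0 1) (\<lambda>(v, s). s * \<mu>' (u + s * (v - u)))"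
      by (auto intro!: continuous_intros simp: split_beta)
  qed auto
  then show ?thesis
    by (simp add: chord_mean_def[abs_def] chord_slope_def)
qed

lemmas cont_chord_mean [continuous_intros] = continuous_on_Lipschitz2[OF chord_mean_lip]
lemmas cont_chord_slope [continuous_intros] = continuous_on_Lipschitz2[OF chord_slope_lip]

text \<open>The new position solves the implicit equation with noise \<open>w\<close>. The
  description is meaningful for \<open>0 < h\<close> and \<open>h * K \<le> 1/2\<close>, where
  \<open>step_ex1\<close> gives existence and uniqueness.\<close>

definition step :: "real \<Rightarrow> real \<Rightarrow> real \<Rightarrow> real" where
  "step h u w = (THE v. v - h * chord_mean u v = u + w)"

context
  fixes h :: real
  assumes h: "0 < h" "h * K \<le> 1/2"
begin

lemma step_map_deriv:
  "((\<lambda>v. v - h * chord_mean u v) has_real_derivative 1 - h * chord_slope u v) (at v)"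
  by (auto intro!: derivative_eq_intros chord_mean_deriv)

lemma step_map_deriv_ge: "1/2 \<le> 1 - h * chord_slope u v"
proof -
  have "h * chord_slope u v \<le> h * K"
    using h chord_slope_bound[of u v] by (intro mult_left_mono) auto
  then show ?thesis using h by linarith
qed

text \<open>The derivative of the step map is at least 1/2, so the map minus \<open>v / 2\<close> is
  nondecreasing. The linear growth yields both injectivity and surjectivity.\<close>

lemma step_map_growth:
  assumes "v \<le> v'"
  shows "(v' - v) / 2 \<le> (v' - h * chord_mean u v') - (v - h * chord_mean u v)"
proof -
  have "v / 2 \<le> v' / 2" using assms by simp
  have "(v - h * chord_mean u v) - v / 2 \<le> (v' - h * chord_mean u v') - v' / 2"
  proof (rule DERIV_nonneg_imp_nondecreasing[OF assms])
    fix z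
    have "((\<lambda>v. v - h * chord_mean u v - v / 2) has_real_derivative 1 - h * chord_slope u z - 1/2) (at z)"
      by (intro DERIV_diff step_map_deriv) (auto intro!: derivative_eq_intros)
    then show "\<exists>y. ((\<lambda>v. v - h * chord_mean u v - v / 2) has_real_derivative y) (at z) \<and> 0 \<le> y"
      using step_map_deriv_ge[of u z] by (intro exI[of _ "1 - h * chord_slope u z - 1/2"]) auto
  qed
  then show ?thesis by (simp add: field_simps)
qed

lemma step_ex1: "\<exists>!v. v - h * chord_mean u v = c"
proof -
  let ?f = "\<lambda>v. v - h * chord_mean u v"
  \<comment> \<open>At a rate of at least 1/2, moving the argument by twice the distance from
    \<open>?f 0\<close> to \<open>c\<close> reaches \<open>c\<close> on either side.\<close>
  let ?R = "2 * \<bar>c - ?f 0\<bar>"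
  have "?f 0 \<le> ?f ?R - ?R / 2" "?f (- ?R) \<le> ?f 0 - ?R / 2"
    using step_map_growth[of 0 ?R u] step_map_growth[of "- ?R" 0 u] by auto
  then have "?f (- ?R) \<le> ?f 0 - \<bar>c - ?f 0\<bar>" "?f 0 + \<bar>c - ?f 0\<bar> \<le> ?f ?R" by simp_all
  then have "?f (- ?R) \<le> c" "c \<le> ?f ?R" 
    using abs_ge_self[of "c - ?f 0"] abs_ge_minus_self[of "c - ?f 0"] by linarith+
  then have "\<exists>v\<ge>- ?R. v \<le> ?R \<and> ?f v = c"
    by (intro IVT') (auto intro!: continuous_intros)
  then obtain v where v: "?f v = c" by blast
  moreover have "v' = v" if "?f v' = c" for v'
    using step_map_growth[of v v' u] step_map_growth[of v' v u] v that by (cases "v \<le> v'") auto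
  ultimately show ?thesis by blast
qed

lemma step_eq: "step h u w = u + w + h * chord_mean u (step h u w)"
  using theI'[OF step_ex1[of u "u + w"]] unfolding step_def by linarith

lemma step_unique: "v = u + w + h * chord_mean u v \<Longrightarrow> step h u w = v"
  unfolding step_def by (rule the1_equality[OF step_ex1]) linarith

text \<open>Subtracting two instances of the implicit equation gives dv \<le> du + dw + (du + dv) /
  2, hence dv \<le> 3 du + 2 dw. The bound makes \<open>step\<close> jointly continuous and so
  measurable.\<close>

lemma step_lip: "\<bar>step h u w - step h u' w'\<bar> \<le> 3 * (\<bar>u - u'\<bar> + \<bar>w - w'\<bar>)"
proof -
  let ?v = "step h u w" and ?v' = "step h u' w'"
  have "?v - ?v' = (u - u') + (w - w') + h * (chord_mean u ?v - chord_mean u' ?v')"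
    using step_eq[of u w] step_eq[of u' w'] by (simp add: algebra_simps)
  then have "\<bar>?v - ?v'\<bar> \<le> \<bar>u - u'\<bar> + \<bar>w - w'\<bar> + \<bar>h * (chord_mean u ?v - chord_mean u' ?v')\<bar>"
    by linarith
  then have "\<bar>?v - ?v'\<bar> \<le> \<bar>u - u'\<bar> + \<bar>w - w'\<bar> + h * \<bar>chord_mean u ?v - chord_mean u' ?v'\<bar>"
    using h by (simp add: abs_mult)
  moreover have "h * \<bar>chord_mean u ?v - chord_mean u' ?v'\<bar> \<le> 1/2 * (\<bar>u - u'\<bar> + \<bar>?v - ?v'\<bar>)"
  proof -
    have "h * \<bar>chord_mean u ?v - chord_mean u' ?v'\<bar> \<le> h * (K * (\<bar>u - u'\<bar> + \<bar>?v - ?v'\<bar>))"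
    using h by (intro mult_left_mono chord_mean_lip) auto
  also have "\<dots> = (h * K) * (\<bar>u - u'\<bar> + \<bar>?v - ?v'\<bar>)" by simp
  also have "\<dots> \<le> 1/2 * (\<bar>u - u'\<bar> + \<bar>?v - ?v'\<bar>)"
    using h by (intro mult_right_mono) auto
    finally show ?thesis .
  qed
  ultimately show ?thesis using abs_ge_zero[of "w - w'"] unfolding distrib_left by linarith
qed

lemma step_measurable:
  assumes [measurable]: "f \<in> borel_measurable M" "g \<in> borel_measurable M"
  shows "(\<lambda>x. step h (f x) (g x)) \<in> borel_measurable M"
proof -
  have "continuous_on UNIV (\<lambda>p. step h (fst p) (snd p))"
    by (intro continuous_on_Lipschitz2[OF step_lip] continuous_intros)
  then have "(\<lambda>p. step h (fst p) (snd p)) \<in> borel_measurable (borel \<Otimes>\<^sub>M borel)"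
    by (simp add: borel_prod borel_measurable_continuous_onI)
  from measurable_compose[OF _ this, of "\<lambda>x. (f x, g x)" M] show ?thesis by simp
qed

end

text \<open>The ratio of the density of the implicit step from \<open>u\<close> to that of the
  Gaussian step from \<open>u\<close>, both at \<open>v\<close>: the exponential comes from the
  shift of the mean, the second factor is the Jacobian of the noise as a function of
  \<open>v\<close>.\<close>

definition step_density :: "real \<Rightarrow> real \<Rightarrow> real \<Rightarrow> real" where
  "step_density h u v =
     exp (A v - A u - h * (chord_mean u v)\<^sup>2 / 2) * (1 - h * chord_slope u v)"

end

text \<open>Substitution on compact intervals, extended to the line by monotone convergence of both
  integrals.\<close>

lemma nn_integral_substitution_increasing:
  fixes g g' :: "real \<Rightarrow> real" and f :: "real \<Rightarrow> ennreal"
  assumes f [measurable]: "f \<in> borel_measurable borel"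
    and deriv: "\<And>x. (g has_real_derivative g' x) (at x)"
    and cont: "continuous_on UNIV g'"
    and nonneg: "\<And>x. 0 \<le> g' x"
    and surj: "surj g"
  shows "(\<integral>\<^sup>+x. f x \<partial>lborel) = (\<integral>\<^sup>+x. f (g x) * g' x \<partial>lborel)"
proof -
  have mono: "g x \<le> g y" if "x \<le> y" for x y
    using that nonneg deriv by (intro DERIV_nonneg_imp_nondecreasing[OF that]) blast
  have contg: "continuous_on UNIV g"
    using deriv DERIV_isCont continuous_at_imp_continuous_on by blast
  have [measurable]: "g \<in> borel_measurable borel" "g' \<in> borel_measurable borel"
    using contg cont by (auto intro: borel_measurable_continuous_onI)
  \<comment> \<open>\<open>Suc n\<close> keeps every interval nondegenerate, as the substitution
    rule on compact intervals requires.\<close>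
  have lim: "(\<lambda>n. \<integral>\<^sup>+x. f x * indicator {g (-real (Suc n))..g (real (Suc n))} x \<partial>lborel)
      \<longlonglongrightarrow> (\<integral>\<^sup>+x. f x \<partial>lborel)"
  proof (rule nn_integral_LIMSEQ)
    show "incseq (\<lambda>n x. f x * indicator {g (-real (Suc n))..g (real (Suc n))} x)"
    proof (intro monoI le_funI mult_left_mono)
      fix k n :: nat and z :: real assume "k \<le> n"
      then have "g (-real (Suc n)) \<le> g (-real (Suc k))" "g (real (Suc k)) \<le> g (real (Suc n))"
        by (auto intro!: mono)
      then show "(indicator {g (-real (Suc k))..g (real (Suc k))} z :: ennreal)
          \<le> indicator {g (-real (Suc n))..g (real (Suc n))} z"
        by (auto simp: indicator_def)
    qed simp
    fix z
    \<comment> \<open>Surjectivity makes the image intervals cover the line: \<open>z\<close> lies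
      in the image of every interval that contains \<open>x\<close>.\<close>
    from surj obtain x where x: "z = g x" by blast
    obtain N where N: "\<bar>x\<bar> \<le> real N" using real_arch_simple by blast
    have "eventually (\<lambda>n. f z * indicator {g (-real (Suc n))..g (real (Suc n))} z = f z) sequentially"
      using eventually_ge_at_top[of N]
    proof eventually_elim
      case (elim n)
      then have "g (-real (Suc n)) \<le> z" "z \<le> g (real (Suc n))" unfolding x using N by (auto intro!: mono)
      then show ?case by simp
    qed
    then show "(\<lambda>n. f z * indicator {g (-real (Suc n))..g (real (Suc n))} z) \<longlonglongrightarrow> f z"
      by (rule tendsto_eventually)
  qed auto
  have lim': "(\<lambda>n. \<integral>\<^sup>+x. f (g x) * g' x * indicator {-real (Suc n)..real (Suc n)} x \<partial>lborel)
      \<longlonglongrightarrow> (\<integral>\<^sup>+x. f (g x) * g' x \<partial>lborel)"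
  proof (rule nn_integral_LIMSEQ)
    show "incseq (\<lambda>n x. f (g x) * g' x * indicator {-real (Suc n)..real (Suc n)} x)"
      by (intro monoI le_funI mult_left_mono) (auto simp: indicator_def)
    fix x
    obtain N where N: "\<bar>x\<bar> \<le> real N" using real_arch_simple by blast
    have "eventually (\<lambda>n. f (g x) * g' x * indicator {-real (Suc n)..real (Suc n)} x = f (g x) * g' x) sequentially"
      using eventually_ge_at_top[of N] by eventually_elim (use N in \<open>auto simp: indicator_def\<close>)
    then show "(\<lambda>n. f (g x) * g' x * indicator {-real (Suc n)..real (Suc n)} x) \<longlonglongrightarrow> f (g x) * g' x"
      by (rule tendsto_eventually)
  qed auto
  have "(\<integral>\<^sup>+x. f x * indicator {g (-real (Suc n))..g (real (Suc n))} x \<partial>lborel)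
      = (\<integral>\<^sup>+x. f (g x) * g' x * indicator {-real (Suc n)..real (Suc n)} x \<partial>lborel)" for n
    by (rule nn_integral_substitution_aux)
      (auto intro!: deriv nonneg continuous_on_subset[OF cont])
  with lim lim' show ?thesis
    using LIMSEQ_unique by simp
qed

section \<open>The density of one implicit step\<close>

context smooth_drift
begin

text \<open>Completing the square: the cross term of the exponent is
  \<open>(v - u) * chord_mean u v\<close>, which is \<open>A v - A u\<close>, and the remaining term
  is minus \<open>h / 2\<close> times the squared chord mean.\<close>

lemma normal_density_shift:
  assumes "0 < h"
  shows "normal_density 0 (sqrt h) (v - h * chord_mean u v - u) * (1 - h * chord_slope u v)
    = step_density h u v * normal_density 0 (sqrt h) (v - u)"
proof -
  have "- (v - h * chord_mean u v - u)\<^sup>2 / (2 * h)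
      = (v - u) * chord_mean u v - h * (chord_mean u v)\<^sup>2 / 2 + - (v - u)\<^sup>2 / (2 * h)"
    using assms by (simp add: power2_eq_square field_simps)
  then have *: "exp (- (v - h * chord_mean u v - u)\<^sup>2 / (2 * h))
      = exp (A v - A u - h * (chord_mean u v)\<^sup>2 / 2) * exp (- (v - u)\<^sup>2 / (2 * h))"
    by (simp add: chord_mean_primitive flip: exp_add)
  have normal: "normal_density 0 (sqrt h) z = 1 / sqrt (2 * pi * h) * exp (- z\<^sup>2 / (2 * h))" for z
    using assms by (simp add: normal_density_def)
  show ?thesis
    unfolding normal * step_density_def by (simp only: mult_ac)
qed

lemma cont_step_density [continuous_intros]:
  "continuous_on S f \<Longrightarrow> continuous_on S g \<Longrightarrow> continuous_on S (\<lambda>x. step_density h (f x) (g x))"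
  unfolding step_density_def by (intro continuous_intros) auto

lemma step_density_measurable [measurable]:
  assumes [measurable]: "f \<in> borel_measurable M" "g \<in> borel_measurable M"
  shows "(\<lambda>x. step_density h (f x) (g x)) \<in> borel_measurable M"
proof -
  have "(\<lambda>p. step_density h (fst p) (snd p)) \<in> borel_measurable (borel \<Otimes>\<^sub>M borel)"
    unfolding borel_prod by (intro borel_measurable_continuous_onI continuous_intros)
  from measurable_compose[OF _ this, of "\<lambda>x. (f x, g x)" M] show ?thesis by simp
qed

lemma step_density_nonneg:
  "0 < h \<Longrightarrow> h * K \<le> 1/2 \<Longrightarrow> 0 \<le> step_density h u v"
  using step_map_deriv_ge[of h u v] unfolding step_density_def by (intro mult_nonneg_nonneg) auto

lemma surj_step_map:
  assumes h: "0 < h" "h * K \<le> 1/2"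
  shows "surj (\<lambda>v. v - h * chord_mean u v - u)"
  unfolding surj_def
proof
  fix c
  from step_ex1[OF h, of u "c + u"] obtain v where "v - h * chord_mean u v = c + u" by (elim ex1E)
  then have "c = v - h * chord_mean u v - u" by linarith
  then show "\<exists>v. c = v - h * chord_mean u v - u" by (rule exI)
qed

lemma nn_integral_step_map:
  assumes h: "0 < h" "h * K \<le> 1/2" and f: "f \<in> borel_measurable borel"
  shows "(\<integral>\<^sup>+w. f w \<partial>lborel)
    = (\<integral>\<^sup>+v. f (v - h * chord_mean u v - u) * ennreal (1 - h * chord_slope u v) \<partial>lborel)"
proof (rule nn_integral_substitution_increasing[OF f _ _ _ surj_step_map[OF h]])
  fix v
  have "((\<lambda>v. v - h * chord_mean u v - u) has_real_derivative 1 - h * chord_slope u v - 0) (at v)"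
    by (intro DERIV_diff step_map_deriv[OF h] DERIV_const)
  then show "((\<lambda>v. v - h * chord_mean u v - u) has_real_derivative 1 - h * chord_slope u v) (at v)"
    by (simp only: diff_zero)
  show "0 \<le> 1 - h * chord_slope u v"
    using step_map_deriv_ge[OF h, of u v] by linarith
next
  show "continuous_on UNIV (\<lambda>v. 1 - h * chord_slope u v)"
    by (intro continuous_intros)
qed

text \<open>The noise is expressed through the new position \<open>v\<close>, and then
  \<open>v = u + w\<close> is written with a Gaussian increment \<open>w\<close> again, so that the
  formula can be iterated.\<close>

lemma nn_integral_step:
  assumes h: "0 < h" "h * K \<le> 1/2" and \<Phi> [measurable]: "\<Phi> \<in> borel_measurable borel"
  shows "(\<integral>\<^sup>+w. \<Phi> (step h u w) \<partial>density lborel (normal_density 0 (sqrt h)))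
    = (\<integral>\<^sup>+w. \<Phi> (u + w) * ennreal (step_density h u (u + w)) \<partial>density lborel (normal_density 0 (sqrt h)))"
proof -
  define p where "p w = ennreal (normal_density 0 (sqrt h) w)" for w
  have p [measurable]: "p \<in> borel_measurable borel" unfolding p_def by measurable
  have S [measurable]: "(\<lambda>w. \<Phi> (step h u w)) \<in> borel_measurable borel"
    by (intro measurable_compose[OF _ \<Phi>] step_measurable[OF h]) auto
  have "(\<integral>\<^sup>+w. \<Phi> (step h u w) \<partial>density lborel p) = (\<integral>\<^sup>+w. p w * \<Phi> (step h u w) \<partial>lborel)"
    by (subst nn_integral_density) auto
  also have "\<dots> = (\<integral>\<^sup>+v. (p (v - h * chord_mean u v - u) * \<Phi> (step h u (v - h * chord_mean u v - u)))
      * ennreal (1 - h * chord_slope u v) \<partial>lborel)"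
    by (rule nn_integral_step_map[OF h]) measurable
  also have "\<dots> = (\<integral>\<^sup>+v. p (v - u) * (\<Phi> v * ennreal (step_density h u v)) \<partial>lborel)"
  proof (rule nn_integral_cong)
    fix v
    \<comment> \<open>By uniqueness of the implicit solution, \<open>step\<close> inverts the
      substitution.\<close>
    have *: "step h u (v - h * chord_mean u v - u) = v" by (rule step_unique[OF h]) linarith
    have "p (v - h * chord_mean u v - u) * ennreal (1 - h * chord_slope u v)
        = p (v - u) * ennreal (step_density h u v)"
      using normal_density_shift[OF h(1), of v u] step_map_deriv_ge[OF h, of u v] step_density_nonneg[OF h, of u v]
      by (simp add: p_def mult.commute flip: ennreal_mult)
    then show "p (v - h * chord_mean u v - u) * \<Phi> (step h u (v - h * chord_mean u v - u)) * ennreal (1 - h * chord_slope u v)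
        = p (v - u) * (\<Phi> v * ennreal (step_density h u v))"
      unfolding * by (simp only: ac_simps)
  qed
  also have "\<dots> = (\<integral>\<^sup>+w. p w * (\<Phi> (u + w) * ennreal (step_density h u (u + w))) \<partial>lborel)"
    using nn_integral_real_affine[where f="\<lambda>v. p (v - u) * (\<Phi> v * ennreal (step_density h u v))" and c=1 and t=u]
    by simp
  also have "\<dots> = (\<integral>\<^sup>+w. \<Phi> (u + w) * ennreal (step_density h u (u + w)) \<partial>density lborel p)"
    by (subst nn_integral_density) auto
  finally show ?thesis unfolding p_def .
qed

end

section \<open>Convergence of the discrete densities and of the scheme\<close>

lemma grid_mem:
  fixes T :: real
  assumes "k \<le> n" "0 < n" "0 \<le> T"
  shows "real k * (T / n) \<in> {0..T}"
proof -
  have "real k * T \<le> real n * T" using assms by (intro mult_right_mono) auto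
  then show ?thesis using assms by (simp add: field_simps)
qed

lemma integral_grid_step:
  fixes f :: "real \<Rightarrow> real"
  assumes f: "continuous_on {0..T} f" and "Suc k \<le> n" "0 < T"
  shows "integral {0..real (Suc k) * (T / n)} f
    = integral {0..real k * (T / n)} f + integral {real k * (T / n)..real (Suc k) * (T / n)} f"
proof -
  have "real k * (T / n) \<le> real (Suc k) * (T / n)"
    using assms by (intro mult_right_mono) auto
  then show ?thesis
    using grid_mem[of k n T] grid_mem[of "Suc k" n T] assms
    by (intro Henstock_Kurzweil_Integration.integral_combine[symmetric] integrable_continuous_real
        continuous_on_subset[OF f]) auto
qed

lemma integral_diff_const_le:
  fixes f :: "real \<Rightarrow> real"
  assumes "a \<le> b" "continuous_on {a..b} f" "\<And>s. s \<in> {a..b} \<Longrightarrow> \<bar>f s - c\<bar> \<le> e"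
  shows "\<bar>integral {a..b} f - (b - a) * c\<bar> \<le> e * (b - a)"
proof -
  have "norm (integral {a..b} (\<lambda>s. f s - c)) \<le> e * (b - a)"
    using assms by (intro integral_bound) (auto intro!: continuous_intros)
  then show ?thesis
    using assms by (simp add: integral_diff integrable_continuous_real)
qed

text \<open>Uniform continuity on the square controls the error of one cell. Two arguments occur
  because the chord functions see both ends of a cell; the ends merge on the diagonal in the
  limit.\<close>

lemma two_point_riemann_sum:
  fixes g :: "real \<Rightarrow> real \<Rightarrow> real"
  assumes g: "continuous_on ({0..T} \<times> {0..T}) (\<lambda>p. g (fst p) (snd p))" and T: "0 < T"
  shows "(\<lambda>n. \<Sum>k<n. T / n * g (real k * (T / n)) (real (Suc k) * (T / n)))
    \<longlonglongrightarrow> integral {0..T} (\<lambda>s. g s s)"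
proof (rule LIMSEQ_I)
  let ?S = "\<lambda>n. \<Sum>k<n. T / real n * g (real k * (T / real n)) (real (Suc k) * (T / real n))"
  fix r :: real assume r: "0 < r"
  \<comment> \<open>The error accumulated over \<open>[0, T]\<close> is then at most
    \<open>e * T = r / 2\<close>.\<close>
  define e where "e = r / (2 * T)"
  have e: "0 < e" using r T by (simp add: e_def)
  have "uniformly_continuous_on ({0..T} \<times> {0..T}) (\<lambda>p. g (fst p) (snd p))"
    by (intro compact_uniformly_continuous g compact_Times) auto
  then obtain d where d: "0 < d"
    and dd: "\<And>p p'. p \<in> {0..T} \<times> {0..T} \<Longrightarrow> p' \<in> {0..T} \<times> {0..T} \<Longrightarrow> dist p' p < d
      \<Longrightarrow> dist (g (fst p') (snd p')) (g (fst p) (snd p)) < e"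
    unfolding uniformly_continuous_on_def using e by metis
  have diag: "continuous_on {0..T} (\<lambda>s. g s s)"
  proof -
    have "continuous_on {0..T} (\<lambda>s. (s, s))" by (intro continuous_intros)
    from continuous_on_compose2[OF g this] show ?thesis by auto
  qed
  \<comment> \<open>In a cell from a to b of length \<open>h\<close>, the distance from
    \<open>(s, s)\<close> to \<open>(a, b)\<close> is estimated by \<open>2 * h\<close>, which has
    to be below \<open>d\<close>.\<close>
  obtain n0 :: nat where n0: "2 * T / d < real n0" using reals_Archimedean2 by blast
  show "\<exists>no. \<forall>n\<ge>no. norm (?S n - integral {0..T} (\<lambda>s. g s s)) < r"
  proof (intro exI[of _ n0] allI impI)
    fix n assume n: "n0 \<le> n"
    have "0 < 2 * T / d" using T d by simp
    then have n_pos: "0 < n" using n n0 by linarith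
    define h where "h = T / n"
    have h: "0 < h" using T n_pos by (simp add: h_def)
    have "2 * T / d < real n" using n n0 by linarith
    then have hd: "2 * h < d" using d n_pos by (simp add: h_def field_simps)
    have "\<bar>(\<Sum>i<k. h * g (real i * h) (real (Suc i) * h)) - integral {0..real k * h} (\<lambda>s. g s s)\<bar>
        \<le> e * (real k * h)" if "k \<le> n" for k
      using that
    proof (induction k)
      case (Suc k)
      let ?a = "real k * h" and ?b = "real (Suc k) * h"
      have mem: "?a \<in> {0..T}" "?b \<in> {0..T}"
        using grid_mem[of k n T] grid_mem[of "Suc k" n T] Suc.prems n_pos T by (auto simp: h_def)
      have ab: "?b - ?a = h" by (simp add: algebra_simps)
      have "\<bar>integral {?a..?b} (\<lambda>s. g s s) - (?b - ?a) * g ?a ?b\<bar> \<le> e * (?b - ?a)"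
      proof (rule integral_diff_const_le)
        show "?a \<le> ?b" using ab h by linarith
        show "continuous_on {?a..?b} (\<lambda>s. g s s)"
          by (rule continuous_on_subset[OF diag]) (use mem in auto)
        fix s assume s: "s \<in> {?a..?b}"
        have "dist (s, s) (?a, ?b) \<le> dist s ?a + dist s ?b"
          using dist_triangle[of "(s,s)" "(?a,?b)" "(?a,s)"] by (simp add: dist_Pair_Pair)
        also have "\<dots> \<le> 2 * h" using s ab by (auto simp: dist_real_def)
        finally have "dist (s, s) (?a, ?b) < d" using hd by linarith
        then have "dist (g s s) (g ?a ?b) < e"
          using dd[of "(?a, ?b)" "(s, s)"] mem s by auto
        then show "\<bar>g s s - g ?a ?b\<bar> \<le> e" by (simp add: dist_real_def)
      qed
      then have "\<bar>integral {?a..?b} (\<lambda>s. g s s) - h * g ?a ?b\<bar> \<le> e * h" unfolding ab .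
      moreover have "integral {0..?b} (\<lambda>s. g s s) = integral {0..?a} (\<lambda>s. g s s) + integral {?a..?b} (\<lambda>s. g s s)"
        unfolding h_def by (rule integral_grid_step[OF diag Suc.prems T])
      moreover have "e * ?b = e * ?a + e * h" by (simp add: algebra_simps)
      ultimately show ?case using Suc.IH Suc.prems by simp
    qed simp
    from this[of n] have "\<bar>(\<Sum>i<n. h * g (real i * h) (real (Suc i) * h)) - integral {0..T} (\<lambda>s. g s s)\<bar> \<le> e * T"
      using n_pos by (simp add: h_def)
    also have "e * T < r" using r T by (simp add: e_def)
    finally show "norm (?S n - integral {0..T} (\<lambda>s. g s s)) < r"
      by (simp add: h_def)
  qed
qed

text \<open>The logarithm of \<open>1 - c\<close> differs from \<open>- c\<close> by at most
  \<open>2 * c^2\<close>, so the total error is at most \<open>n * 2 * (C / n)^2\<close>, which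
  tends to 0.\<close>

lemma prod_one_minus_limit:
  fixes c :: "nat \<Rightarrow> nat \<Rightarrow> real"
  assumes bound: "\<And>n k. k < n \<Longrightarrow> \<bar>c n k\<bar> \<le> C / n"
    and lim: "(\<lambda>n. \<Sum>k<n. c n k) \<longlonglongrightarrow> L"
  shows "(\<lambda>n. \<Prod>k<n. 1 - c n k) \<longlonglongrightarrow> exp (- L)"
proof -
  obtain n0 :: nat where n0: "2 * C < real n0" using reals_Archimedean2 by blast
  \<comment> \<open>The quadratic bound on the logarithm holds up to 1/2 in absolute value; the
    factors are then positive as well.\<close>
  have small: "\<bar>c n k\<bar> \<le> 1/2" if "n0 \<le> n" "k < n" for n k
  proof -
    have "C / n \<le> 1/2" using n0 that by (simp add: field_simps)
    then show ?thesis using bound[OF that(2)] by linarith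
  qed
  have "(\<lambda>n. (\<Sum>k<n. ln (1 - c n k)) - (- (\<Sum>k<n. c n k))) \<longlonglongrightarrow> 0"
  proof (rule Lim_null_comparison)
    show "(\<lambda>n. 2 * C\<^sup>2 / n) \<longlonglongrightarrow> 0" by (rule lim_const_over_n)
    show "\<forall>\<^sub>F n in sequentially. norm ((\<Sum>k<n. ln (1 - c n k)) - (- (\<Sum>k<n. c n k))) \<le> 2 * C\<^sup>2 / n"
      using eventually_ge_at_top[of "max 1 n0"]
    proof eventually_elim
      case (elim n)
      have "norm ((\<Sum>k<n. ln (1 - c n k)) - (- (\<Sum>k<n. c n k))) = norm (\<Sum>k<n. ln (1 + (- c n k)) - (- c n k))"
        by (simp add: sum.distrib)
      also have "\<dots> \<le> (\<Sum>k<n. 2 * (C / n)\<^sup>2)"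
      proof (rule sum_norm_le)
        fix k assume k: "k \<in> {..<n}"
        have "\<bar>ln (1 + (- c n k)) - (- c n k)\<bar> \<le> 2 * (- c n k)\<^sup>2"
          by (rule abs_ln_one_plus_x_minus_x_bound) (use small elim k in auto)
        also have "(- c n k)\<^sup>2 \<le> (C / n)\<^sup>2"
          using bound[of k n] k by (intro power2_le_iff_abs_le[THEN iffD2]) auto
        finally show "norm (ln (1 + (- c n k)) - (- c n k)) \<le> 2 * (C / n)\<^sup>2" by simp
      qed
      also have "\<dots> = 2 * C\<^sup>2 / n" using elim by (simp add: power2_eq_square)
      finally show ?case .
    qed
  qed
  from tendsto_add[OF this tendsto_minus[OF lim]]
  have "(\<lambda>n. \<Sum>k<n. ln (1 - c n k)) \<longlonglongrightarrow> - L" by simp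
  then have "(\<lambda>n. exp (\<Sum>k<n. ln (1 - c n k))) \<longlonglongrightarrow> exp (- L)" by (rule tendsto_exp)
  moreover have "\<forall>\<^sub>F n in sequentially. exp (\<Sum>k<n. ln (1 - c n k)) = (\<Prod>k<n. 1 - c n k)"
    using eventually_ge_at_top[of n0]
  proof eventually_elim
    case (elim n)
    have "0 < 1 - c n k" if "k < n" for k using small[OF elim that] by linarith
    then show ?case by (simp add: exp_sum)
  qed
  ultimately show ?thesis by (rule Lim_transform_eventually)
qed

section \<open>Products of step densities along a path\<close>

context smooth_drift
begin

lemma deriv_mu: "deriv \<mu> u = \<mu>' u"
  by (rule DERIV_imp_deriv[OF deriv])

lemma prod_step_density:
  "(\<Prod>k<n. step_density h (p k) (p (Suc k)))
    = exp (A (p n) - A (p 0)) * exp (- (\<Sum>k<n. h * (chord_mean (p k) (p (Suc k)))\<^sup>2) / 2)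
      * (\<Prod>k<n. 1 - h * chord_slope (p k) (p (Suc k)))"
proof -
  have "(\<Prod>k<n. step_density h (p k) (p (Suc k)))
      = exp (\<Sum>k<n. A (p (Suc k)) - A (p k) - h * (chord_mean (p k) (p (Suc k)))\<^sup>2 / 2)
      * (\<Prod>k<n. 1 - h * chord_slope (p k) (p (Suc k)))"
    by (simp add: step_density_def prod.distrib exp_sum)
  also have "(\<Sum>k<n. A (p (Suc k)) - A (p k) - h * (chord_mean (p k) (p (Suc k)))\<^sup>2 / 2)
      = (\<Sum>k<n. A (p (Suc k)) - A (p k)) - (\<Sum>k<n. h * (chord_mean (p k) (p (Suc k)))\<^sup>2) / 2"
    by (simp add: sum_subtractf sum_divide_distrib)
  also have "\<dots> = (A (p n) - A (p 0)) + - (\<Sum>k<n. h * (chord_mean (p k) (p (Suc k)))\<^sup>2) / 2"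
    by (simp only: sum_lessThan_telescope[of "\<lambda>k. A (p k)"])
  finally show ?thesis by (simp only: exp_add)
qed

text \<open>The exponential of the squared chord means is at most 1, and each Jacobian is at most
  \<open>1 + h * K \<le> exp (h * K)\<close>. Only \<open>exp (A (p n))\<close> is left for the
  cut-off to control.\<close>

lemma prod_step_density_le:
  assumes "0 < h" "h * K \<le> 1/2"
  shows "(\<Prod>k<n. step_density h (p k) (p (Suc k))) \<le> exp (A (p n) - A (p 0)) * exp (real n * h * K)"
proof -
  have "(\<Prod>k<n. 1 - h * chord_slope (p k) (p (Suc k))) \<le> (\<Prod>k<n. exp (h * K))"
  proof (rule prod_mono)
    fix k
    have "- (h * chord_slope (p k) (p (Suc k))) \<le> h * K"
      using mult_left_mono[of "- chord_slope (p k) (p (Suc k))" K h] chord_slope_bound[of "p k" "p (Suc k)"] assms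
      by auto
    then have "1 - h * chord_slope (p k) (p (Suc k)) \<le> exp (h * K)"
      using exp_ge_add_one_self[of "h * K"] by linarith
    then show "0 \<le> 1 - h * chord_slope (p k) (p (Suc k)) \<and> 1 - h * chord_slope (p k) (p (Suc k)) \<le> exp (h * K)"
      using step_map_deriv_ge[OF assms, of "p k" "p (Suc k)"] by linarith
  qed
  also have "\<dots> = exp (real n * h * K)" by (simp add: exp_of_nat_mult mult.assoc)
  finally have 1: "(\<Prod>k<n. 1 - h * chord_slope (p k) (p (Suc k))) \<le> exp (real n * h * K)" .
  have 2: "exp (- (\<Sum>k<n. h * (chord_mean (p k) (p (Suc k)))\<^sup>2) / 2) \<le> 1"
    using assms by (simp add: sum_nonneg)
  have 3: "0 \<le> (\<Prod>k<n. 1 - h * chord_slope (p k) (p (Suc k)))"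
    using step_map_deriv_ge[OF assms] by (intro prod_nonneg) (smt (verit, best) half_gt_zero_iff)
  show ?thesis
    unfolding prod_step_density
    using mult_mono[OF 2 1] 3 by (simp add: mult.assoc mult_left_mono)
qed

text \<open>Squared chord means and chord slopes form two Riemann sums whose diagonal values are the
  square of the drift and half its derivative; with the factor 1/2 on the first, they make up half
  of the potential.\<close>

lemma prod_step_density_limit:
  assumes \<omega>: "continuous_on {0..T} \<omega>" and T: "0 < T"
  shows "(\<lambda>n. \<Prod>k<n. step_density (T / n) (\<omega> (real k * (T / n))) (\<omega> (real (Suc k) * (T / n))))
    \<longlonglongrightarrow> exp (A (\<omega> T) - A (\<omega> 0)) * weight \<mu> T \<omega>"
proof -
  let ?p = "\<lambda>n k. \<omega> (real k * (T / real n))"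
  have fs: "continuous_on ({0..T} \<times> {0..T}) (\<lambda>p. \<omega> (fst p))" "continuous_on ({0..T} \<times> {0..T}) (\<lambda>p. \<omega> (snd p))"
    by (auto intro!: continuous_on_compose2[OF \<omega>] continuous_intros)
  have m: "(\<lambda>n. \<Sum>k<n. T / n * (chord_mean (?p n k) (?p n (Suc k)))\<^sup>2)
      \<longlonglongrightarrow> integral {0..T} (\<lambda>s. (chord_mean (\<omega> s) (\<omega> s))\<^sup>2)"
    by (rule two_point_riemann_sum[OF _ T]) (intro continuous_intros fs)
  have r: "(\<lambda>n. \<Sum>k<n. T / n * chord_slope (?p n k) (?p n (Suc k)))
      \<longlonglongrightarrow> integral {0..T} (\<lambda>s. chord_slope (\<omega> s) (\<omega> s))"
    by (rule two_point_riemann_sum[OF _ T]) (intro continuous_intros fs)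
  have "(\<lambda>n. \<Prod>k<n. 1 - T / n * chord_slope (?p n k) (?p n (Suc k)))
      \<longlonglongrightarrow> exp (- integral {0..T} (\<lambda>s. chord_slope (\<omega> s) (\<omega> s)))"
  proof (rule prod_one_minus_limit[OF _ r])
    fix n k :: nat
    show "\<bar>T / n * chord_slope (?p n k) (?p n (Suc k))\<bar> \<le> (T * K) / n"
      using T chord_slope_bound by (simp add: abs_mult divide_right_mono)
  qed
  from tendsto_mult[OF tendsto_mult[OF tendsto_const[of "exp (A (\<omega> T) - A (\<omega> 0))"]
      tendsto_exp[OF tendsto_divide[OF tendsto_minus[OF m] tendsto_const[of 2]]]] this]
  have "(\<lambda>n. exp (A (\<omega> T) - A (\<omega> 0))
        * exp (- (\<Sum>k<n. T / n * (chord_mean (?p n k) (?p n (Suc k)))\<^sup>2) / 2)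
        * (\<Prod>k<n. 1 - T / n * chord_slope (?p n k) (?p n (Suc k))))
      \<longlonglongrightarrow> exp (A (\<omega> T) - A (\<omega> 0)) * exp (- integral {0..T} (\<lambda>s. (chord_mean (\<omega> s) (\<omega> s))\<^sup>2) / 2)
        * exp (- integral {0..T} (\<lambda>s. chord_slope (\<omega> s) (\<omega> s)))"
    by simp
  note lim = this
  have weight: "exp (- integral {0..T} (\<lambda>s. (chord_mean (\<omega> s) (\<omega> s))\<^sup>2) / 2)
        * exp (- integral {0..T} (\<lambda>s. chord_slope (\<omega> s) (\<omega> s))) = weight \<mu> T \<omega>"
  proof -
    have "integral {0..T} (\<lambda>s. drift_potential \<mu> (\<omega> s))
        = integral {0..T} (\<lambda>s. (\<mu> (\<omega> s))\<^sup>2) + integral {0..T} (\<lambda>s. \<mu>' (\<omega> s))"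
      unfolding drift_potential_def deriv_mu
      by (intro integral_add integrable_continuous_real continuous_intros \<omega>)
    then show ?thesis
      by (simp add: weight_def chord_slope_same add_divide_distrib flip: exp_add)
  qed
  \<comment> \<open>For \<open>n = 0\<close> the mesh is 0 by convention; for positive
    \<open>n\<close> the last grid point is \<open>T\<close>, which produces
    \<open>A (\<omega> T)\<close>.\<close>
  have "\<forall>\<^sub>F n in sequentially. exp (A (\<omega> T) - A (\<omega> 0))
        * exp (- (\<Sum>k<n. T / n * (chord_mean (?p n k) (?p n (Suc k)))\<^sup>2) / 2)
        * (\<Prod>k<n. 1 - T / n * chord_slope (?p n k) (?p n (Suc k)))
      = (\<Prod>k<n. step_density (T / n) (?p n k) (?p n (Suc k)))"
    using eventually_gt_at_top[of 0]
    by eventually_elim (subst prod_step_density[of _ "?p n" for n], simp)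
  from Lim_transform_eventually[OF lim this] show ?thesis
    by (simp only: mult.assoc weight)
qed

section \<open>The implicit scheme along a solution path\<close>

primrec implicit_walk :: "real \<Rightarrow> real \<Rightarrow> (nat \<Rightarrow> real) \<Rightarrow> nat \<Rightarrow> real" where
  "implicit_walk h x w 0 = x"
| "implicit_walk h x w (Suc k) = step h (implicit_walk h x w k) (w k)"

text \<open>The solution obeys the implicit recursion up to replacing its integral over a cell by
  \<open>h * chord_mean\<close> of the end values, an error of at most \<open>2 * K * e * h\<close>.
  A discrete Gronwall argument accumulates these errors.\<close>

lemma implicit_walk_error:
  fixes n k :: nat
  assumes T: "0 < T" and n: "0 < n" "T / n * K \<le> 1/2"
    and X: "continuous_on {0..T} X" and x: "X 0 = x"
    and sde: "\<And>t. t \<in> {0..T} \<Longrightarrow> X t = x + integral {0..t} (\<lambda>s. \<mu> (X s)) + W t"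
    and osc: "\<And>s t. s \<in> {0..T} \<Longrightarrow> t \<in> {0..T} \<Longrightarrow> \<bar>s - t\<bar> \<le> T / n \<Longrightarrow> \<bar>X s - X t\<bar> \<le> e"
    and k: "k \<le> n"
  shows "\<bar>X (real k * (T / n)) - implicit_walk (T / n) x (\<lambda>i. W (real (Suc i) * (T / n)) - W (real i * (T / n))) k\<bar>
    \<le> exp (4 * K * T) * e"
proof -
  define h where "h = T / n"
  define Y where "Y = implicit_walk h x (\<lambda>i. W (real (Suc i) * h) - W (real i * h))"
  have h: "0 < h" "h * K \<le> 1/2" using T n by (auto simp: h_def)
  have e: "0 \<le> e" using osc[of 0 0] T n by simp
  have contmu: "continuous_on {0..T} (\<lambda>s. \<mu> (X s))" by (intro continuous_intros X)
  \<comment> \<open>Adding \<open>e\<close> to the error turns the affine recursion into a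
    multiplicative one.\<close>
  have "\<bar>X (real k * h) - Y k\<bar> + e \<le> (1 + 4 * (h * K)) ^ k * e" if "k \<le> n" for k
    using that
  proof (induction k)
    case 0
    then show ?case by (simp add: Y_def x)
  next
    case (Suc k)
    let ?a = "real k * h" and ?b = "real (Suc k) * h"
    have mem: "?a \<in> {0..T}" "?b \<in> {0..T}"
      using grid_mem[of k n T] grid_mem[of "Suc k" n T] Suc.prems n T by (auto simp: h_def)
    have ab: "?b - ?a = h" by (simp add: algebra_simps)
    define I where "I = integral {?a..?b} (\<lambda>s. \<mu> (X s))"
    have "\<bar>I - (?b - ?a) * chord_mean (X ?a) (X ?b)\<bar> \<le> (2 * K * e) * (?b - ?a)"
      unfolding I_def
    proof (rule integral_diff_const_le)
      show "?a \<le> ?b" using ab h by linarith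
      show "continuous_on {?a..?b} (\<lambda>s. \<mu> (X s))"
        by (rule continuous_on_subset[OF contmu]) (use mem in auto)
      fix s assume s: "s \<in> {?a..?b}"
      have "s \<in> {0..T}" "\<bar>s - ?a\<bar> \<le> h" "\<bar>s - ?b\<bar> \<le> h"
        using s mem ab unfolding atLeastAtMost_iff by linarith+
      then have "\<bar>X s - X ?a\<bar> \<le> e" "\<bar>X s - X ?b\<bar> \<le> e"
        using mem osc by (simp_all only: h_def)
      then have "K * (\<bar>X s - X ?a\<bar> + \<bar>X s - X ?b\<bar>) \<le> K * (2 * e)"
        using K_nonneg by (intro mult_left_mono) auto
      \<comment> \<open>\<open>\<mu> (X s)\<close> is the chord mean of the degenerate segment at
        \<open>X s\<close>, to be compared with the two ends of the cell.\<close>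
      then show "\<bar>\<mu> (X s) - chord_mean (X ?a) (X ?b)\<bar> \<le> 2 * K * e"
        using chord_mean_lip[of "X s" "X s" "X ?a" "X ?b"] by simp
    qed
    then have I: "\<bar>I - h * chord_mean (X ?a) (X ?b)\<bar> \<le> 2 * (h * K) * e"
      unfolding ab by (simp add: ac_simps)
    have "integral {0..?b} (\<lambda>s. \<mu> (X s)) = integral {0..?a} (\<lambda>s. \<mu> (X s)) + I"
      unfolding h_def I_def by (rule integral_grid_step[OF contmu Suc.prems T])
    then have X: "X ?b = X ?a + I + (W ?b - W ?a)"
      using sde[OF mem(1)] sde[OF mem(2)] by simp
    have Y: "Y (Suc k) = Y k + (W ?b - W ?a) + h * chord_mean (Y k) (Y (Suc k))"
      using step_eq[OF h, of "Y k" "W ?b - W ?a"] by (simp add: Y_def)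
    let ?E = "\<bar>X ?a - Y k\<bar>" and ?F = "\<bar>X ?b - Y (Suc k)\<bar>"
    define c where "c = chord_mean (X ?a) (X ?b) - chord_mean (Y k) (Y (Suc k))"
    have "\<bar>h * c\<bar> \<le> h * (K * (?E + ?F))"
      unfolding abs_mult c_def using h chord_mean_lip by (simp add: mult_left_mono)
    moreover have "X ?b - Y (Suc k) = (X ?a - Y k) + (I - h * chord_mean (X ?a) (X ?b)) + h * c"
    proof -
      have "h * c = h * chord_mean (X ?a) (X ?b) - h * chord_mean (Y k) (Y (Suc k))"
        unfolding c_def by (rule right_diff_distrib)
      then show ?thesis using X Y by linarith
    qed
    ultimately have F: "?F \<le> ?E + 2 * (h * K) * e + (h * K) * (?E + ?F)"
      using I by (simp add: mult.assoc)
    define a where "a = h * K"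
    have a: "0 \<le> a" "a \<le> 1/2" using h K_nonneg by (auto simp: a_def)
    \<comment> \<open>Adding \<open>(1 - a) * e\<close> to both sides absorbs the local error
      \<open>2 * a * e\<close> exactly.\<close>
    have "(1 - a) * (?F + e) \<le> (1 + a) * (?E + e)"
      using F unfolding a_def[symmetric] by (simp add: algebra_simps)
    also have "\<dots> \<le> ((1 - a) * (1 + 4 * a)) * (?E + e)"
    proof (rule mult_right_mono)
      \<comment> \<open>The difference of the two sides below is \<open>2 * a * (1 - 2 * a)\<close>,
        which is nonnegative for \<open>a\<close> between 0 and 1/2.\<close>
      have "a * a \<le> a * (1/2)" using a by (intro mult_left_mono) auto
      then show "1 + a \<le> (1 - a) * (1 + 4 * a)" by (simp add: algebra_simps)
    qed (use e in simp)
    finally have "?F + e \<le> (1 + 4 * a) * (?E + e)"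
      using a by (simp add: mult.assoc)
    also have "\<dots> \<le> (1 + 4 * a) * ((1 + 4 * a) ^ k * e)"
      using Suc a by (intro mult_left_mono) (auto simp: a_def)
    finally show ?case by (simp add: a_def)
  qed
  from this[OF k] have "\<bar>X (real k * h) - Y k\<bar> \<le> (1 + 4 * (h * K)) ^ k * e" using e by linarith
  also have "(1 + 4 * (h * K)) ^ k \<le> exp (4 * (h * K)) ^ k"
    using h K_nonneg exp_ge_add_one_self[of "4 * (h * K)"] by (intro power_mono) auto
  also have "\<dots> = exp (4 * K * (real k * h))" by (simp add: exp_of_nat_mult[symmetric] ac_simps)
  also have "\<dots> \<le> exp (4 * K * T)"
  proof -
    have "real k * h \<le> T" using grid_mem[OF k n(1), of T] T by (simp add: h_def)
    then have "4 * K * (real k * h) \<le> 4 * K * T" using K_nonneg by (intro mult_left_mono) auto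
    then show ?thesis by simp
  qed
  finally show ?thesis using e by (simp add: Y_def h_def mult_right_mono)
qed

end

lemma grid_index:
  fixes T s :: real and n :: nat
  assumes "s \<in> {0..T}" "0 < T" "0 < n"
  defines "k \<equiv> nat \<lfloor>s * n / T\<rfloor>"
  shows "k \<le> n" "\<bar>real k * (T / n) - s\<bar> \<le> T / n"
proof -
  have "s * n / T \<le> n" using assms by (simp add: field_simps mult_right_mono)
  moreover have "0 \<le> s * n / T" using assms by simp
  ultimately show "k \<le> n" unfolding k_def by linarith
  have "real k \<le> s * n / T" "s * n / T \<le> real k + 1"
    using \<open>0 \<le> s * n / T\<close> unfolding k_def by linarith+
  then have "real k * (T / n) \<le> s" "s \<le> (real k + 1) * (T / n)"
    using assms by (auto simp: field_simps)
  then show "\<bar>real k * (T / n) - s\<bar> \<le> T / n" by (simp add: algebra_simps add_divide_distrib)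
qed

lemma grid_point_limit:
  fixes T s :: real
  assumes "s \<in> {0..T}" "0 < T"
  shows "(\<lambda>n. real (nat \<lfloor>s * n / T\<rfloor>) * (T / n)) \<longlonglongrightarrow> s"
proof -
  have "(\<lambda>n. real (nat \<lfloor>s * n / T\<rfloor>) * (T / n) - s) \<longlonglongrightarrow> 0"
  proof (rule Lim_null_comparison)
    show "(\<lambda>n. T / real n) \<longlonglongrightarrow> 0" by (rule lim_const_over_n)
    show "\<forall>\<^sub>F n in sequentially. norm (real (nat \<lfloor>s * n / T\<rfloor>) * (T / n) - s) \<le> T / n"
      using eventually_gt_at_top[of 0] by eventually_elim (use grid_index[OF assms] in auto)
  qed
  then show ?thesis by (rule iffD2[OF Lim_null])
qed

lemma grid_value_limit:
  fixes T s :: real and \<omega> :: "real \<Rightarrow> real"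
  assumes \<omega>: "continuous_on {0..T} \<omega>" and s: "s \<in> {0..T}" "0 < T"
  shows "(\<lambda>n. \<omega> (real (nat \<lfloor>s * n / T\<rfloor>) * (T / n))) \<longlonglongrightarrow> \<omega> s"
proof (rule continuous_on_tendsto_compose[OF \<omega> grid_point_limit[OF s] s(1)])
  show "\<forall>\<^sub>F n in sequentially. real (nat \<lfloor>s * n / T\<rfloor>) * (T / n) \<in> {0..T}"
    using eventually_gt_at_top[of 0]
    by eventually_elim (intro grid_mem grid_index s; use s in simp)
qed

context smooth_drift
begin

lemma implicit_walk_limit:
  assumes T: "0 < T" and X: "continuous_on {0..T} X" and x: "X 0 = x"
    and sde: "\<And>t. t \<in> {0..T} \<Longrightarrow> X t = x + integral {0..t} (\<lambda>s. \<mu> (X s)) + W t"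
    and s: "s \<in> {0..T}"
  shows "(\<lambda>n. implicit_walk (T / n) x (\<lambda>i. W (real (Suc i) * (T / n)) - W (real i * (T / n)))
    (nat \<lfloor>s * n / T\<rfloor>)) \<longlonglongrightarrow> X s"
proof -
  let ?k = "\<lambda>n. nat \<lfloor>s * real n / T\<rfloor>"
  let ?Y = "\<lambda>n. implicit_walk (T / n) x (\<lambda>i. W (real (Suc i) * (T / n)) - W (real i * (T / n))) (?k n)"
  have "(\<lambda>n. X (real (?k n) * (T / n)) - ?Y n) \<longlonglongrightarrow> 0"
  proof (rule LIMSEQ_I)
    fix r :: real assume r: "0 < r"
    \<comment> \<open>Cancels the Gronwall factor and leaves \<open>r / 2\<close>.\<close>
    define e where "e = r / (2 * exp (4 * K * T))"
    have e: "0 < e" using r by (simp add: e_def)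
    have "uniformly_continuous_on {0..T} X" by (intro compact_uniformly_continuous X) auto
    then obtain d where d: "0 < d"
      and dd: "\<And>s t. s \<in> {0..T} \<Longrightarrow> t \<in> {0..T} \<Longrightarrow> dist t s < d \<Longrightarrow> dist (X t) (X s) < e"
      unfolding uniformly_continuous_on_def using e by metis
    \<comment> \<open>The threshold makes the mesh smaller than \<open>d\<close> and ensures
      \<open>T / n * K \<le> 1/2\<close>.\<close>
    obtain n0 :: nat where n0: "max (T / d) (2 * T * K) < real n0" using reals_Archimedean2 by blast
    show "\<exists>no. \<forall>n\<ge>no. norm (X (real (?k n) * (T / n)) - ?Y n - 0) < r"
    proof (intro exI[of _ "max 1 n0"] allI impI)
      fix n assume n: "max 1 n0 \<le> n"
      have "T / d < real n" "2 * T * K \<le> real n" using n n0 by linarith+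
      then have "T / n < d" "T / n * K \<le> 1/2" using d n by (auto simp: field_simps)
      have osc: "\<bar>X s - X t\<bar> \<le> e" if "s \<in> {0..T}" "t \<in> {0..T}" "\<bar>s - t\<bar> \<le> T / n" for s t
        using dd[OF that(2,1)] that(3) \<open>T / n < d\<close> by (simp add: dist_real_def)
      from \<open>T / n * K \<le> 1/2\<close> have "\<bar>X (real (?k n) * (T / n)) - ?Y n\<bar> \<le> exp (4 * K * T) * e"
        using n grid_index(1)[OF s T, of n]
        by (intro implicit_walk_error[OF T _ _ X x sde] osc) auto
      also have "\<dots> < r" using r by (simp add: e_def)
      finally show "norm (X (real (?k n) * (T / n)) - ?Y n - 0) < r" by simp
    qed
  qed
  from tendsto_diff[OF grid_value_limit[OF X s T] this] show ?thesis by simp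
qed

end

section \<open>Gaussian increments\<close>

text \<open>The parameter is the variance, whereas \<open>normal_density\<close> takes the standard
  deviation.\<close>

abbreviation centred_normal :: "real \<Rightarrow> real measure" where
  "centred_normal v \<equiv> density lborel (\<lambda>z. ennreal (normal_density 0 (sqrt v) z))"

lemma prob_space_centred_normal: "0 < v \<Longrightarrow> prob_space (centred_normal v)"
  by (rule prob_space_normal_density) simp

lemma increments_measurable:
  fixes t :: "nat \<Rightarrow> real"
  assumes W: "standard_brownian_motion \<Omega> T W"
    and t: "0 \<le> t 0" "\<And>i. i < n \<Longrightarrow> t i < t (Suc i)" "t n \<le> T" and i: "i < n"
  shows "(\<lambda>\<omega>. W (t (Suc i)) \<omega> - W (t i) \<omega>) \<in> borel_measurable \<Omega>" and "0 \<le> t i" and "t (Suc i) \<le> T"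
proof -
  have mono: "t i \<le> t j" if "i \<le> j" "j \<le> n" for i j
    using that
  proof (induction j rule: dec_induct)
    case (step j)
    then show ?case using t(2)[of j] by simp
  qed simp
  show range: "0 \<le> t i" "t (Suc i) \<le> T" using mono[of 0 i] mono[of "Suc i" n] i t by simp_all
  show "(\<lambda>\<omega>. W (t (Suc i)) \<omega> - W (t i) \<omega>) \<in> borel_measurable \<Omega>"
    using W range t(2)[OF i] by (intro borel_measurable_diff) (simp_all add: standard_brownian_motion_def continuous_process_def)
qed

lemma increments_law:
  fixes t :: "nat \<Rightarrow> real"
  assumes W: "standard_brownian_motion \<Omega> T W"
    and t: "0 \<le> t 0" "\<And>i. i < n \<Longrightarrow> t i < t (Suc i)" "t n \<le> T" and n: "0 < n"
  shows "distr \<Omega> (Pi\<^sub>M {..<n} (\<lambda>_. borel)) (\<lambda>\<omega>. \<lambda>i\<in>{..<n}. W (t (Suc i)) \<omega> - W (t i) \<omega>)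
    = Pi\<^sub>M {..<n} (\<lambda>i. centred_normal (t (Suc i) - t i))"
proof -
  interpret prob_space \<Omega> using W by (simp add: standard_brownian_motion_def)
  note incr = increments_measurable[where n = n, OF W t]
  have "indep_vars (\<lambda>_. borel) (\<lambda>i \<omega>. W (t (Suc i)) \<omega> - W (t i) \<omega>) {..<n}"
    using W t by (auto simp: standard_brownian_motion_def)
  \<comment> \<open>Independence is equivalent to a product law for a nonempty index set, whence
    \<open>0 < n\<close>.\<close>
  then have "distr \<Omega> (Pi\<^sub>M {..<n} (\<lambda>_. borel)) (\<lambda>\<omega>. \<lambda>i\<in>{..<n}. W (t (Suc i)) \<omega> - W (t i) \<omega>)
      = Pi\<^sub>M {..<n} (\<lambda>i. distr \<Omega> borel (\<lambda>\<omega>. W (t (Suc i)) \<omega> - W (t i) \<omega>))"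
    using n incr(1) by (subst (asm) indep_vars_iff_distr_eq_PiM') auto
  also have "\<dots> = Pi\<^sub>M {..<n} (\<lambda>i. centred_normal (t (Suc i) - t i))"
  proof (intro PiM_cong refl)
    fix i assume i: "i \<in> {..<n}"
    have "distributed \<Omega> lborel (\<lambda>\<omega>. W (t (Suc i)) \<omega> - W (t i) \<omega>)
        (\<lambda>z. ennreal (normal_density 0 (sqrt (t (Suc i) - t i)) z))"
      using W i t(2)[of i] incr(2,3)[of i] by (auto simp: standard_brownian_motion_def)
    from distributed_distr_eq_density[OF this]
    show "distr \<Omega> borel (\<lambda>\<omega>. W (t (Suc i)) \<omega> - W (t i) \<omega>) = centred_normal (t (Suc i) - t i)"
      by (subst distr_cong[OF refl sets_lborel[symmetric]]) auto
  qed
  finally show ?thesis .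
qed

lemma nn_integral_increments:
  fixes t :: "nat \<Rightarrow> real"
  assumes W: "standard_brownian_motion \<Omega> T W"
    and t: "0 \<le> t 0" "\<And>i. i < n \<Longrightarrow> t i < t (Suc i)" "t n \<le> T" and n: "0 < n"
    and f: "f \<in> borel_measurable (Pi\<^sub>M {..<n} (\<lambda>_. borel))"
  shows "(\<integral>\<^sup>+\<omega>. f (\<lambda>i\<in>{..<n}. W (t (Suc i)) \<omega> - W (t i) \<omega>) \<partial>\<Omega>)
    = (\<integral>\<^sup>+w. f w \<partial>Pi\<^sub>M {..<n} (\<lambda>i. centred_normal (t (Suc i) - t i)))"
proof -
  have "(\<lambda>\<omega>. \<lambda>i\<in>{..<n}. W (t (Suc i)) \<omega> - W (t i) \<omega>) \<in> measurable \<Omega> (Pi\<^sub>M {..<n} (\<lambda>_. borel))"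
    by (intro measurable_restrict increments_measurable[where n = n, OF W t]) auto
  then have "(\<integral>\<^sup>+\<omega>. f (\<lambda>i\<in>{..<n}. W (t (Suc i)) \<omega> - W (t i) \<omega>) \<partial>\<Omega>)
      = (\<integral>\<^sup>+w. f w \<partial>distr \<Omega> (Pi\<^sub>M {..<n} (\<lambda>_. borel)) (\<lambda>\<omega>. \<lambda>i\<in>{..<n}. W (t (Suc i)) \<omega> - W (t i) \<omega>))"
    by (rule nn_integral_distr[symmetric]) (simp add: f)
  also note increments_law[OF W t n]
  finally show ?thesis .
qed

section \<open>The Gaussian walk and the implicit walk\<close>

definition walk :: "real \<Rightarrow> (nat \<Rightarrow> real) \<Rightarrow> nat \<Rightarrow> real" where
  "walk x w k = x + (\<Sum>i<k. w i)"

lemma walk_simps [simp]: "walk x w 0 = x" "walk x w (Suc k) = walk x w k + w k"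
  by (simp_all add: walk_def)

lemma walk_fun_upd: "k \<le> n \<Longrightarrow> walk x (w(n := y)) k = walk x w k"
  by (simp add: walk_def)

lemma walk_measurable:
  "k \<le> n \<Longrightarrow> (\<lambda>w. walk x w k) \<in> borel_measurable (Pi\<^sub>M {..<n} (\<lambda>_. borel))"
  unfolding walk_def
  by (intro borel_measurable_add borel_measurable_sum borel_measurable_const measurable_component_singleton) auto

context smooth_drift
begin

text \<open>The position after \<open>k\<close> steps sees the first \<open>k\<close> increments
  only; this is what makes the shift triangular.\<close>

lemma implicit_walk_cong:
  "(\<And>i. i < k \<Longrightarrow> w i = w' i) \<Longrightarrow> implicit_walk h x w k = implicit_walk h x w' k"
  by (induction k) auto

lemma implicit_walk_measurable:
  assumes h: "0 < h" "h * K \<le> 1/2"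
  shows "k \<le> n \<Longrightarrow> (\<lambda>w. implicit_walk h x w k) \<in> borel_measurable (Pi\<^sub>M {..<n} (\<lambda>_. borel))"
proof (induction k)
  case (Suc k)
  then show ?case
    by (auto intro!: step_measurable[OF h] measurable_component_singleton)
qed simp

text \<open>The shift that turns the Gaussian walk into the implicit walk is triangular, so that the
  density of the walk is the product of the one-step densities.\<close>

lemma nn_integral_implicit_walk:
  assumes h: "0 < h" "h * K \<le> 1/2"
    and \<phi>: "\<And>k. \<phi> k \<in> borel_measurable borel"
  shows "(\<integral>\<^sup>+w. (\<Prod>k\<le>n. \<phi> k (implicit_walk h x w k)) \<partial>Pi\<^sub>M {..<n} (\<lambda>_. centred_normal h))
    = (\<integral>\<^sup>+w. (\<Prod>k\<le>n. \<phi> k (walk x w k))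
        * (\<Prod>k<n. ennreal (step_density h (walk x w k) (walk x w (Suc k))))
      \<partial>Pi\<^sub>M {..<n} (\<lambda>_. centred_normal h))"
  using \<phi>
proof (induction n arbitrary: \<phi>)
  case 0
  then show ?case by simp
next
  case (Suc n)
  note [measurable] = Suc.prems
  interpret N: prob_space "centred_normal h" by (rule prob_space_centred_normal[OF h(1)])
  interpret product_sigma_finite "\<lambda>_::nat. centred_normal h" ..
  let ?N = "\<lambda>n. Pi\<^sub>M {..<n} (\<lambda>_. centred_normal h)"
  let ?D = "\<lambda>n p. \<Prod>k<n. ennreal (step_density h (p k) (p (Suc k)))"
  have sets_Pi: "sets (Pi\<^sub>M I (\<lambda>_. centred_normal h)) = sets (Pi\<^sub>M I (\<lambda>_. borel))" for I :: "nat set"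
    by (intro sets_PiM_cong) auto
  have iw: "(\<lambda>w. implicit_walk h x w k) \<in> borel_measurable (?N m)"
    if "k \<le> m" for k m
    using implicit_walk_measurable[OF h that] by (simp add: measurable_cong_sets[OF sets_Pi refl])
  have wm: "(\<lambda>w. walk x w k) \<in> borel_measurable (?N m)"
    if "k \<le> m" for k m
    using walk_measurable[OF that] by (simp add: measurable_cong_sets[OF sets_Pi refl])
  \<comment> \<open>\<open>\<psi> u\<close> is the contribution of the last step started from
    \<open>u\<close>. It is merged into the test function at index \<open>n\<close>, which is why
    the induction keeps the test functions arbitrary.\<close>
  define \<psi> where "\<psi> u = (\<integral>\<^sup>+y. \<phi> (Suc n) (u + y) * ennreal (step_density h u (u + y)) \<partial>centred_normal h)" for u
  have [measurable]: "\<psi> \<in> borel_measurable borel"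
    unfolding \<psi>_def[abs_def] by measurable
  define \<phi>' where "\<phi>' = \<phi>(n := \<lambda>u. \<phi> n u * \<psi> u)"
  have \<phi>'_meas: "\<phi>' k \<in> borel_measurable borel" for k
    by (auto simp: \<phi>'_def)
  have prod_\<phi>': "(\<Prod>k\<le>n. \<phi>' k (p k)) = (\<Prod>k\<le>n. \<phi> k (p k)) * \<psi> (p n)" for p :: "nat \<Rightarrow> real"
    by (cases n) (simp_all add: \<phi>'_def mult_ac)
  have "(\<integral>\<^sup>+w. (\<Prod>k\<le>Suc n. \<phi> k (implicit_walk h x w k)) \<partial>?N (Suc n))
      = (\<integral>\<^sup>+w. \<integral>\<^sup>+y. (\<Prod>k\<le>Suc n. \<phi> k (implicit_walk h x (w(n := y)) k)) \<partial>centred_normal h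
        \<partial>?N n)"
    unfolding lessThan_Suc
  proof (rule product_nn_integral_insert)
    show "(\<lambda>w. \<Prod>k\<le>Suc n. \<phi> k (implicit_walk h x w k))
        \<in> borel_measurable (Pi\<^sub>M (insert n {..<n}) (\<lambda>_. centred_normal h))"
      unfolding lessThan_Suc[symmetric]
      by (intro borel_measurable_prod_ennreal measurable_compose[OF iw Suc.prems]) simp
  qed auto
  \<comment> \<open>Only the last position depends on the last increment; the one-step formula turns
    its integral into \<open>\<psi>\<close>.\<close>
  also have "\<dots> = (\<integral>\<^sup>+w. (\<Prod>k\<le>n. \<phi>' k (implicit_walk h x w k)) \<partial>?N n)"
  proof (intro nn_integral_cong)
    fix w
    have *: "implicit_walk h x (w(n := y)) k = implicit_walk h x w k" if "k \<le> n" for y k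
      using that by (intro implicit_walk_cong) auto
    have "(\<integral>\<^sup>+y. (\<Prod>k\<le>Suc n. \<phi> k (implicit_walk h x (w(n := y)) k)) \<partial>centred_normal h)
        = (\<integral>\<^sup>+y. (\<Prod>k\<le>n. \<phi> k (implicit_walk h x w k)) * \<phi> (Suc n) (step h (implicit_walk h x w n) y) \<partial>centred_normal h)"
      by (simp add: *)
    also have "\<dots> = (\<Prod>k\<le>n. \<phi> k (implicit_walk h x w k))
        * (\<integral>\<^sup>+y. \<phi> (Suc n) (step h (implicit_walk h x w n) y) \<partial>centred_normal h)"
      by (rule nn_integral_cmult) (intro measurable_compose[OF _ Suc.prems] step_measurable[OF h]; simp)
    also have "\<dots> = (\<Prod>k\<le>n. \<phi>' k (implicit_walk h x w k))"
      unfolding prod_\<phi>' \<psi>_def nn_integral_step[OF h Suc.prems] ..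
    finally show "(\<integral>\<^sup>+y. (\<Prod>k\<le>Suc n. \<phi> k (implicit_walk h x (w(n := y)) k)) \<partial>centred_normal h)
        = (\<Prod>k\<le>n. \<phi>' k (implicit_walk h x w k))" .
  qed
  also have "\<dots> = (\<integral>\<^sup>+w. (\<Prod>k\<le>n. \<phi>' k (walk x w k))
        * ?D n (walk x w)
      \<partial>?N n)"
    by (rule Suc.IH[OF \<phi>'_meas])
  \<comment> \<open>Now \<open>\<psi>\<close> is unfolded on the side of the Gaussian walk, which
    restores the last increment.\<close>
  also have "\<dots> = (\<integral>\<^sup>+w. \<integral>\<^sup>+y. (\<Prod>k\<le>Suc n. \<phi> k (walk x (w(n := y)) k))
        * ?D (Suc n) (walk x (w(n := y)))
        \<partial>centred_normal h \<partial>?N n)"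
  proof (intro nn_integral_cong)
    fix w
    have "(\<Prod>k\<le>n. \<phi>' k (walk x w k)) * ?D n (walk x w)
        = ((\<Prod>k\<le>n. \<phi> k (walk x w k)) * ?D n (walk x w)) * \<psi> (walk x w n)"
      by (simp only: prod_\<phi>' mult_ac)
    also have "\<dots> = (\<integral>\<^sup>+y. ((\<Prod>k\<le>n. \<phi> k (walk x w k)) * ?D n (walk x w)) *
        (\<phi> (Suc n) (walk x w n + y) * ennreal (step_density h (walk x w n) (walk x w n + y))) \<partial>centred_normal h)"
      unfolding \<psi>_def by (rule nn_integral_cmult[symmetric]) measurable
    also have "\<dots> = (\<integral>\<^sup>+y. (\<Prod>k\<le>Suc n. \<phi> k (walk x (w(n := y)) k))
        * ?D (Suc n) (walk x (w(n := y))) \<partial>centred_normal h)"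
    proof (intro nn_integral_cong)
      fix y
      have 1: "(\<Prod>k\<le>n. \<phi> k (walk x (w(n := y)) k)) = (\<Prod>k\<le>n. \<phi> k (walk x w k))"
        by (intro prod.cong) (simp_all add: walk_fun_upd)
      have 2: "?D n (walk x (w(n := y))) = ?D n (walk x w)"
        by (intro prod.cong) (simp_all add: walk_fun_upd)
      have 3: "walk x (w(n := y)) n = walk x w n" "walk x (w(n := y)) (Suc n) = walk x w n + y"
        by (simp_all add: walk_fun_upd)
      show "((\<Prod>k\<le>n. \<phi> k (walk x w k)) * ?D n (walk x w)) *
        (\<phi> (Suc n) (walk x w n + y) * ennreal (step_density h (walk x w n) (walk x w n + y)))
        = (\<Prod>k\<le>Suc n. \<phi> k (walk x (w(n := y)) k))
        * ?D (Suc n) (walk x (w(n := y)))"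
        unfolding prod.atMost_Suc prod.lessThan_Suc 1 2 3 by (simp only: mult_ac)
    qed
    finally show "(\<Prod>k\<le>n. \<phi>' k (walk x w k)) * ?D n (walk x w)
      = (\<integral>\<^sup>+y. (\<Prod>k\<le>Suc n. \<phi> k (walk x (w(n := y)) k))
        * ?D (Suc n) (walk x (w(n := y))) \<partial>centred_normal h)" .
  qed
  also have "\<dots> = (\<integral>\<^sup>+w. (\<Prod>k\<le>Suc n. \<phi> k (walk x w k))
        * ?D (Suc n) (walk x w)
        \<partial>?N (Suc n))"
    unfolding lessThan_Suc[of n]
  proof (rule product_nn_integral_insert[symmetric])
    show "(\<lambda>w. (\<Prod>k\<le>Suc n. \<phi> k (walk x w k))
        * (\<Prod>k\<in>insert n {..<n}. ennreal (step_density h (walk x w k) (walk x w (Suc k)))))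
        \<in> borel_measurable (Pi\<^sub>M (insert n {..<n}) (\<lambda>_. centred_normal h))"
      unfolding lessThan_Suc[symmetric]
      by (intro borel_measurable_times_ennreal borel_measurable_prod_ennreal measurable_compose[OF wm Suc.prems]
          measurable_compose[OF _ measurable_ennreal] step_density_measurable wm) auto
  qed auto
  finally show ?case .
qed

end

section \<open>The Girsanov formula for product functionals\<close>

lemma isCont_from_on: "continuous_on UNIV f \<Longrightarrow> isCont f x"
  by (simp add: continuous_on_eq_continuous_at)

context smooth_drift
begin

text \<open>The weight contains an integral over the whole path. Up to an endpoint factor it is the
  pointwise limit of the discrete densities, each of which uses finitely many coordinates.\<close>

lemma weight_process_measurable:
  assumes Y: "continuous_process \<Omega> T Y" and T: "0 < T"
  shows "(\<lambda>\<omega>. weight \<mu> T (\<lambda>t. Y t \<omega>)) \<in> borel_measurable \<Omega>"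
proof -
  have meas [measurable]: "Y t \<in> borel_measurable \<Omega>" if "t \<in> {0..T}" for t
    using Y that by (simp add: continuous_process_def)
  have mu_meas [measurable]: "A \<in> borel_measurable borel"
    by (intro borel_measurable_continuous_onI continuous_intros)
  have [measurable]: "Y 0 \<in> borel_measurable \<Omega>" "Y T \<in> borel_measurable \<Omega>"
    using T by (auto intro!: meas)
  have "(\<lambda>\<omega>. exp (A (Y T \<omega>) - A (Y 0 \<omega>)) * weight \<mu> T (\<lambda>t. Y t \<omega>)) \<in> borel_measurable \<Omega>"
  proof (rule borel_measurable_LIMSEQ_real)
    fix \<omega> assume "\<omega> \<in> space \<Omega>"
    then have "continuous_on {0..T} (\<lambda>t. Y t \<omega>)" using Y by (simp add: continuous_process_def)
    from prod_step_density_limit[OF this T]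
    show "(\<lambda>n. \<Prod>k<n. step_density (T / n) (Y (real k * (T / n)) \<omega>) (Y (real (Suc k) * (T / n)) \<omega>))
      \<longlonglongrightarrow> exp (A (Y T \<omega>) - A (Y 0 \<omega>)) * weight \<mu> T (\<lambda>t. Y t \<omega>)" .
  next
    fix n :: nat
    show "(\<lambda>\<omega>. \<Prod>k<n. step_density (T / n) (Y (real k * (T / n)) \<omega>) (Y (real (Suc k) * (T / n)) \<omega>))
      \<in> borel_measurable \<Omega>"
    proof (intro borel_measurable_prod step_density_measurable meas)
      fix k assume "k \<in> {..<n}"
      then show "real k * (T / n) \<in> {0..T}" "real (Suc k) * (T / n) \<in> {0..T}"
        using grid_mem[of k n T] grid_mem[of "Suc k" n T] T by auto
    qed
  qed
  then have "(\<lambda>\<omega>. exp (A (Y T \<omega>) - A (Y 0 \<omega>)) * weight \<mu> T (\<lambda>t. Y t \<omega>) / exp (A (Y T \<omega>) - A (Y 0 \<omega>)))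
      \<in> borel_measurable \<Omega>"
    by (rule borel_measurable_divide) measurable
  then show ?thesis by simp
qed

text \<open>\<open>B 0\<close> is subtracted because it vanishes only almost surely, while the walk
  built from the increments starts exactly at \<open>x\<close>.\<close>

lemma discrete_girsanov:
  fixes n :: nat and \<phi> :: "real \<Rightarrow> real \<Rightarrow> real"
  assumes W: "standard_brownian_motion \<Omega> T W" and B: "standard_brownian_motion \<Omega>' T B"
    and T: "0 < T" and n: "0 < n" "T / n * K \<le> 1/2"
    and J: "finite J" "J \<subseteq> {0..T}"
    and \<phi>: "\<And>j. \<phi> j \<in> borel_measurable borel" "\<And>j v. 0 \<le> \<phi> j v"
  shows "(\<integral>\<^sup>+\<omega>. ennreal (\<Prod>j\<in>J. \<phi> j (implicit_walk (T / n) x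
        (\<lambda>i. W (real (Suc i) * (T / n)) \<omega> - W (real i * (T / n)) \<omega>) (nat \<lfloor>j * n / T\<rfloor>))) \<partial>\<Omega>)
    = (\<integral>\<^sup>+\<omega>. ennreal ((\<Prod>j\<in>J. \<phi> j (x + B (real (nat \<lfloor>j * n / T\<rfloor>) * (T / n)) \<omega> - B 0 \<omega>))
        * (\<Prod>k<n. step_density (T / n) (x + B (real k * (T / n)) \<omega> - B 0 \<omega>)
            (x + B (real (Suc k) * (T / n)) \<omega> - B 0 \<omega>))) \<partial>\<Omega>')"
proof -
  define h where "h = T / n"
  have h: "0 < h" "h * K \<le> 1/2" using T n by (auto simp: h_def)
  define \<kappa> where "\<kappa> j = nat \<lfloor>j * n / T\<rfloor>" for j :: real
  have \<kappa>: "\<kappa> j \<le> n" if "j \<in> J" for j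
    using grid_index(1)[of j T n] that J T n by (auto simp: \<kappa>_def)
  \<comment> \<open>Several times in \<open>J\<close> can round to the same grid index;
    \<open>\<psi> k\<close> collects their test functions and is 1 if there are none.\<close>
  define \<psi> where "\<psi> k v = ennreal (\<Prod>j\<in>{j \<in> J. \<kappa> j = k}. \<phi> j v)" for k v
  have \<psi>: "\<psi> k \<in> borel_measurable borel" for k
    unfolding \<psi>_def[abs_def] by (intro measurable_compose[OF _ measurable_ennreal] borel_measurable_prod \<phi>)
  have group: "(\<Prod>k\<le>n. \<psi> k (p k)) = ennreal (\<Prod>j\<in>J. \<phi> j (p (\<kappa> j)))" for p :: "nat \<Rightarrow> real"
  proof -
    have "(\<Prod>k\<le>n. \<psi> k (p k)) = ennreal (\<Prod>k\<le>n. \<Prod>j\<in>{j \<in> J. \<kappa> j = k}. \<phi> j (p k))"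
      unfolding \<psi>_def by (rule prod_ennreal) (intro prod_nonneg \<phi>)
    also have "(\<Prod>k\<le>n. \<Prod>j\<in>{j \<in> J. \<kappa> j = k}. \<phi> j (p k)) = (\<Prod>k\<le>n. \<Prod>j\<in>{j \<in> J. \<kappa> j = k}. \<phi> j (p (\<kappa> j)))"
      by (intro prod.cong) auto
    also have "\<dots> = (\<Prod>j\<in>J. \<phi> j (p (\<kappa> j)))"
      by (rule prod.group) (use J \<kappa> in auto)
    finally show ?thesis .
  qed
  have grid: "0 \<le> real 0 * h" "\<And>i. i < n \<Longrightarrow> real i * h < real (Suc i) * h" "real n * h \<le> T"
    using h(1) n(1) by (simp, simp add: distrib_right, simp add: h_def)
  have mesh: "real (Suc i) * h - real i * h = h" for i by (simp add: algebra_simps)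
  let ?N = "Pi\<^sub>M {..<n} (\<lambda>_. centred_normal h)"
  have "(\<integral>\<^sup>+\<omega>. ennreal (\<Prod>j\<in>J. \<phi> j (implicit_walk h x (\<lambda>i. W (real (Suc i) * h) \<omega> - W (real i * h) \<omega>) (\<kappa> j))) \<partial>\<Omega>)
      = (\<integral>\<^sup>+\<omega>. (\<Prod>k\<le>n. \<psi> k (implicit_walk h x (\<lambda>i\<in>{..<n}. W (real (Suc i) * h) \<omega> - W (real i * h) \<omega>) k)) \<partial>\<Omega>)"
  proof (intro nn_integral_cong)
    fix \<omega>
    have "implicit_walk h x (\<lambda>i\<in>{..<n}. W (real (Suc i) * h) \<omega> - W (real i * h) \<omega>) k
        = implicit_walk h x (\<lambda>i. W (real (Suc i) * h) \<omega> - W (real i * h) \<omega>) k" if "k \<le> n" for k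
      using that by (intro implicit_walk_cong) auto
    then show "ennreal (\<Prod>j\<in>J. \<phi> j (implicit_walk h x (\<lambda>i. W (real (Suc i) * h) \<omega> - W (real i * h) \<omega>) (\<kappa> j)))
        = (\<Prod>k\<le>n. \<psi> k (implicit_walk h x (\<lambda>i\<in>{..<n}. W (real (Suc i) * h) \<omega> - W (real i * h) \<omega>) k))"
      unfolding group by (intro arg_cong[where f = ennreal] prod.cong) (use \<kappa> in auto)
  qed
  also have "\<dots> = (\<integral>\<^sup>+w. (\<Prod>k\<le>n. \<psi> k (implicit_walk h x w k)) \<partial>?N)"
  proof -
    have "(\<lambda>w. \<Prod>k\<le>n. \<psi> k (implicit_walk h x w k)) \<in> borel_measurable (Pi\<^sub>M {..<n} (\<lambda>_. borel))"
      by (intro borel_measurable_prod_ennreal measurable_compose[OF implicit_walk_measurable[OF h] \<psi>]) auto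
    from nn_integral_increments[OF W grid n(1) this] show ?thesis unfolding mesh .
  qed
  also have "\<dots> = (\<integral>\<^sup>+w. (\<Prod>k\<le>n. \<psi> k (walk x w k))
        * (\<Prod>k<n. ennreal (step_density h (walk x w k) (walk x w (Suc k)))) \<partial>?N)"
    by (rule nn_integral_implicit_walk[OF h \<psi>])
  also have "\<dots> = (\<integral>\<^sup>+\<omega>. (\<lambda>w. (\<Prod>k\<le>n. \<psi> k (walk x w k))
        * (\<Prod>k<n. ennreal (step_density h (walk x w k) (walk x w (Suc k)))))
        (\<lambda>i\<in>{..<n}. B (real (Suc i) * h) \<omega> - B (real i * h) \<omega>) \<partial>\<Omega>')"
  proof -
    have "(\<lambda>w. (\<Prod>k\<le>n. \<psi> k (walk x w k)) * (\<Prod>k<n. ennreal (step_density h (walk x w k) (walk x w (Suc k)))))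
        \<in> borel_measurable (Pi\<^sub>M {..<n} (\<lambda>_. borel))"
      by (intro borel_measurable_times_ennreal borel_measurable_prod_ennreal measurable_compose[OF walk_measurable \<psi>]
          measurable_compose[OF _ measurable_ennreal] step_density_measurable walk_measurable) auto
    from nn_integral_increments[OF B grid n(1) this] show ?thesis unfolding mesh by (rule sym)
  qed
  also have "\<dots> = (\<integral>\<^sup>+\<omega>. ennreal ((\<Prod>j\<in>J. \<phi> j (x + B (real (\<kappa> j) * h) \<omega> - B 0 \<omega>))
        * (\<Prod>k<n. step_density h (x + B (real k * h) \<omega> - B 0 \<omega>) (x + B (real (Suc k) * h) \<omega> - B 0 \<omega>))) \<partial>\<Omega>')"
  proof (intro nn_integral_cong)
    fix \<omega>
    let ?p = "\<lambda>k. x + B (real k * h) \<omega> - B 0 \<omega>"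
    let ?q = "walk x (\<lambda>i\<in>{..<n}. B (real (Suc i) * h) \<omega> - B (real i * h) \<omega>)"
    have q: "?q k = ?p k" if "k \<le> n" for k
    proof -
      have "?q k = x + (\<Sum>i<k. B (real (Suc i) * h) \<omega> - B (real i * h) \<omega>)"
        unfolding walk_def using that by (intro arg_cong2[where f = "(+)"] sum.cong) auto
      then show ?thesis using sum_lessThan_telescope[of "\<lambda>i. B (real i * h) \<omega>" k] by simp
    qed
    have "(\<Prod>k\<le>n. \<psi> k (?q k)) = (\<Prod>k\<le>n. \<psi> k (?p k))"
      by (intro prod.cong refl arg_cong[where f = "\<psi> _"] q) simp
    moreover have "(\<Prod>k<n. ennreal (step_density h (?q k) (?q (Suc k))))
        = ennreal (\<Prod>k<n. step_density h (?p k) (?p (Suc k)))"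
    proof (subst prod_ennreal[symmetric])
      show "(\<Prod>k<n. ennreal (step_density h (?q k) (?q (Suc k)))) = (\<Prod>k<n. ennreal (step_density h (?p k) (?p (Suc k))))"
        by (intro prod.cong refl arg_cong[where f = ennreal] arg_cong2[where f = "step_density h"] q) auto
    qed (rule step_density_nonneg[OF h])
    ultimately show "(\<lambda>w. (\<Prod>k\<le>n. \<psi> k (walk x w k))
        * (\<Prod>k<n. ennreal (step_density h (walk x w k) (walk x w (Suc k)))))
        (\<lambda>i\<in>{..<n}. B (real (Suc i) * h) \<omega> - B (real i * h) \<omega>)
      = ennreal ((\<Prod>j\<in>J. \<phi> j (?p (\<kappa> j))) * (\<Prod>k<n. step_density h (?p k) (?p (Suc k))))"
      by (simp only: group) (simp add: ennreal_mult prod_nonneg \<phi> step_density_nonneg[OF h])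
  qed
  finally show ?thesis unfolding h_def \<kappa>_def .
qed

text \<open>The discrete formula passes to the limit by dominated convergence on both sides. On the
  Brownian side the hypothesis \<open>tail\<close> supplies the dominating constant.\<close>

lemma girsanov_functional:
  fixes \<phi> :: "real \<Rightarrow> real \<Rightarrow> real"
  assumes sde: "solves_sde \<Omega> T \<mu> x W X" and B: "standard_brownian_motion \<Omega>' T B" and T: "0 < T"
    and J: "finite J" "J \<subseteq> {0..T}" "T \<in> J"
    and \<phi>: "\<And>j. continuous_on UNIV (\<phi> j)" "\<And>j v. 0 \<le> \<phi> j v" "\<And>j v. \<phi> j v \<le> 1"
    and tail: "\<And>v. \<phi> T v * exp (A v) \<le> 1"
  shows "(\<integral>\<^sup>+\<omega>. ennreal (\<Prod>j\<in>J. \<phi> j (X j \<omega>)) \<partial>\<Omega>)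
    = (\<integral>\<^sup>+\<omega>. ennreal ((\<Prod>j\<in>J. \<phi> j (x + B j \<omega>))
        * (exp (A (x + B T \<omega>) - A x) * weight \<mu> T (\<lambda>t. x + B t \<omega>))) \<partial>\<Omega>')"
proof -
  have W: "standard_brownian_motion \<Omega> T W" and X: "continuous_process \<Omega> T X"
    and eq: "AE \<omega> in \<Omega>. \<forall>t\<in>{0..T}. X t \<omega> = x + integral {0..t} (\<lambda>s. \<mu> (X s \<omega>)) + W t \<omega>"
    using sde by (auto simp: solves_sde_def)
  interpret P: prob_space \<Omega> using W by (simp add: standard_brownian_motion_def)
  interpret P': prob_space \<Omega>' using B by (simp add: standard_brownian_motion_def)
  have W_meas: "W t \<in> borel_measurable \<Omega>" and X_meas: "X t \<in> borel_measurable \<Omega>"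
    and B_meas: "B t \<in> borel_measurable \<Omega>'" if "t \<in> {0..T}" for t
    using W X B that by (auto simp: standard_brownian_motion_def continuous_process_def)
  have W0: "AE \<omega> in \<Omega>. W 0 \<omega> = 0" and B0: "AE \<omega> in \<Omega>'. B 0 \<omega> = 0"
    using W B by (auto simp: standard_brownian_motion_def)
  have \<phi>_meas: "\<phi> j \<in> borel_measurable borel" for j
    by (rule borel_measurable_continuous_onI[OF \<phi>(1)])
  obtain n0 :: nat where n0: "2 * T * K < real n0" using reals_Archimedean2 by blast
  \<comment> \<open>The shifted index makes every scheme of the sequence fine enough, as
    \<open>n0\<close> exceeds \<open>2 * T * K\<close>.\<close>
  define N where "N m = m + Suc n0" for m
  have N_pos: "0 < N m" and N_fine: "T / N m * K \<le> 1/2" for m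
    using n0 by (auto simp: N_def field_simps)
  have N_lim: "(\<lambda>m. f (N m)) \<longlonglongrightarrow> l" if "f \<longlonglongrightarrow> l" for f :: "nat \<Rightarrow> real" and l
    unfolding N_def by (rule LIMSEQ_ignore_initial_segment[OF that])
  define \<kappa> where "\<kappa> n j = nat \<lfloor>j * real n / T\<rfloor>" for n :: nat and j :: real
  have \<kappa>: "\<kappa> (N m) j \<le> N m" if "j \<in> J" for j m
    using grid_index(1)[of j T "N m"] that J T N_pos by (auto simp: \<kappa>_def)
  \<comment> \<open>The endpoint is hit exactly, so the test function at \<open>T\<close> meets the
    factor \<open>exp (A (p n))\<close> of the density at the same point.\<close>
  have \<kappa>T: "\<kappa> n T = n" for n using T by (simp add: \<kappa>_def)
  have grid: "real k * (T / N m) \<in> {0..T}" if "k \<le> N m" for k m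
    using grid_mem[OF that N_pos] T by simp
  let ?Y = "\<lambda>n \<omega>. implicit_walk (T / real n) x (\<lambda>i. W (real (Suc i) * (T / real n)) \<omega> - W (real i * (T / real n)) \<omega>)"
  let ?b = "\<lambda>n k \<omega>. x + B (real k * (T / real n)) \<omega> - B 0 \<omega>"
  let ?u = "\<lambda>m \<omega>. ennreal (\<Prod>j\<in>J. \<phi> j (?Y (N m) \<omega> (\<kappa> (N m) j)))"
  let ?v = "\<lambda>m \<omega>. ennreal ((\<Prod>j\<in>J. \<phi> j (?b (N m) (\<kappa> (N m) j) \<omega>))
      * (\<Prod>k<N m. step_density (T / N m) (?b (N m) k \<omega>) (?b (N m) (Suc k) \<omega>)))"
  have uv: "(\<integral>\<^sup>+\<omega>. ?u m \<omega> \<partial>\<Omega>) = (\<integral>\<^sup>+\<omega>. ?v m \<omega> \<partial>\<Omega>')" for m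
    unfolding \<kappa>_def by (rule discrete_girsanov[OF W B T N_pos N_fine J(1,2) \<phi>_meas \<phi>(2)])
  have Y_meas: "(\<lambda>\<omega>. ?Y (N m) \<omega> k) \<in> borel_measurable \<Omega>" if "k \<le> N m" for m k
    using that
  proof (induction k)
    case (Suc k)
    have "(\<lambda>\<omega>. step (T / N m) (?Y (N m) \<omega> k) (W (real (Suc k) * (T / N m)) \<omega> - W (real k * (T / N m)) \<omega>)) \<in> borel_measurable \<Omega>"
      using Suc T N_pos N_fine by (intro step_measurable borel_measurable_diff W_meas grid) auto
    then show ?case by simp
  qed simp
  have b_meas: "(\<lambda>\<omega>. ?b (N m) k \<omega>) \<in> borel_measurable \<Omega>'" if "k \<le> N m" for m k
    using T by (intro borel_measurable_diff borel_measurable_add borel_measurable_const B_meas grid that) auto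
  have "(\<lambda>m. \<integral>\<^sup>+\<omega>. ?u m \<omega> \<partial>\<Omega>) \<longlonglongrightarrow> (\<integral>\<^sup>+\<omega>. ennreal (\<Prod>j\<in>J. \<phi> j (X j \<omega>)) \<partial>\<Omega>)"
  proof (rule nn_integral_dominated_convergence[where w = "\<lambda>_. 1"])
    show "?u m \<in> borel_measurable \<Omega>" for m
      by (intro measurable_compose[OF _ measurable_ennreal] borel_measurable_prod measurable_compose[OF Y_meas \<phi>_meas] \<kappa>)
    show "(\<lambda>\<omega>. ennreal (\<Prod>j\<in>J. \<phi> j (X j \<omega>))) \<in> borel_measurable \<Omega>"
      using J by (intro measurable_compose[OF _ measurable_ennreal] borel_measurable_prod measurable_compose[OF X_meas \<phi>_meas]) auto
    show "AE \<omega> in \<Omega>. ?u m \<omega> \<le> 1" for m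
      using \<phi> by (intro AE_I2) (auto intro!: prod_le_1)
    show "AE \<omega> in \<Omega>. (\<lambda>m. ?u m \<omega>) \<longlonglongrightarrow> ennreal (\<Prod>j\<in>J. \<phi> j (X j \<omega>))"
      using eq W0 AE_space
    proof eventually_elim
      case (elim \<omega>)
      have cont: "continuous_on {0..T} (\<lambda>t. X t \<omega>)" using X elim by (simp add: continuous_process_def)
      \<comment> \<open>At time 0 the equation reads \<open>X 0 = x + W 0\<close>, and
        \<open>W 0\<close> vanishes almost surely.\<close>
      have "X 0 \<omega> = x" using elim T by (auto dest: bspec[of _ _ 0])
      from implicit_walk_limit[OF T cont this, of "\<lambda>t. W t \<omega>"] elim(1)
      have "(\<lambda>n. ?Y n \<omega> (\<kappa> n j)) \<longlonglongrightarrow> X j \<omega>" if "j \<in> J" for j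
        unfolding \<kappa>_def using that J by blast
      then show ?case
        by (intro tendsto_ennrealI tendsto_prod isCont_tendsto_compose[OF isCont_from_on[OF \<phi>(1)]]) (rule N_lim)
    qed
  qed (auto simp: P.emeasure_space_1)
  note X_lim = this
  have "(\<lambda>m. \<integral>\<^sup>+\<omega>. ?v m \<omega> \<partial>\<Omega>') \<longlonglongrightarrow> (\<integral>\<^sup>+\<omega>. ennreal ((\<Prod>j\<in>J. \<phi> j (x + B j \<omega>))
        * (exp (A (x + B T \<omega>) - A x) * weight \<mu> T (\<lambda>t. x + B t \<omega>))) \<partial>\<Omega>')"
  \<comment> \<open>The constant is \<open>exp (T * K)\<close> from the Jacobians times
    \<open>exp (- A x)\<close>; \<open>tail\<close> disposes of the remaining exponential.\<close>
  proof (rule nn_integral_dominated_convergence[where w = "\<lambda>_. ennreal (exp (T * K - A x))"])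
    have cont_B: "continuous_process \<Omega>' T (\<lambda>t \<omega>. x + B t \<omega>)"
      using B by (auto simp: standard_brownian_motion_def continuous_process_def intro!: continuous_intros)
    have [measurable]: "A \<in> borel_measurable borel"
      by (intro borel_measurable_continuous_onI continuous_intros)
    show "?v m \<in> borel_measurable \<Omega>'" for m
      by (intro measurable_compose[OF _ measurable_ennreal] borel_measurable_times borel_measurable_prod
          measurable_compose[OF b_meas \<phi>_meas] \<kappa> step_density_measurable b_meas) auto
    have "T \<in> {0..T}" using T by simp
    note B_meas[OF this, measurable]
    show "(\<lambda>\<omega>. ennreal ((\<Prod>j\<in>J. \<phi> j (x + B j \<omega>))
        * (exp (A (x + B T \<omega>) - A x) * weight \<mu> T (\<lambda>t. x + B t \<omega>)))) \<in> borel_measurable \<Omega>'"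
    proof (intro measurable_compose[OF _ measurable_ennreal] borel_measurable_times)
      show "(\<lambda>\<omega>. \<Prod>j\<in>J. \<phi> j (x + B j \<omega>)) \<in> borel_measurable \<Omega>'"
        using J by (intro borel_measurable_prod measurable_compose[OF _ \<phi>_meas] borel_measurable_add B_meas borel_measurable_const) auto
      show "(\<lambda>\<omega>. weight \<mu> T (\<lambda>t. x + B t \<omega>)) \<in> borel_measurable \<Omega>'"
        by (rule weight_process_measurable[OF cont_B T])
    qed measurable
    show "AE \<omega> in \<Omega>'. ?v m \<omega> \<le> ennreal (exp (T * K - A x))" for m
    proof (intro AE_I2 ennreal_leI)
      fix \<omega>
      let ?p = "\<lambda>k. ?b (N m) k \<omega>"
      have fine: "0 < T / N m" "T / N m * K \<le> 1/2" using T N_pos N_fine by auto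
      have "(\<Prod>j\<in>J. \<phi> j (?p (\<kappa> (N m) j))) = \<phi> T (?p (N m)) * (\<Prod>j\<in>J - {T}. \<phi> j (?p (\<kappa> (N m) j)))"
        using J by (subst prod.remove[of J T]) (auto simp: \<kappa>T)
      also have "\<dots> \<le> \<phi> T (?p (N m)) * 1"
        using \<phi> by (intro mult_left_mono prod_le_1) auto
      finally have 1: "(\<Prod>j\<in>J. \<phi> j (?p (\<kappa> (N m) j))) \<le> \<phi> T (?p (N m))" by simp
      have "(\<Prod>k<N m. step_density (T / N m) (?p k) (?p (Suc k)))
          \<le> exp (A (?p (N m)) - A (?p 0)) * exp (real (N m) * (T / N m) * K)"
        by (rule prod_step_density_le[OF fine])
      also have "\<dots> = exp (A (?p (N m))) * exp (T * K - A x)"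
        using N_pos[of m] by (simp flip: exp_add)
      finally have 2: "(\<Prod>k<N m. step_density (T / N m) (?p k) (?p (Suc k))) \<le> exp (A (?p (N m))) * exp (T * K - A x)" .
      have "(\<Prod>j\<in>J. \<phi> j (?p (\<kappa> (N m) j))) * (\<Prod>k<N m. step_density (T / N m) (?p k) (?p (Suc k)))
          \<le> \<phi> T (?p (N m)) * (exp (A (?p (N m))) * exp (T * K - A x))"
        using \<phi> step_density_nonneg[OF fine] by (intro mult_mono 1 2 prod_nonneg) auto
      also have "\<dots> \<le> 1 * exp (T * K - A x)"
        unfolding mult.assoc[symmetric] by (intro mult_right_mono tail) auto
      finally show "(\<Prod>j\<in>J. \<phi> j (?p (\<kappa> (N m) j))) * (\<Prod>k<N m. step_density (T / N m) (?p k) (?p (Suc k)))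
          \<le> exp (T * K - A x)" by simp
    qed
    show "AE \<omega> in \<Omega>'. (\<lambda>m. ?v m \<omega>) \<longlonglongrightarrow> ennreal ((\<Prod>j\<in>J. \<phi> j (x + B j \<omega>))
        * (exp (A (x + B T \<omega>) - A x) * weight \<mu> T (\<lambda>t. x + B t \<omega>)))"
      using B0 AE_space
    proof eventually_elim
      case (elim \<omega>)
      have cont: "continuous_on {0..T} (\<lambda>t. x + B t \<omega>)" using cont_B elim by (simp add: continuous_process_def)
      have b: "?b n k \<omega> = x + B (real k * (T / n)) \<omega>" for n k using elim by simp
      have "(\<lambda>n. x + B (real (\<kappa> n j) * (T / n)) \<omega>) \<longlonglongrightarrow> x + B j \<omega>" if "j \<in> J" for j
        unfolding \<kappa>_def using that J by (intro grid_value_limit[OF cont _ T]) auto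
      moreover have "(\<lambda>n. \<Prod>k<n. step_density (T / n) (x + B (real k * (T / n)) \<omega>) (x + B (real (Suc k) * (T / n)) \<omega>))
          \<longlonglongrightarrow> exp (A (x + B T \<omega>) - A x) * weight \<mu> T (\<lambda>t. x + B t \<omega>)"
        using prod_step_density_limit[OF cont T] elim by simp
      ultimately show ?case
        unfolding b
        by (intro tendsto_ennrealI tendsto_mult tendsto_prod isCont_tendsto_compose[OF isCont_from_on[OF \<phi>(1)]] N_lim)
    qed
  qed (auto simp: P'.emeasure_space_1 ennreal_mult_less_top)
  from LIMSEQ_unique[OF X_lim[unfolded uv] this] show ?thesis .
qed

end

section \<open>Path space and endpoint kernels\<close>

text \<open>\<open>cfunspace\<close> consists of bounded functions; on a compact interval
  boundedness is automatic.\<close>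

lemma mspace_path_metric:
  "\<omega> \<in> mspace (path_metric T) \<longleftrightarrow> continuous_on {0..T} \<omega> \<and> \<omega> \<in> extensional {0..T}"
proof -
  have "compactin (top_of_set {0..T}) (topspace (top_of_set {0..T}))"
    using compact_space_def compact_space_subtopology compactin_euclidean_iff by fastforce
  from compactin_mspace_cfunspace[OF this, of euclidean_metric] show ?thesis
    by (simp add: path_metric_def) blast
qed

lemma space_path_space: "space (path_space T) = mspace (path_metric T)"
  by (auto simp: path_space_def space_restrict_space space_PiM mspace_path_metric extensional_def PiE_def)

lemma coordinate_measurable [measurable]:
  assumes "t \<in> {0..T}"
  shows "(\<lambda>\<omega>. \<omega> t) \<in> borel_measurable (path_space T)"
  unfolding path_space_def
  by (intro measurable_restrict_space1 measurable_component_singleton assms)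

lemma continuous_process_coordinates: "continuous_process (path_space T) T (\<lambda>t \<omega>. \<omega> t)"
  by (auto simp: continuous_process_def space_path_space mspace_path_metric)

lemma measurable_path_spaceI:
  assumes "\<And>t. t \<in> {0..T} \<Longrightarrow> (\<lambda>\<omega>. f \<omega> t) \<in> borel_measurable M"
    and "\<And>\<omega>. \<omega> \<in> space M \<Longrightarrow> f \<omega> \<in> mspace (path_metric T)"
  shows "f \<in> measurable M (path_space T)"
  unfolding path_space_def
proof (rule measurable_restrict_space2)
  show "f \<in> space M \<rightarrow> mspace (path_metric T)" using assms(2) by blast
  show "f \<in> measurable M (Pi\<^sub>M {0..T} (\<lambda>_. borel))"
    by (rule measurable_PiM_single') (use assms in \<open>auto simp: mspace_path_metric PiE_def\<close>)
qed

lemma measurable_path: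
  assumes "continuous_process \<Omega> T X"
  shows "(\<lambda>\<omega>. \<lambda>t\<in>{0..T}. X t \<omega>) \<in> measurable \<Omega> (path_space T)"
proof (rule measurable_path_spaceI)
  fix \<omega> assume "\<omega> \<in> space \<Omega>"
  then have "continuous_on {0..T} (\<lambda>t. X t \<omega>)" using assms by (simp add: continuous_process_def)
  moreover have "continuous_on {0..T} (\<lambda>t\<in>{0..T}. X t \<omega>) = continuous_on {0..T} (\<lambda>t. X t \<omega>)"
    by (rule continuous_on_cong) auto
  ultimately show "(\<lambda>t\<in>{0..T}. X t \<omega>) \<in> mspace (path_metric T)"
    by (simp add: mspace_path_metric)
qed (use assms in \<open>auto simp: continuous_process_def\<close>)

lemma sets_path_law [simp]: "sets (path_law \<Omega> T X) = sets (path_space T)"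
  by (simp add: path_law_def)

text \<open>In a metric space sequences suffice, and convergence in the path metric is uniform
  convergence.\<close>

lemma continuous_map_path_metricI:
  assumes T: "0 < T"
    and F: "\<And>\<omega>s \<omega>. (\<And>n. \<omega>s n \<in> mspace (path_metric T)) \<Longrightarrow> \<omega> \<in> mspace (path_metric T)
      \<Longrightarrow> uniform_limit {0..T} \<omega>s \<omega> sequentially \<Longrightarrow> (\<lambda>n. F (\<omega>s n)) \<longlonglongrightarrow> F \<omega>"
  shows "continuous_map (mtopology_of (path_metric T)) euclideanreal F"
proof -
  interpret Metric_space "mspace (path_metric T)" "mdist (path_metric T)"
    by (rule Metric_space_mspace_mdist)
  have "\<exists>\<delta>>0. \<forall>\<eta>. \<eta> \<in> mspace (path_metric T) \<and> mdist (path_metric T) \<omega> \<eta> < \<delta> \<longrightarrow> dist (F \<omega>) (F \<eta>) < \<epsilon>"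
    if \<omega>: "\<omega> \<in> mspace (path_metric T)" and \<epsilon>: "0 < \<epsilon>" for \<omega> \<epsilon>
  proof (rule ccontr)
    assume contr: "\<not> ?thesis"
    have "\<exists>\<eta>. \<eta> \<in> mspace (path_metric T) \<and> mdist (path_metric T) \<omega> \<eta> < 1 / real (Suc n) \<and> \<epsilon> \<le> dist (F \<omega>) (F \<eta>)" for n
    proof -
      have "0 < 1 / real (Suc n)" by simp
      then show ?thesis using contr by (meson not_le)
    qed
    then obtain \<omega>s where \<omega>s: "\<And>n. \<omega>s n \<in> mspace (path_metric T)"
      "\<And>n. mdist (path_metric T) \<omega> (\<omega>s n) < 1 / real (Suc n)" "\<And>n. \<epsilon> \<le> dist (F \<omega>) (F (\<omega>s n))"
      by metis
    have "uniform_limit {0..T} \<omega>s \<omega> sequentially"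
    proof (rule uniform_limitI)
      fix e :: real assume "0 < e"
      then obtain n0 where n0: "1 / real (Suc n0) < e" using nat_approx_posE by blast
      show "\<forall>\<^sub>F n in sequentially. \<forall>t\<in>{0..T}. dist (\<omega>s n t) (\<omega> t) < e"
        using eventually_ge_at_top[of n0]
      proof (eventually_elim, intro ballI)
        fix n t assume n: "n0 \<le> n" and t: "t \<in> {0..T}"
        have "mdist euclidean_metric (\<omega> t) (\<omega>s n t) \<le> 1 / real (Suc n)"
          using mdist_cfunspace_imp_mdist_le[of \<omega> "top_of_set {0..T}" euclidean_metric "\<omega>s n"]
            \<omega> \<omega>s(1)[of n] \<omega>s(2)[of n] t unfolding path_metric_def by auto
        also have "\<dots> \<le> 1 / real (Suc n0)" using n by (intro divide_left_mono) auto
        finally show "dist (\<omega>s n t) (\<omega> t) < e" using n0 by (simp add: dist_commute)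
      qed
    qed
    from tendstoD[OF F[OF \<omega>s(1) \<omega> this] \<epsilon>] obtain n where "dist (F (\<omega>s n)) (F \<omega>) < \<epsilon>"
      by (auto simp: eventually_sequentially)
    with \<omega>s(3)[of n] show False by (simp add: dist_commute)
  qed
  then have "continuous_map mtopology Met_TC.mtopology F"
    by (subst metric_continuous_map[OF Met_TC.Metric_space_axioms]) auto
  then show ?thesis by (simp add: mtopology_of_def)
qed

text \<open>Continuous functions increasing with \<open>k\<close> to the indicator of an open set.
  The whole line is a separate case because \<open>infdist\<close> to the empty set is 0 by
  convention.\<close>

definition bump :: "real set \<Rightarrow> nat \<Rightarrow> real \<Rightarrow> real" where
  "bump U k z = (if U = UNIV then 1 else min 1 (real k * infdist z (- U)))"

lemma bump_bounds: "0 \<le> bump U k z" "bump U k z \<le> 1"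
  by (auto simp: bump_def infdist_nonneg)

lemma continuous_on_bump: "continuous_on UNIV (bump U k)"
  unfolding bump_def[abs_def] by (cases "U = UNIV") (auto intro!: continuous_intros)

lemma bump_limit:
  assumes "open U"
  shows "(\<lambda>k. bump U k z) \<longlonglongrightarrow> indicator U z"
proof (cases "z \<in> U \<and> U \<noteq> UNIV")
  case True
  then have "infdist z (- U) \<noteq> 0"
    using in_closed_iff_infdist_zero[of "- U" z] assms by (auto simp: closed_Compl)
  then have pos: "0 < infdist z (- U)" using infdist_nonneg[of z "- U"] by linarith
  obtain n :: nat where n: "1 / infdist z (- U) < real n" using reals_Archimedean2 by blast
  have "\<forall>\<^sub>F k in sequentially. bump U k z = 1"
    using eventually_ge_at_top[of n]
  proof eventually_elim
    case (elim k)
    then have "1 / infdist z (- U) \<le> real k" using n by linarith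
    then have "1 \<le> real k * infdist z (- U)" using pos by (simp add: field_simps)
    then show ?case by (simp add: bump_def)
  qed
  then show ?thesis using True by (simp add: tendsto_eventually)
next
  case False
  then have "bump U k z = indicator U z" for k
    using in_closed_iff_infdist_zero[of "- U" z] assms by (auto simp: bump_def indicator_def closed_Compl)
  then show ?thesis by simp
qed

text \<open>Open cylinders form an intersection-stable generator, and their indicators are limits of
  products of bumps. Index sets may be restricted to those containing \<open>T\<close>, since a
  trivial constraint can always be added; the cut-off at the endpoint relies on this.\<close>

lemma path_measure_eqI:
  assumes T: "0 < T" and P: "sets P = sets (path_space T)" and Q: "sets Q = sets (path_space T)"
    and finite: "finite_measure P"
    and eq: "\<And>J \<phi>. finite J \<Longrightarrow> J \<subseteq> {0..T} \<Longrightarrow> T \<in> J \<Longrightarrow> (\<And>j. continuous_on UNIV (\<phi> j))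
      \<Longrightarrow> (\<And>j v. 0 \<le> \<phi> j v) \<Longrightarrow> (\<And>j v. \<phi> j v \<le> 1)
      \<Longrightarrow> (\<integral>\<^sup>+\<omega>. ennreal (\<Prod>j\<in>J. \<phi> j (\<omega> j)) \<partial>P) = (\<integral>\<^sup>+\<omega>. ennreal (\<Prod>j\<in>J. \<phi> j (\<omega> j)) \<partial>Q)"
  shows "P = Q"
proof -
  let ?S = "mspace (path_metric T)"
  define cyl where "cyl J U = {\<omega> \<in> ?S. \<forall>j\<in>J. \<omega> j \<in> U j}" for J :: "real set" and U :: "real \<Rightarrow> real set"
  define E where "E = {cyl J U | J U. finite J \<and> J \<subseteq> {0..T} \<and> T \<in> J \<and> (\<forall>j. open (U j))}"
  have spaces: "space P = ?S" "space Q = ?S"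
    using sets_eq_imp_space_eq[OF P] sets_eq_imp_space_eq[OF Q] by (simp_all add: space_path_space)
  \<comment> \<open>Constant test functions give equal total masses, so finiteness passes from
    \<open>P\<close> to \<open>Q\<close>.\<close>
  have "emeasure P ?S = emeasure Q ?S"
    using eq[of "{T}" "\<lambda>_ _. 1"] T spaces by simp
  then have finite_Q: "finite_measure Q"
    using finite_measure.emeasure_finite[OF finite, of ?S] by (intro finite_measureI) (simp add: spaces)
  have cyl_meas: "cyl J U \<in> sets (path_space T)" if "finite J" "J \<subseteq> {0..T}" "\<And>j. open (U j)" for J U
  proof -
    have "{\<omega> \<in> space (path_space T). \<forall>j\<in>J. \<omega> j \<in> U j} \<in> sets (path_space T)"
    proof (intro sets.sets_Collect_finite_All that(1))
      fix j assume "j \<in> J"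
      then have "(\<lambda>\<omega>. \<omega> j) \<in> borel_measurable (path_space T)" using that(2) by (intro coordinate_measurable) auto
      from measurable_sets[OF this borel_open[OF that(3)[of j]]]
      show "{\<omega> \<in> space (path_space T). \<omega> j \<in> U j} \<in> sets (path_space T)"
        by (simp add: vimage_def Int_def conj_commute)
    qed
    then show ?thesis by (simp add: cyl_def space_path_space)
  qed
  have E_Pow: "E \<subseteq> Pow ?S" by (auto simp: E_def cyl_def)
  have sigma_E: "sets (path_space T) = sigma_sets ?S E"
  proof
    show "sigma_sets ?S E \<subseteq> sets (path_space T)"
      unfolding space_path_space[symmetric]
      by (rule sets.sigma_sets_subset) (auto simp: E_def cyl_meas)
    have meas: "(\<lambda>\<omega>. \<omega>) \<in> measurable (sigma ?S E) (path_space T)"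
    proof (rule measurable_path_spaceI)
      fix t assume t: "t \<in> {0..T}"
      show "(\<lambda>\<omega>. \<omega> t) \<in> borel_measurable (sigma ?S E)"
      proof (rule borel_measurableI)
        fix U :: "real set" assume "open U"
        \<comment> \<open>The endpoint joins the index set with the trivial constraint, unless
          \<open>t\<close> is the endpoint itself.\<close>
        have "(\<lambda>\<omega>. \<omega> t) -` U \<inter> ?S = cyl {t, T} (\<lambda>j. if j = t then U else UNIV)"
          by (auto simp: cyl_def)
        also have "\<dots> \<in> E"
          using t T \<open>open U\<close> unfolding E_def
          by (intro CollectI exI[of _ "{t, T}"] exI[of _ "\<lambda>j. if j = t then U else UNIV"]) auto
        finally show "(\<lambda>\<omega>. \<omega> t) -` U \<inter> space (sigma ?S E) \<in> sets (sigma ?S E)"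
          using E_Pow by (simp add: space_measure_of_conv)
      qed
    qed (use E_Pow in \<open>simp add: space_measure_of_conv\<close>)
    show "sets (path_space T) \<subseteq> sigma_sets ?S E"
    proof
      fix A assume A: "A \<in> sets (path_space T)"
      from measurable_sets[OF meas A] sets.sets_into_space[OF A] show "A \<in> sigma_sets ?S E"
        using E_Pow by (simp add: space_path_space space_measure_of_conv Int_absorb2)
    qed
  qed
  show ?thesis
  proof (rule measure_eqI_generator_eq[OF _ E_Pow])
    show "Int_stable E"
    proof (rule Int_stableI)
      fix a b assume "a \<in> E" "b \<in> E"
      then obtain J U J' U' where a: "a = cyl J U" "finite J" "J \<subseteq> {0..T}" "T \<in> J" "\<And>j. open (U j)"
        and b: "b = cyl J' U'" "finite J'" "J' \<subseteq> {0..T}" "\<And>j. open (U' j)"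
        unfolding E_def by blast
      let ?V = "\<lambda>j. (if j \<in> J then U j else UNIV) \<inter> (if j \<in> J' then U' j else UNIV)"
      have "a \<inter> b = cyl (J \<union> J') ?V" using a b by (auto simp: cyl_def)
      moreover have "open (?V j)" for j using a b by (auto intro!: open_Int)
      ultimately show "a \<inter> b \<in> E"
        unfolding E_def using a b by (intro CollectI exI[of _ "J \<union> J'"] exI[of _ ?V]) auto
    qed
    show "sets P = sigma_sets ?S E" "sets Q = sigma_sets ?S E" using P Q sigma_E by auto
    show "range (\<lambda>_::nat. cyl {T} (\<lambda>_. UNIV)) \<subseteq> E"
      using T unfolding E_def by (auto intro!: exI[of _ "{T}"] exI[of _ "\<lambda>_. UNIV"])
    show "(\<Union>i::nat. cyl {T} (\<lambda>_. UNIV)) = ?S" by (auto simp: cyl_def)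
    show "emeasure P (cyl {T} (\<lambda>_. UNIV)) \<noteq> \<infinity>"
      using finite_measure.emeasure_finite[OF finite] by simp
  next
    fix Y assume "Y \<in> E"
    then obtain J U where Y: "Y = cyl J U" "finite J" "J \<subseteq> {0..T}" "T \<in> J" "\<And>j. open (U j)"
      unfolding E_def by blast
    have lim: "(\<lambda>k. \<integral>\<^sup>+\<omega>. ennreal (\<Prod>j\<in>J. bump (U j) k (\<omega> j)) \<partial>R) \<longlonglongrightarrow> emeasure R Y"
      if R: "sets R = sets (path_space T)" and fin: "finite_measure R" for R
    proof -
      have space_R: "space R = ?S" using sets_eq_imp_space_eq[OF R] by (simp add: space_path_space)
      have YR: "Y \<in> sets R" using Y R cyl_meas by simp
      have "(\<lambda>k. \<integral>\<^sup>+\<omega>. ennreal (\<Prod>j\<in>J. bump (U j) k (\<omega> j)) \<partial>R) \<longlonglongrightarrow> (\<integral>\<^sup>+\<omega>. indicator Y \<omega> \<partial>R)"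
      proof (rule nn_integral_dominated_convergence[where w = "\<lambda>_. 1"])
        fix k
        show "(\<lambda>\<omega>. ennreal (\<Prod>j\<in>J. bump (U j) k (\<omega> j))) \<in> borel_measurable R"
          unfolding measurable_cong_sets[OF R refl] using Y(3)
          by (intro measurable_compose[OF _ measurable_ennreal] borel_measurable_prod
            measurable_compose[OF coordinate_measurable borel_measurable_continuous_onI[OF continuous_on_bump]]) auto
        show "AE \<omega> in R. ennreal (\<Prod>j\<in>J. bump (U j) k (\<omega> j)) \<le> 1"
          by (intro AE_I2) (auto intro!: prod_le_1 simp: bump_bounds)
      next
        show "AE \<omega> in R. (\<lambda>k. ennreal (\<Prod>j\<in>J. bump (U j) k (\<omega> j))) \<longlonglongrightarrow> indicator Y \<omega>"
        proof (rule AE_I2)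
          fix \<omega> assume "\<omega> \<in> space R"
          have *: "indicator Y \<omega> = ennreal (\<Prod>j\<in>J. indicator (U j) (\<omega> j))"
          proof (cases "\<forall>j\<in>J. \<omega> j \<in> U j")
            case False
            then have "(\<Prod>j\<in>J. indicator (U j) (\<omega> j)) = (0 :: real)"
              using Y(2) by (intro prod_zero) (auto simp: indicator_def)
            then show ?thesis using False by (simp add: Y(1) cyl_def)
          qed (use \<open>\<omega> \<in> space R\<close> in \<open>simp add: Y(1) cyl_def space_R\<close>)
          show "(\<lambda>k. ennreal (\<Prod>j\<in>J. bump (U j) k (\<omega> j))) \<longlonglongrightarrow> indicator Y \<omega>"
            unfolding * by (intro tendsto_ennrealI tendsto_prod bump_limit Y)
        qed
      qed (use YR finite_measure.emeasure_finite[OF fin, of "space R"] in \<open>auto simp: less_top\<close>)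
      then show ?thesis using YR by simp
    qed
    have "(\<integral>\<^sup>+\<omega>. ennreal (\<Prod>j\<in>J. bump (U j) k (\<omega> j)) \<partial>P) = (\<integral>\<^sup>+\<omega>. ennreal (\<Prod>j\<in>J. bump (U j) k (\<omega> j)) \<partial>Q)" for k
      using Y by (intro eq bump_bounds continuous_on_bump)
    with lim[OF P finite] lim[OF Q finite_Q] show "emeasure P Y = emeasure Q Y"
      using LIMSEQ_unique by simp
  qed
qed

section \<open>Integration against the endpoint kernel\<close>

lemma endpoint_kernel_prob:
  assumes "endpoint_kernel T P \<kappa>"
  shows "prob_space (\<kappa> z)" "sets (\<kappa> z) = sets (path_space T)"
proof -
  have "\<kappa> z \<in> space (prob_algebra (path_space T))"
    using assms by (auto simp: endpoint_kernel_def intro: measurable_space)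
  then show "prob_space (\<kappa> z)" "sets (\<kappa> z) = sets (path_space T)"
    by (auto simp: space_prob_algebra)
qed

lemma kernel_nn_integral_measurable:
  assumes "endpoint_kernel T P \<kappa>" "H \<in> borel_measurable (path_space T)"
  shows "(\<lambda>z. \<integral>\<^sup>+\<omega>. H \<omega> \<partial>\<kappa> z) \<in> borel_measurable borel"
  using assms
  by (intro measurable_compose[OF measurable_prob_algebraD nn_integral_measurable_subprob_algebra])
    (auto simp: endpoint_kernel_def)

text \<open>The definition of the kernel is the case of two indicators. For fixed \<open>B\<close>
  both sides are measures of the path event, which gives the formula for every \<open>H\<close>; for
  fixed \<open>H\<close> both sides are measures of \<open>B\<close>, which gives it for every
  \<open>a\<close>.\<close>

lemma kernel_nn_integral:
  fixes H :: "(real \<Rightarrow> real) \<Rightarrow> ennreal" and a :: "real \<Rightarrow> ennreal"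
  assumes T: "0 < T" and P: "sets P = sets (path_space T)"
    and \<kappa>: "endpoint_kernel T P \<kappa>"
    and H: "H \<in> borel_measurable (path_space T)" and a: "a \<in> borel_measurable borel"
  shows "(\<integral>\<^sup>+\<omega>. a (\<omega> T) * H \<omega> \<partial>P)
    = (\<integral>\<^sup>+z. a z * (\<integral>\<^sup>+\<omega>. H \<omega> \<partial>\<kappa> z) \<partial>(distr P borel (\<lambda>\<omega>. \<omega> T)))"
proof -
  let ?\<rho> = "distr P borel (\<lambda>\<omega>. \<omega> T)"
  have HP: "H \<in> borel_measurable P" using H by (simp add: measurable_cong_sets[OF P refl])
  have ev: "(\<lambda>\<omega>. \<omega> T) \<in> borel_measurable P"
    using coordinate_measurable[of T T] T by (simp add: measurable_cong_sets[OF P refl])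
  have \<kappa>_meas: "\<kappa> \<in> measurable borel (subprob_algebra (path_space T))"
    using \<kappa> by (auto simp: endpoint_kernel_def intro: measurable_prob_algebraD)
  have f: "(\<lambda>z. \<integral>\<^sup>+\<omega>. H \<omega> \<partial>\<kappa> z) \<in> borel_measurable borel"
    by (rule kernel_nn_integral_measurable[OF \<kappa> H])
  have on_sets: "(\<integral>\<^sup>+\<omega>. H \<omega> * indicator B (\<omega> T) \<partial>P) = (\<integral>\<^sup>+z. (\<integral>\<^sup>+\<omega>. H \<omega> \<partial>\<kappa> z) * indicator B z \<partial>?\<rho>)"
    if B: "B \<in> sets borel" for B
  proof -
    have indB: "(\<lambda>\<omega>. indicator B (\<omega> T) :: ennreal) \<in> borel_measurable P"
      using measurable_compose[OF ev borel_measurable_indicator[OF B]] .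
    have \<kappa>_density: "\<kappa> \<in> measurable (density ?\<rho> (indicator B)) (subprob_algebra (path_space T))"
      using \<kappa>_meas by (simp cong: measurable_cong_sets)
    \<comment> \<open>The mixture of the kernel over endpoints in \<open>B\<close> is
      \<open>P\<close> restricted to paths ending in \<open>B\<close>.\<close>
    have "density P (\<lambda>\<omega>. indicator B (\<omega> T)) = density ?\<rho> (indicator B) \<bind> \<kappa>"
    proof (rule measure_eqI)
      show "sets (density P (\<lambda>\<omega>. indicator B (\<omega> T))) = sets (density ?\<rho> (indicator B) \<bind> \<kappa>)"
        using sets_bind[of "density ?\<rho> (indicator B)" \<kappa> "path_space T"] endpoint_kernel_prob[OF \<kappa>] P by simp
      fix A assume "A \<in> sets (density P (\<lambda>\<omega>. indicator B (\<omega> T)))"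
      then have A: "A \<in> sets (path_space T)" "A \<in> sets P" using P by auto
      have eq: "{\<omega> \<in> A. \<omega> T \<in> B} \<in> sets P"
      proof -
        have "A \<inter> ((\<lambda>\<omega>. \<omega> T) -` B \<inter> space P) \<in> sets P" using A measurable_sets[OF ev B] by auto
        also have "A \<inter> ((\<lambda>\<omega>. \<omega> T) -` B \<inter> space P) = {\<omega> \<in> A. \<omega> T \<in> B}"
          using sets.sets_into_space[OF A(2)] by auto
        finally show ?thesis .
      qed
      have "emeasure (density P (\<lambda>\<omega>. indicator B (\<omega> T))) A = (\<integral>\<^sup>+\<omega>. indicator B (\<omega> T) * indicator A \<omega> \<partial>P)"
        by (rule emeasure_density[OF indB A(2)])
      also have "\<dots> = (\<integral>\<^sup>+\<omega>. indicator {\<omega> \<in> A. \<omega> T \<in> B} \<omega> \<partial>P)"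
        by (intro nn_integral_cong) (auto simp: indicator_def)
      also have "\<dots> = emeasure P {\<omega> \<in> A. \<omega> T \<in> B}" using eq by simp
      also have "\<dots> = (\<integral>\<^sup>+z\<in>B. emeasure (\<kappa> z) A \<partial>?\<rho>)"
        using \<kappa> A(1) B by (auto simp: endpoint_kernel_def)
      also have "\<dots> = (\<integral>\<^sup>+z. emeasure (\<kappa> z) A \<partial>density ?\<rho> (indicator B))"
        using B measurable_emeasure_kernel[OF \<kappa>_meas A(1)]
        by (subst nn_integral_density) (auto simp: mult.commute)
      also have "\<dots> = emeasure (density ?\<rho> (indicator B) \<bind> \<kappa>) A"
        by (rule emeasure_bind[OF _ \<kappa>_density A(1), symmetric]) simp
      finally show "emeasure (density P (\<lambda>\<omega>. indicator B (\<omega> T))) A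
          = emeasure (density ?\<rho> (indicator B) \<bind> \<kappa>) A" .
    qed
    then have "(\<integral>\<^sup>+\<omega>. H \<omega> \<partial>density P (\<lambda>\<omega>. indicator B (\<omega> T)))
        = (\<integral>\<^sup>+z. \<integral>\<^sup>+\<omega>. H \<omega> \<partial>\<kappa> z \<partial>density ?\<rho> (indicator B))"
      by (simp add: nn_integral_bind[OF H \<kappa>_density])
    then show ?thesis
      using indB HP f B by (simp add: nn_integral_density mult.commute)
  qed
  have "distr (density P H) borel (\<lambda>\<omega>. \<omega> T) = density ?\<rho> (\<lambda>z. \<integral>\<^sup>+\<omega>. H \<omega> \<partial>\<kappa> z)"
  proof (rule measure_eqI)
    fix B assume "B \<in> sets (distr (density P H) borel (\<lambda>\<omega>. \<omega> T))"
    then have B: "B \<in> sets borel" by simp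
    have "emeasure (distr (density P H) borel (\<lambda>\<omega>. \<omega> T)) B = (\<integral>\<^sup>+\<omega>. H \<omega> * indicator ((\<lambda>\<omega>. \<omega> T) -` B \<inter> space P) \<omega> \<partial>P)"
      using ev B HP measurable_sets[OF ev B] by (simp add: emeasure_distr emeasure_density)
    also have "\<dots> = (\<integral>\<^sup>+\<omega>. H \<omega> * indicator B (\<omega> T) \<partial>P)"
      by (intro nn_integral_cong) (auto simp: indicator_def)
    finally show "emeasure (distr (density P H) borel (\<lambda>\<omega>. \<omega> T)) B = emeasure (density ?\<rho> (\<lambda>z. \<integral>\<^sup>+\<omega>. H \<omega> \<partial>\<kappa> z)) B"
      using on_sets[OF B] B f by (simp add: emeasure_density)
  qed simp
  then have "(\<integral>\<^sup>+z. a z \<partial>distr (density P H) borel (\<lambda>\<omega>. \<omega> T)) = (\<integral>\<^sup>+z. a z \<partial>density ?\<rho> (\<lambda>z. \<integral>\<^sup>+\<omega>. H \<omega> \<partial>\<kappa> z))"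
    by simp
  then show ?thesis
    using a ev HP f measurable_compose[OF ev a] by (simp add: nn_integral_distr nn_integral_density mult.commute)
qed

section \<open>The Girsanov formula on path space\<close>

text \<open>A violation at one point would persist on an interval, which has positive Lebesgue
  measure.\<close>

lemma AE_lborel_continuous_le:
  fixes f g :: "real \<Rightarrow> real"
  assumes ae: "AE z in lborel. f z \<le> g z" and cont: "continuous_on UNIV f" "continuous_on UNIV g"
  shows "f y \<le> g y"
proof (rule ccontr)
  assume "\<not> f y \<le> g y"
  then have y: "y \<in> {z. g z < f z}" by simp
  have "open {z. g z < f z}" using cont by (intro open_Collect_less)
  then obtain d where d: "0 < d" "cball y d \<subseteq> {z. g z < f z}" using y open_contains_cball by blast
  have sub: "{y - d..y + d} \<subseteq> {z. g z < f z}" using d by (auto simp: cball_eq_atLeastAtMost)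
  have "AE z in lborel. z \<notin> {y - d..y + d}" using ae by eventually_elim (use sub in force)
  then have "{y - d..y + d} \<in> null_sets lborel" by (subst AE_iff_null_sets) auto
  then have "emeasure lborel {y - d..y + d} = 0" by auto
  then show False using d by simp
qed

lemma AE_lborel_continuous_eq:
  fixes f g :: "real \<Rightarrow> real"
  assumes ae: "AE z in lborel. f z = g z" and cont: "continuous_on UNIV f" "continuous_on UNIV g"
  shows "f y = g y"
proof (rule antisym)
  show "f y \<le> g y" by (rule AE_lborel_continuous_le[OF _ cont]) (use ae in auto)
  show "g y \<le> f y" by (rule AE_lborel_continuous_le[OF _ cont(2,1)]) (use ae in auto)
qed

text \<open>\<open>V\<close> is uniformly continuous only on compact sets; by uniform convergence
  the paths eventually stay in one of them, the range of the limit enlarged by 1.\<close>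

lemma uniform_limit_integral_compose:
  fixes V :: "real \<Rightarrow> real" and T :: real
  assumes V: "continuous_on UNIV V" and \<omega>: "continuous_on {0..T} \<omega>"
    and \<omega>s: "\<And>n. continuous_on {0..T} (\<omega>s n)" and lim: "uniform_limit {0..T} \<omega>s \<omega> sequentially"
  shows "(\<lambda>n. integral {0..T} (\<lambda>s. V (\<omega>s n s))) \<longlonglongrightarrow> integral {0..T} (\<lambda>s. V (\<omega> s))"
proof -
  have "bounded (\<omega> ` {0..T})" by (intro compact_imp_bounded compact_continuous_image \<omega>) auto
  then obtain R where R: "\<And>s. s \<in> {0..T} \<Longrightarrow> \<bar>\<omega> s\<bar> \<le> R" unfolding bounded_iff by fastforce
  have "uniform_limit {0..T} (\<lambda>n s. V (\<omega>s n s)) (\<lambda>s. V (\<omega> s)) sequentially"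
  proof (rule uniform_limit_compose_uniformly_continuous_on[OF lim, where B = "{- (R + 1)..R + 1}"])
    show "uniformly_continuous_on {- (R + 1)..R + 1} V"
      by (intro compact_uniformly_continuous continuous_on_subset[OF V]) auto
    show "\<forall>\<^sub>F n in sequentially. \<forall>s\<in>{0..T}. \<omega>s n s \<in> {- (R + 1)..R + 1}"
      using uniform_limitD[OF lim zero_less_one]
    proof (eventually_elim, intro ballI)
      fix n s assume "\<forall>s\<in>{0..T}. dist (\<omega>s n s) (\<omega> s) < 1" "s \<in> {0..T}"
      then have "\<bar>\<omega>s n s - \<omega> s\<bar> < 1" by (simp add: dist_real_def)
      then show "\<omega>s n s \<in> {- (R + 1)..R + 1}" using R[OF \<open>s \<in> {0..T}\<close>] by auto
    qed
  qed auto
  from uniform_limit_integral[OF this] obtain I J where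
    IJ: "\<And>n. ((\<lambda>s. V (\<omega>s n s)) has_integral I n) {0..T}" "((\<lambda>s. V (\<omega> s)) has_integral J) {0..T}" "I \<longlonglongrightarrow> J"
    using continuous_on_compose2[OF V \<omega>s] by (metis subset_UNIV trivial_limit_sequentially)
  then show ?thesis by (simp add: integral_unique[OF IJ(1)] integral_unique[OF IJ(2)])
qed

lemma uniform_limit_coordinate:
  "uniform_limit S \<omega>s \<omega> F \<Longrightarrow> s \<in> S \<Longrightarrow> ((\<lambda>n. \<omega>s n s) \<longlongrightarrow> \<omega> s) F"
  by (rule tendsto_uniform_limitI)

lemma weight_restrict: "weight m T (\<lambda>t\<in>{0..T}. f t) = weight m T f"
  unfolding weight_def
  by (intro arg_cong[where f = exp] arg_cong2[where f = "(*)"] refl integral_cong) simp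

text \<open>The value at \<open>T\<close> agrees almost surely with the increment from time 0. The
  density is positive everywhere, so the null sets of endpoints are the Lebesgue null sets.\<close>

lemma endpoint_law:
  assumes B: "standard_brownian_motion \<Omega> T B" and T: "0 < T"
  shows "distr (path_law \<Omega> T (\<lambda>t \<omega>. x + B t \<omega>)) borel (\<lambda>\<omega>. \<omega> T)
    = density lborel (\<lambda>z. ennreal (normal_density x (sqrt T) z))"
proof -
  interpret prob_space \<Omega> using B by (simp add: standard_brownian_motion_def)
  have B_meas: "B t \<in> borel_measurable \<Omega>" if "t \<in> {0..T}" for t
    using B that by (auto simp: standard_brownian_motion_def continuous_process_def)
  have [measurable]: "B 0 \<in> borel_measurable \<Omega>" "B T \<in> borel_measurable \<Omega>" using T by (auto intro: B_meas)
  have B0: "AE \<omega> in \<Omega>. B 0 \<omega> = 0" using B by (auto simp: standard_brownian_motion_def)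
  have cont: "continuous_process \<Omega> T (\<lambda>t \<omega>. x + B t \<omega>)"
    using B by (auto simp: standard_brownian_motion_def continuous_process_def intro!: continuous_intros)
  have "distributed \<Omega> lborel (\<lambda>\<omega>. B T \<omega> - B 0 \<omega>) (\<lambda>z. ennreal (normal_density 0 (sqrt (T - 0)) z))"
    using B T unfolding standard_brownian_motion_def by blast
  then have "distributed \<Omega> lborel (\<lambda>\<omega>. x + 1 * (B T \<omega> - B 0 \<omega>)) (normal_density (x + 1 * 0) (\<bar>1\<bar> * sqrt T))"
    using T by (intro normal_density_affine) auto
  then have *: "distributed \<Omega> lborel (\<lambda>\<omega>. x + (B T \<omega> - B 0 \<omega>)) (normal_density x (sqrt T))" by simp
  have "distr (path_law \<Omega> T (\<lambda>t \<omega>. x + B t \<omega>)) borel (\<lambda>\<omega>. \<omega> T)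
      = distr \<Omega> borel ((\<lambda>\<omega>. \<omega> T) \<circ> (\<lambda>\<omega>. \<lambda>t\<in>{0..T}. x + B t \<omega>))"
    unfolding path_law_def using T by (intro distr_distr coordinate_measurable measurable_path cont) auto
  also have "\<dots> = distr \<Omega> lborel (\<lambda>\<omega>. x + (B T \<omega> - B 0 \<omega>))"
    using B0 T by (intro distr_cong_AE) (auto simp: comp_def)
  also have "\<dots> = density lborel (\<lambda>z. ennreal (normal_density x (sqrt T) z))"
    by (rule distributed_distr_eq_density[OF *])
  finally show ?thesis .
qed

lemma prod_functional_measurable:
  assumes "J \<subseteq> {0..T}" "\<And>j. continuous_on UNIV (\<phi> j)"
  shows "(\<lambda>\<omega>. \<Prod>j\<in>J. \<phi> j (\<omega> j) :: real) \<in> borel_measurable (path_space T)"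
  using assms
  by (intro borel_measurable_prod measurable_compose[OF coordinate_measurable borel_measurable_continuous_onI]) auto

lemma kernel_integral_continuous:
  assumes "endpoint_kernel T P \<kappa>" "continuous_map (mtopology_of (path_metric T)) euclideanreal F"
    and "\<And>\<omega>. \<omega> \<in> mspace (path_metric T) \<Longrightarrow> \<bar>F \<omega>\<bar> \<le> C"
  shows "continuous_on UNIV (\<lambda>z. \<integral>\<omega>. F \<omega> \<partial>\<kappa> z)"
proof -
  have "bounded (F ` mspace (path_metric T))" using assms(3) by (auto simp: bounded_iff)
  with assms(1,2) show ?thesis unfolding endpoint_kernel_def by blast
qed

lemma prob_bounded_integrable:
  fixes F :: "(real \<Rightarrow> real) \<Rightarrow> real" and C :: real
  assumes "prob_space R" "sets R = sets (path_space T)" "F \<in> borel_measurable (path_space T)"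
    and "\<And>\<omega>. \<omega> \<in> mspace (path_metric T) \<Longrightarrow> \<bar>F \<omega>\<bar> \<le> C"
  shows "integrable R F"
proof -
  interpret prob_space R by fact
  have "space R = mspace (path_metric T)" using sets_eq_imp_space_eq[OF assms(2)] by (simp add: space_path_space)
  then show ?thesis
    using assms(3,4) by (intro integrable_const_bound[where B = C]) (auto simp: measurable_cong_sets[OF assms(2) refl])
qed

context smooth_drift
begin

lemma cont_potential: "continuous_on UNIV (drift_potential \<mu>)"
  unfolding drift_potential_def[abs_def] deriv_mu by (intro continuous_intros)

text \<open>Only the derivative can make the potential negative. The resulting bound on the weight
  makes it a legitimate test function for weak continuity.\<close>

lemma potential_ge: "- K \<le> drift_potential \<mu> z"
  using deriv_bound[of z] zero_le_power2[of "\<mu> z"] unfolding drift_potential_def deriv_mu by linarith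

lemma potential_integrable:
  fixes T :: real
  shows "continuous_on {0..T} \<omega> \<Longrightarrow> (\<lambda>s. drift_potential \<mu> (\<omega> s)) integrable_on {0..T}"
  by (rule integrable_continuous_real[OF continuous_on_compose2[OF cont_potential]]) auto

lemma weight_le:
  assumes "continuous_on {0..T} \<omega>" "0 < T" "\<And>z. l \<le> drift_potential \<mu> z"
  shows "weight \<mu> T \<omega> \<le> exp (- (1/2) * (T * l))"
proof -
  have "integral {0..T} (\<lambda>s. l) \<le> integral {0..T} (\<lambda>s. drift_potential \<mu> (\<omega> s))"
    using assms by (intro integral_le potential_integrable) auto
  then show ?thesis using assms by (simp add: weight_def)
qed

lemma weight_ge:
  assumes "continuous_on {0..T} \<omega>" "0 < T" "\<And>z. drift_potential \<mu> z \<le> u"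
  shows "exp (- (1/2) * (T * u)) \<le> weight \<mu> T \<omega>"
proof -
  have "integral {0..T} (\<lambda>s. drift_potential \<mu> (\<omega> s)) \<le> integral {0..T} (\<lambda>s. u)"
    using assms by (intro integral_le potential_integrable) auto
  then show ?thesis using assms by (simp add: weight_def)
qed

lemma weight_bound:
  assumes "0 < T" "\<omega> \<in> mspace (path_metric T)"
  shows "weight \<mu> T \<omega> \<le> exp (T * K / 2)"
  using weight_le[of T \<omega> "- K"] assms potential_ge by (simp add: mspace_path_metric)

lemma weight_measurable:
  "0 < T \<Longrightarrow> weight \<mu> T \<in> borel_measurable (path_space T)"
  using weight_process_measurable[OF continuous_process_coordinates] by simp

text \<open>Prepares the passage from almost every to every endpoint: these are the functionals to
  which weak continuity of the kernels is applied.\<close>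

lemma continuous_map_prod_functional:
  assumes T: "0 < T" and J: "J \<subseteq> {0..T}" and \<phi>: "\<And>j. continuous_on UNIV (\<phi> j)"
  shows "continuous_map (mtopology_of (path_metric T)) euclideanreal (\<lambda>\<omega>. \<Prod>j\<in>J. \<phi> j (\<omega> j))"
    and "continuous_map (mtopology_of (path_metric T)) euclideanreal (\<lambda>\<omega>. weight \<mu> T \<omega> * (\<Prod>j\<in>J. \<phi> j (\<omega> j)))"
proof -
  have prod: "(\<lambda>n. \<Prod>j\<in>J. \<phi> j (\<omega>s n j)) \<longlonglongrightarrow> (\<Prod>j\<in>J. \<phi> j (\<omega> j))"
    if "uniform_limit {0..T} \<omega>s \<omega> sequentially" for \<omega>s :: "nat \<Rightarrow> real \<Rightarrow> real" and \<omega>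
    using J by (intro tendsto_prod isCont_tendsto_compose[OF isCont_from_on[OF \<phi>]] uniform_limit_coordinate[OF that]) auto
  show "continuous_map (mtopology_of (path_metric T)) euclideanreal (\<lambda>\<omega>. \<Prod>j\<in>J. \<phi> j (\<omega> j))"
    by (rule continuous_map_path_metricI[OF T prod])
  show "continuous_map (mtopology_of (path_metric T)) euclideanreal (\<lambda>\<omega>. weight \<mu> T \<omega> * (\<Prod>j\<in>J. \<phi> j (\<omega> j)))"
  proof (rule continuous_map_path_metricI[OF T tendsto_mult[OF _ prod]])
    fix \<omega>s :: "nat \<Rightarrow> real \<Rightarrow> real" and \<omega>
    assume "\<And>n. \<omega>s n \<in> mspace (path_metric T)" "\<omega> \<in> mspace (path_metric T)" "uniform_limit {0..T} \<omega>s \<omega> sequentially"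
    then have "(\<lambda>n. integral {0..T} (\<lambda>s. drift_potential \<mu> (\<omega>s n s))) \<longlonglongrightarrow> integral {0..T} (\<lambda>s. drift_potential \<mu> (\<omega> s))"
      by (intro uniform_limit_integral_compose cont_potential) (auto simp: mspace_path_metric)
    then show "(\<lambda>n. weight \<mu> T (\<omega>s n)) \<longlonglongrightarrow> weight \<mu> T \<omega>"
      unfolding weight_def by (intro tendsto_intros)
  qed
qed

text \<open>The factor exp(- max 0 (A v)) at the endpoint makes the Girsanov density bounded.\<close>

lemma girsanov_path_measure:
  assumes sde: "solves_sde \<Omega> T \<mu> x W X" and B: "standard_brownian_motion \<Omega>' T B" and T: "0 < T"
  shows "density (path_law \<Omega> T X) (\<lambda>\<omega>. ennreal (exp (- max 0 (A (\<omega> T)))))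
    = density (path_law \<Omega>' T (\<lambda>t \<omega>. x + B t \<omega>))
        (\<lambda>\<omega>. ennreal (exp (- max 0 (A (\<omega> T))) * (exp (A (\<omega> T) - A x) * weight \<mu> T \<omega>)))"
proof -
  define \<tau> where "\<tau> v = exp (- max 0 (A v))" for v
  have W: "standard_brownian_motion \<Omega> T W" and X: "continuous_process \<Omega> T X"
    using sde by (auto simp: solves_sde_def)
  interpret P: prob_space \<Omega> using W by (simp add: standard_brownian_motion_def)
  have xB: "continuous_process \<Omega>' T (\<lambda>t \<omega>. x + B t \<omega>)"
    using B by (auto simp: standard_brownian_motion_def continuous_process_def intro!: continuous_intros)
  have \<tau>_cont: "continuous_on UNIV \<tau>" unfolding \<tau>_def[abs_def] by (intro continuous_intros)
  have \<tau>_bounds: "0 \<le> \<tau> v" "\<tau> v \<le> 1" "\<tau> v * exp (A v) \<le> 1" for v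
    by (auto simp: \<tau>_def simp flip: exp_add)
  have [measurable]: "\<tau> \<in> borel_measurable borel" "A \<in> borel_measurable borel"
    using \<tau>_cont by (auto intro!: borel_measurable_continuous_onI continuous_intros)
  have ev [measurable]: "(\<lambda>\<omega>. \<omega> T) \<in> borel_measurable (path_space T)" using T by (intro coordinate_measurable) auto
  note weight_measurable[OF T, measurable]
  let ?P = "path_law \<Omega> T X" and ?R = "path_law \<Omega>' T (\<lambda>t \<omega>. x + B t \<omega>)"
  let ?d = "\<lambda>\<omega>. \<tau> (\<omega> T) * (exp (A (\<omega> T) - A x) * weight \<mu> T \<omega>)"
  have \<tau>_meas: "(\<lambda>\<omega>. ennreal (\<tau> (\<omega> T))) \<in> borel_measurable (path_space T)"
    and d_meas: "(\<lambda>\<omega>. ennreal (?d \<omega>)) \<in> borel_measurable (path_space T)"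
    by measurable
  have "density ?P (\<lambda>\<omega>. ennreal (\<tau> (\<omega> T))) = density ?R (\<lambda>\<omega>. ennreal (?d \<omega>))"
  proof (rule path_measure_eqI[OF T])
    have "emeasure (density ?P (\<lambda>\<omega>. ennreal (\<tau> (\<omega> T)))) (space ?P) = (\<integral>\<^sup>+\<omega>. ennreal (\<tau> (\<omega> T)) \<partial>?P)"
      using \<tau>_meas sets.top[of ?P]
      by (subst emeasure_density) (auto intro!: nn_integral_cong simp: measurable_cong_sets[OF sets_path_law refl] simp del: sets.top)
    also have "\<dots> \<le> (\<integral>\<^sup>+\<omega>. 1 \<partial>?P)" using \<tau>_bounds by (intro nn_integral_mono) auto
    also have "\<dots> = 1"
      using prob_space.emeasure_space_1[OF P.prob_space_distr[OF measurable_path[OF X]]]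
      by (simp add: path_law_def)
    finally show "finite_measure (density ?P (\<lambda>\<omega>. ennreal (\<tau> (\<omega> T))))"
      by (intro finite_measureI) (auto simp: top_unique)
  next
    fix J :: "real set" and \<phi> :: "real \<Rightarrow> real \<Rightarrow> real"
    assume J: "finite J" "J \<subseteq> {0..T}" "T \<in> J"
      and \<phi>: "\<And>j. continuous_on UNIV (\<phi> j)" "\<And>j v. 0 \<le> \<phi> j v" "\<And>j v. \<phi> j v \<le> 1"
    \<comment> \<open>The cut-off moves into the test function at \<open>T\<close>, where
      \<open>\<tau> v * exp (A v) \<le> 1\<close> yields the \<open>tail\<close> condition.\<close>
    define \<psi> where "\<psi> = \<phi>(T := \<lambda>v. \<phi> T v * \<tau> v)"
    have \<psi>: "continuous_on UNIV (\<psi> j)" "0 \<le> \<psi> j v" "\<psi> j v \<le> 1" "\<psi> T v * exp (A v) \<le> 1" for j v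
    proof -
      show "continuous_on UNIV (\<psi> j)" using \<phi>(1) \<tau>_cont by (auto simp: \<psi>_def intro!: continuous_intros)
      show "0 \<le> \<psi> j v" "\<psi> j v \<le> 1" using \<phi>(2,3) \<tau>_bounds by (auto simp: \<psi>_def intro: mult_le_one)
      show "\<psi> T v * exp (A v) \<le> 1"
        using \<phi>(2)[of T v] \<phi>(3)[of T v] \<tau>_bounds[of v] mult_le_one[of "\<phi> T v" "\<tau> v * exp (A v)"]
        by (simp add: \<psi>_def mult.assoc)
    qed
    have prod_\<psi>: "(\<Prod>j\<in>J. \<psi> j (p j)) = \<tau> (p T) * (\<Prod>j\<in>J. \<phi> j (p j))" for p :: "real \<Rightarrow> real"
    proof -
      have "(\<Prod>j\<in>J. \<psi> j (p j)) = \<psi> T (p T) * (\<Prod>j\<in>J - {T}. \<psi> j (p j))" using J by (intro prod.remove)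
      also have "(\<Prod>j\<in>J - {T}. \<psi> j (p j)) = (\<Prod>j\<in>J - {T}. \<phi> j (p j))" by (intro prod.cong) (auto simp: \<psi>_def)
      also have "\<psi> T (p T) * (\<Prod>j\<in>J - {T}. \<phi> j (p j)) = \<tau> (p T) * (\<Prod>j\<in>J. \<phi> j (p j))"
        using J prod.remove[of J T "\<lambda>j. \<phi> j (p j)"] by (simp add: \<psi>_def)
      finally show ?thesis .
    qed
    have prod_meas: "(\<lambda>\<omega>. ennreal (\<Prod>j\<in>J. \<phi> j (\<omega> j))) \<in> borel_measurable (path_space T)"
      "(\<lambda>\<omega>. ennreal (\<Prod>j\<in>J. \<psi> j (\<omega> j))) \<in> borel_measurable (path_space T)"
      by (intro measurable_compose[OF _ measurable_ennreal] prod_functional_measurable J \<phi> \<psi>)+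
    have "(\<integral>\<^sup>+\<omega>. ennreal (\<Prod>j\<in>J. \<phi> j (\<omega> j)) \<partial>density ?P (\<lambda>\<omega>. ennreal (\<tau> (\<omega> T))))
        = (\<integral>\<^sup>+\<omega>. ennreal (\<Prod>j\<in>J. \<psi> j (\<omega> j)) \<partial>?P)"
      using \<tau>_meas prod_meas \<tau>_bounds \<phi>
      by (subst nn_integral_density)
        (auto simp: measurable_cong_sets[OF sets_path_law refl] prod_\<psi> ennreal_mult prod_nonneg)
    also have "\<dots> = (\<integral>\<^sup>+\<omega>. ennreal (\<Prod>j\<in>J. \<psi> j (X j \<omega>)) \<partial>\<Omega>)"
      unfolding path_law_def using J prod_meas
      by (subst nn_integral_distr[OF measurable_path[OF X]])
        (auto intro!: nn_integral_cong arg_cong[where f = ennreal] prod.cong)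
    also have "\<dots> = (\<integral>\<^sup>+\<omega>. ennreal ((\<Prod>j\<in>J. \<psi> j (x + B j \<omega>))
        * (exp (A (x + B T \<omega>) - A x) * weight \<mu> T (\<lambda>t. x + B t \<omega>))) \<partial>\<Omega>')"
      by (rule girsanov_functional[where \<phi> = \<psi>, OF sde B T J \<psi>])
    also have "\<dots> = (\<integral>\<^sup>+\<omega>. ennreal ((\<Prod>j\<in>J. \<psi> j (\<omega> j)) * (exp (A (\<omega> T) - A x) * weight \<mu> T \<omega>)) \<partial>?R)"
      unfolding path_law_def
    proof (subst nn_integral_distr[OF measurable_path[OF xB]])
      show "(\<lambda>\<omega>. ennreal ((\<Prod>j\<in>J. \<psi> j (\<omega> j)) * (exp (A (\<omega> T) - A x) * weight \<mu> T \<omega>)))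
          \<in> borel_measurable (distr \<Omega>' (path_space T) (\<lambda>\<omega>. \<lambda>t\<in>{0..T}. x + B t \<omega>))"
        using prod_functional_measurable[OF J(2) \<psi>(1)] by simp
      have "(\<Prod>j\<in>J. \<psi> j ((\<lambda>t\<in>{0..T}. x + B t \<omega>) j)) = (\<Prod>j\<in>J. \<psi> j (x + B j \<omega>))" for \<omega>
        using J by (intro prod.cong) auto
      then show "(\<integral>\<^sup>+\<omega>. ennreal ((\<Prod>j\<in>J. \<psi> j (x + B j \<omega>))
          * (exp (A (x + B T \<omega>) - A x) * weight \<mu> T (\<lambda>t. x + B t \<omega>))) \<partial>\<Omega>')
        = (\<integral>\<^sup>+\<omega>. ennreal ((\<Prod>j\<in>J. \<psi> j ((\<lambda>t\<in>{0..T}. x + B t \<omega>) j))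
          * (exp (A ((\<lambda>t\<in>{0..T}. x + B t \<omega>) T) - A x) * weight \<mu> T (\<lambda>t\<in>{0..T}. x + B t \<omega>))) \<partial>\<Omega>')"
        using T by (simp add: weight_restrict)
    qed
    also have "\<dots> = (\<integral>\<^sup>+\<omega>. ennreal (\<Prod>j\<in>J. \<phi> j (\<omega> j)) \<partial>density ?R (\<lambda>\<omega>. ennreal (?d \<omega>)))"
    proof (subst nn_integral_density)
      show "(\<integral>\<^sup>+\<omega>. ennreal ((\<Prod>j\<in>J. \<psi> j (\<omega> j)) * (exp (A (\<omega> T) - A x) * weight \<mu> T \<omega>)) \<partial>?R)
        = (\<integral>\<^sup>+\<omega>. ennreal (?d \<omega>) * ennreal (\<Prod>j\<in>J. \<phi> j (\<omega> j)) \<partial>?R)"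
      proof (intro nn_integral_cong)
        fix \<omega>
        have "0 \<le> ?d \<omega>" "0 \<le> (\<Prod>j\<in>J. \<phi> j (\<omega> j))"
          using \<tau>_bounds \<phi> by (auto intro!: prod_nonneg simp: weight_def)
        then show "ennreal ((\<Prod>j\<in>J. \<psi> j (\<omega> j)) * (exp (A (\<omega> T) - A x) * weight \<mu> T \<omega>))
            = ennreal (?d \<omega>) * ennreal (\<Prod>j\<in>J. \<phi> j (\<omega> j))"
          by (simp only: prod_\<psi> ennreal_mult[symmetric]) (simp only: mult_ac)
      qed
    qed (use d_meas prod_meas in \<open>simp_all add: measurable_cong_sets[OF sets_path_law refl]\<close>)
    finally show "(\<integral>\<^sup>+\<omega>. ennreal (\<Prod>j\<in>J. \<phi> j (\<omega> j)) \<partial>density ?P (\<lambda>\<omega>. ennreal (\<tau> (\<omega> T))))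
        = (\<integral>\<^sup>+\<omega>. ennreal (\<Prod>j\<in>J. \<phi> j (\<omega> j)) \<partial>density ?R (\<lambda>\<omega>. ennreal (?d \<omega>)))" .
  qed simp_all
  then show ?thesis unfolding \<tau>_def .
qed

section \<open>The density of the diffusion bridge\<close>

text \<open>Both sides of the formula on path space are disintegrated; \<open>b\<close>, the cut-off
  and the exponential of \<open>A\<close> depend on the endpoint alone and leave the inner
  integral.\<close>

lemma girsanov_kernels:
  assumes sde: "solves_sde \<Omega> T \<mu> x W X" and B: "standard_brownian_motion \<Omega>' T B" and T: "0 < T"
    and \<kappa>X: "endpoint_kernel T (path_law \<Omega> T X) \<kappa>X"
    and \<kappa>B: "endpoint_kernel T (path_law \<Omega>' T (\<lambda>t \<omega>. x + B t \<omega>)) \<kappa>B"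
    and H: "H \<in> borel_measurable (path_space T)" and b: "b \<in> borel_measurable borel"
  shows "(\<integral>\<^sup>+z. b z * (\<integral>\<^sup>+\<omega>. H \<omega> \<partial>\<kappa>X z) \<partial>distr (path_law \<Omega> T X) borel (\<lambda>\<omega>. \<omega> T))
    = (\<integral>\<^sup>+z. b z * ennreal (exp (A z - A x)) * (\<integral>\<^sup>+\<omega>. ennreal (weight \<mu> T \<omega>) * H \<omega> \<partial>\<kappa>B z)
        \<partial>distr (path_law \<Omega>' T (\<lambda>t \<omega>. x + B t \<omega>)) borel (\<lambda>\<omega>. \<omega> T))"
proof -
  let ?P = "path_law \<Omega> T X" and ?R = "path_law \<Omega>' T (\<lambda>t \<omega>. x + B t \<omega>)"
  define \<tau> where "\<tau> v = exp (- max 0 (A v))" for v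
  have \<tau>_pos: "0 < \<tau> v" for v by (simp add: \<tau>_def)
  \<comment> \<open>Dividing by the positive cut-off removes it again; the quotient may be
    unbounded, which is harmless for nonnegative integrals.\<close>
  define c where "c z = b z * ennreal (1 / \<tau> z)" for z
  have [measurable]: "A \<in> borel_measurable borel" "\<tau> \<in> borel_measurable borel"
    unfolding \<tau>_def[abs_def] by (auto intro!: borel_measurable_continuous_onI continuous_intros)
  note b [measurable] H [measurable] weight_measurable[OF T, measurable]
  have ev [measurable]: "(\<lambda>\<omega>. \<omega> T) \<in> borel_measurable (path_space T)" using T by (intro coordinate_measurable) auto
  have c [measurable]: "c \<in> borel_measurable borel" unfolding c_def[abs_def] by measurable
  have c_\<tau>: "c z * ennreal (\<tau> z) = b z" for z
    using \<tau>_pos[of z] by (simp add: c_def mult.assoc flip: ennreal_mult)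
  have measP: "f \<in> borel_measurable ?P \<longleftrightarrow> f \<in> borel_measurable (path_space T)"
    and measR: "f \<in> borel_measurable ?R \<longleftrightarrow> f \<in> borel_measurable (path_space T)"
    for f :: "(real \<Rightarrow> real) \<Rightarrow> ennreal"
    by (simp_all add: measurable_cong_sets[OF sets_path_law refl])
  let ?d = "\<lambda>\<omega>. ennreal (\<tau> (\<omega> T) * (exp (A (\<omega> T) - A x) * weight \<mu> T \<omega>))"
  have "(\<integral>\<^sup>+\<omega>. b (\<omega> T) * H \<omega> \<partial>?P) = (\<integral>\<^sup>+\<omega>. ennreal (\<tau> (\<omega> T)) * (c (\<omega> T) * H \<omega>) \<partial>?P)"
    by (simp add: c_\<tau>[symmetric] mult_ac)
  also have "\<dots> = (\<integral>\<^sup>+\<omega>. c (\<omega> T) * H \<omega> \<partial>density ?P (\<lambda>\<omega>. ennreal (\<tau> (\<omega> T))))"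
    by (rule nn_integral_density[symmetric]) (simp_all add: measP)
  also have "\<dots> = (\<integral>\<^sup>+\<omega>. c (\<omega> T) * H \<omega> \<partial>density ?R ?d)"
    unfolding \<tau>_def girsanov_path_measure[OF sde B T] ..
  also have "\<dots> = (\<integral>\<^sup>+\<omega>. ?d \<omega> * (c (\<omega> T) * H \<omega>) \<partial>?R)"
    by (rule nn_integral_density) (simp_all add: measR)
  also have "\<dots> = (\<integral>\<^sup>+\<omega>. (b (\<omega> T) * ennreal (exp (A (\<omega> T) - A x))) * (ennreal (weight \<mu> T \<omega>) * H \<omega>) \<partial>?R)"
  proof (intro nn_integral_cong)
    fix \<omega>
    have "?d \<omega> = ennreal (\<tau> (\<omega> T)) * (ennreal (exp (A (\<omega> T) - A x)) * ennreal (weight \<mu> T \<omega>))"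
      using \<tau>_pos[of "\<omega> T"] by (simp add: ennreal_mult weight_def)
    then show "?d \<omega> * (c (\<omega> T) * H \<omega>)
        = (b (\<omega> T) * ennreal (exp (A (\<omega> T) - A x))) * (ennreal (weight \<mu> T \<omega>) * H \<omega>)"
      unfolding c_\<tau>[symmetric] by (simp only: mult_ac)
  qed
  finally have "(\<integral>\<^sup>+\<omega>. b (\<omega> T) * H \<omega> \<partial>?P)
      = (\<integral>\<^sup>+\<omega>. (b (\<omega> T) * ennreal (exp (A (\<omega> T) - A x))) * (ennreal (weight \<mu> T \<omega>) * H \<omega>) \<partial>?R)" .
  then show ?thesis
    using kernel_nn_integral[OF T sets_path_law \<kappa>X H b]
      kernel_nn_integral[OF T sets_path_law \<kappa>B, of "\<lambda>\<omega>. ennreal (weight \<mu> T \<omega>) * H \<omega>" "\<lambda>z. b z * ennreal (exp (A z - A x))"]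
    by simp
qed

text \<open>Computing one integral against the unknown law of the endpoint of \<open>X\<close> in
  two ways eliminates that law. The identity results for almost every endpoint, and its three
  ingredients \<open>h\<close>, \<open>l\<close> and \<open>m\<close> are continuous in the
  endpoint.\<close>

lemma bridge_expectation:
  assumes sde: "solves_sde \<Omega> T \<mu> x W X" and B: "standard_brownian_motion \<Omega>' T B" and T: "0 < T"
    and \<kappa>X: "endpoint_kernel T (path_law \<Omega> T X) \<kappa>X"
    and \<kappa>B: "endpoint_kernel T (path_law \<Omega>' T (\<lambda>t \<omega>. x + B t \<omega>)) \<kappa>B"
    and J: "J \<subseteq> {0..T}"
    and \<phi>: "\<And>j. continuous_on UNIV (\<phi> j)" "\<And>j v. 0 \<le> \<phi> j v" "\<And>j v. \<phi> j v \<le> (1 :: real)"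
  shows "(\<integral>\<omega>. weight \<mu> T \<omega> \<partial>\<kappa>B y) * (\<integral>\<omega>. (\<Prod>j\<in>J. \<phi> j (\<omega> j)) \<partial>\<kappa>X y)
    = (\<integral>\<omega>. weight \<mu> T \<omega> * (\<Prod>j\<in>J. \<phi> j (\<omega> j)) \<partial>\<kappa>B y)"
proof -
  let ?H = "\<lambda>\<omega>. \<Prod>j\<in>J. \<phi> j (\<omega> j)" and ?L = "weight \<mu> T"
  let ?\<rho>X = "distr (path_law \<Omega> T X) borel (\<lambda>\<omega>. \<omega> T)"
  let ?\<rho>B = "distr (path_law \<Omega>' T (\<lambda>t \<omega>. x + B t \<omega>)) borel (\<lambda>\<omega>. \<omega> T)"
  define C where "C = exp (T * K / 2)"
  have H01: "0 \<le> ?H \<omega>" "?H \<omega> \<le> 1" for \<omega>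
    using \<phi> by (auto intro!: prod_nonneg prod_le_1)
  have L0: "0 \<le> ?L \<omega>" for \<omega> by (simp add: weight_def)
  have LC: "?L \<omega> \<le> C" if "\<omega> \<in> mspace (path_metric T)" for \<omega>
    using weight_bound[OF T that] by (simp add: C_def)
  have LH: "\<bar>?L \<omega> * ?H \<omega>\<bar> \<le> C" if "\<omega> \<in> mspace (path_metric T)" for \<omega>
    using mult_mono[OF LC[OF that] H01(2)] L0 H01 by (simp add: C_def)
  have H_meas: "?H \<in> borel_measurable (path_space T)" by (rule prod_functional_measurable[OF J \<phi>(1)])
  have L_meas: "?L \<in> borel_measurable (path_space T)" by (rule weight_measurable[OF T])
  have LH_meas: "(\<lambda>\<omega>. ?L \<omega> * ?H \<omega>) \<in> borel_measurable (path_space T)"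
    using H_meas L_meas by (rule borel_measurable_times[rotated])
  note pX = endpoint_kernel_prob[OF \<kappa>X] and pB = endpoint_kernel_prob[OF \<kappa>B]
  define h where "h z = (\<integral>\<omega>. ?H \<omega> \<partial>\<kappa>X z)" for z
  define l where "l z = (\<integral>\<omega>. ?L \<omega> \<partial>\<kappa>B z)" for z
  define m where "m z = (\<integral>\<omega>. ?L \<omega> * ?H \<omega> \<partial>\<kappa>B z)" for z
  have cont: "continuous_on UNIV h" "continuous_on UNIV l" "continuous_on UNIV m"
  proof -
    show "continuous_on UNIV h"
      unfolding h_def using H01
      by (intro kernel_integral_continuous[OF \<kappa>X, where C = 1] continuous_map_prod_functional T J \<phi>) auto
    show "continuous_on UNIV m"
      unfolding m_def
      by (intro kernel_integral_continuous[OF \<kappa>B, where C = C] continuous_map_prod_functional T J \<phi> LH)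
    show "continuous_on UNIV l"
      unfolding l_def
      using continuous_map_prod_functional(2)[OF T, of "{}"] LC L0
      by (intro kernel_integral_continuous[OF \<kappa>B, where C = C]) auto
  qed
  have hnn: "(\<integral>\<^sup>+\<omega>. ennreal (?H \<omega>) \<partial>\<kappa>X z) = ennreal (h z)" for z
    unfolding h_def using H01
    by (intro nn_integral_eq_integral prob_bounded_integrable[OF pX H_meas, where C = 1]) auto
  have lnn: "(\<integral>\<^sup>+\<omega>. ennreal (?L \<omega>) \<partial>\<kappa>B z) = ennreal (l z)" for z
    unfolding l_def using LC L0
    by (intro nn_integral_eq_integral prob_bounded_integrable[OF pB L_meas, where C = C]) auto
  have mnn: "(\<integral>\<^sup>+\<omega>. ennreal (?L \<omega>) * ennreal (?H \<omega>) \<partial>\<kappa>B z) = ennreal (m z)" for z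
  proof -
    have "(\<integral>\<^sup>+\<omega>. ennreal (?L \<omega> * ?H \<omega>) \<partial>\<kappa>B z) = ennreal (m z)"
      unfolding m_def using L0 H01 LH
      by (intro nn_integral_eq_integral prob_bounded_integrable[OF pB LH_meas, where C = C]) auto
    then show ?thesis using L0 H01 by (simp add: ennreal_mult)
  qed
  have [measurable]: "h \<in> borel_measurable borel" "l \<in> borel_measurable borel" "m \<in> borel_measurable borel"
    "A \<in> borel_measurable borel"
    using cont by (auto intro!: borel_measurable_continuous_onI continuous_intros)
  have l0: "0 \<le> l z" and h0: "0 \<le> h z" and m0: "0 \<le> m z" for z
    unfolding l_def h_def m_def using L0 H01 by (auto intro!: integral_nonneg)
  have key: "(\<integral>\<^sup>+z. ennreal (exp (A z - A x) * (l z * h z)) * indicator S z \<partial>?\<rho>B)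
      = (\<integral>\<^sup>+z. ennreal (exp (A z - A x) * m z) * indicator S z \<partial>?\<rho>B)" if S: "S \<in> sets borel" for S
  proof -
    \<comment> \<open>Here \<open>h z\<close> multiplies the total mass of the kernel; in the second
      formula it arises as the kernel integral of the product. The left-hand sides agree.\<close>
    have "(\<integral>\<^sup>+z. (indicator S z * ennreal (h z)) * (\<integral>\<^sup>+\<omega>. 1 \<partial>\<kappa>X z) \<partial>?\<rho>X)
        = (\<integral>\<^sup>+z. (indicator S z * ennreal (h z)) * ennreal (exp (A z - A x)) * (\<integral>\<^sup>+\<omega>. ennreal (?L \<omega>) * 1 \<partial>\<kappa>B z) \<partial>?\<rho>B)"
      using S by (intro girsanov_kernels[OF sde B T \<kappa>X \<kappa>B]) auto
    moreover have "(\<integral>\<^sup>+z. indicator S z * (\<integral>\<^sup>+\<omega>. ennreal (?H \<omega>) \<partial>\<kappa>X z) \<partial>?\<rho>X)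
        = (\<integral>\<^sup>+z. indicator S z * ennreal (exp (A z - A x)) * (\<integral>\<^sup>+\<omega>. ennreal (?L \<omega>) * ennreal (?H \<omega>) \<partial>\<kappa>B z) \<partial>?\<rho>B)"
      using S H_meas by (intro girsanov_kernels[OF sde B T \<kappa>X \<kappa>B]) auto
    moreover have "(\<integral>\<^sup>+\<omega>. 1 \<partial>\<kappa>X z) = 1" for z
      using prob_space.emeasure_space_1[OF pX(1)] by simp
    ultimately show ?thesis
      using l0 h0 m0 by (simp add: hnn lnn mnn ennreal_mult mult_ac)
  qed
  have \<rho>: "?\<rho>B = density lborel (\<lambda>z. ennreal (normal_density x (sqrt T) z))"
    by (rule endpoint_law[OF B T])
  interpret \<rho>B: prob_space ?\<rho>B
    unfolding \<rho> using T by (intro prob_space_normal_density) simp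
  have "AE z in ?\<rho>B. ennreal (exp (A z - A x) * (l z * h z)) = ennreal (exp (A z - A x) * m z)"
    by (rule \<rho>B.density_unique_finite_measure) (auto simp: key)
  then have "AE z in ?\<rho>B. l z * h z = m z"
    by eventually_elim (use l0 h0 m0 in auto)
  \<comment> \<open>The normal density is positive, so almost every endpoint means Lebesgue almost
    every endpoint.\<close>
  then have "AE z in lborel. l z * h z = m z"
    unfolding \<rho> using T by (subst (asm) AE_density) (auto simp: normal_density_pos)
  then have "l y * h y = m y"
    by (rule AE_lborel_continuous_eq) (intro continuous_intros cont)+
  then show ?thesis by (simp add: l_def h_def m_def)
qed

theorem bridge_density:
  assumes Q: "diffusion_bridge_law \<Omega> W X \<mu> T x y \<Q>"
    and W: "brownian_bridge_law \<Omega>' B T x y \<W>" and T: "0 < T"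
  shows "density \<W> (\<lambda>\<omega>. ennreal (normalised_weight \<W> \<mu> T \<omega>)) = \<Q>"
    and "0 < (\<integral>\<omega>. weight \<mu> T \<omega> \<partial>\<W>)" and "integrable \<W> (weight \<mu> T)"
proof -
  obtain \<kappa>X where sde: "solves_sde \<Omega> T \<mu> x W X" and \<kappa>X: "endpoint_kernel T (path_law \<Omega> T X) \<kappa>X" "\<Q> = \<kappa>X y"
    using Q by (auto simp: diffusion_bridge_law_def bridge_law_def)
  obtain \<kappa>B where B: "standard_brownian_motion \<Omega>' T B"
    and \<kappa>B: "endpoint_kernel T (path_law \<Omega>' T (\<lambda>t \<omega>. x + B t \<omega>)) \<kappa>B" "\<W> = \<kappa>B y"
    using W by (auto simp: brownian_bridge_law_def bridge_law_def)
  note pQ = endpoint_kernel_prob[OF \<kappa>X(1), of y, folded \<kappa>X(2)]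
  note pW = endpoint_kernel_prob[OF \<kappa>B(1), of y, folded \<kappa>B(2)]
  interpret Q: prob_space \<Q> by (rule pQ)
  interpret W: prob_space \<W> by (rule pW)
  let ?L = "weight \<mu> T"
  have LC: "\<bar>?L \<omega>\<bar> \<le> exp (T * K / 2)" if "\<omega> \<in> mspace (path_metric T)" for \<omega>
    using weight_bound[OF T that] by (simp add: weight_def)
  show int: "integrable \<W> ?L"
    by (rule prob_bounded_integrable[OF pW weight_measurable[OF T] LC])
  \<comment> \<open>A vanishing integral would force the positive weight to be zero almost
    everywhere.\<close>
  have "(\<integral>\<omega>. ?L \<omega> \<partial>\<W>) \<noteq> 0"
    using W.prob_space int by (subst integral_nonneg_eq_0_iff_AE) (auto simp: weight_def W.AE_False)
  moreover have "0 \<le> (\<integral>\<omega>. ?L \<omega> \<partial>\<W>)" by (rule Bochner_Integration.integral_nonneg) (simp add: weight_def)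
  ultimately show pos: "0 < (\<integral>\<omega>. ?L \<omega> \<partial>\<W>)" by linarith
  have meas: "f \<in> borel_measurable \<W> \<longleftrightarrow> f \<in> borel_measurable (path_space T)" for f :: "_ \<Rightarrow> 'c::topological_space"
    by (simp add: measurable_cong_sets[OF pW(2) refl])
  have Z0: "0 \<le> normalised_weight \<W> \<mu> T \<omega>" for \<omega>
    using pos by (simp add: normalised_weight_def weight_def)
  have Z_meas: "(\<lambda>\<omega>. normalised_weight \<W> \<mu> T \<omega>) \<in> borel_measurable (path_space T)"
    unfolding normalised_weight_def using weight_measurable[OF T] by (intro borel_measurable_divide) auto
  show "density \<W> (\<lambda>\<omega>. ennreal (normalised_weight \<W> \<mu> T \<omega>)) = \<Q>"
  proof (rule path_measure_eqI[OF T, symmetric])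
    fix J :: "real set" and \<phi> :: "real \<Rightarrow> real \<Rightarrow> real"
    assume J: "finite J" "J \<subseteq> {0..T}" "T \<in> J"
      and \<phi>: "\<And>j. continuous_on UNIV (\<phi> j)" "\<And>j v. 0 \<le> \<phi> j v" "\<And>j v. \<phi> j v \<le> 1"
    let ?H = "\<lambda>\<omega>. \<Prod>j\<in>J. \<phi> j (\<omega> j)"
    have H01: "0 \<le> ?H \<omega>" "?H \<omega> \<le> 1" for \<omega> using \<phi> by (auto intro!: prod_nonneg prod_le_1)
    have H_meas: "?H \<in> borel_measurable (path_space T)" by (rule prod_functional_measurable[OF J(2) \<phi>(1)])
    have LH: "integrable \<W> (\<lambda>\<omega>. ?L \<omega> * ?H \<omega>)"
    proof (rule Bochner_Integration.integrable_bound[OF int])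
      show "(\<lambda>\<omega>. ?L \<omega> * ?H \<omega>) \<in> borel_measurable \<W>"
        unfolding meas by (intro borel_measurable_times weight_measurable[OF T] H_meas)
      show "AE \<omega> in \<W>. norm (?L \<omega> * ?H \<omega>) \<le> norm (?L \<omega>)"
        using H01 by (intro AE_I2) (simp add: abs_mult mult_left_le)
    qed
    have "(\<integral>\<^sup>+\<omega>. ennreal (?H \<omega>) \<partial>density \<W> (\<lambda>\<omega>. ennreal (normalised_weight \<W> \<mu> T \<omega>)))
        = (\<integral>\<^sup>+\<omega>. ennreal (normalised_weight \<W> \<mu> T \<omega>) * ennreal (?H \<omega>) \<partial>\<W>)"
      using H_meas Z_meas by (intro nn_integral_density) (auto simp: meas)
    also have "\<dots> = (\<integral>\<^sup>+\<omega>. ennreal (?L \<omega> * ?H \<omega> / (\<integral>\<omega>. ?L \<omega> \<partial>\<W>)) \<partial>\<W>)"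
      using H01 Z0 by (intro nn_integral_cong) (simp add: normalised_weight_def flip: ennreal_mult)
    also have "\<dots> = ennreal (\<integral>\<omega>. ?L \<omega> * ?H \<omega> / (\<integral>\<omega>. ?L \<omega> \<partial>\<W>) \<partial>\<W>)"
      using LH H01 pos by (intro nn_integral_eq_integral) (auto simp: weight_def)
    also have "(\<integral>\<omega>. ?L \<omega> * ?H \<omega> / (\<integral>\<omega>. ?L \<omega> \<partial>\<W>) \<partial>\<W>) = (\<integral>\<omega>. ?H \<omega> \<partial>\<Q>)"
      using bridge_expectation[OF sde B T \<kappa>X(1) \<kappa>B(1) J(2) \<phi>, of y] pos
      unfolding \<kappa>X(2)[symmetric] \<kappa>B(2)[symmetric] by (simp add: field_simps)
    also have "ennreal (\<integral>\<omega>. ?H \<omega> \<partial>\<Q>) = (\<integral>\<^sup>+\<omega>. ennreal (?H \<omega>) \<partial>\<Q>)"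
      using H01 by (intro nn_integral_eq_integral[symmetric] prob_bounded_integrable[OF pQ H_meas, where C = 1]) auto
    finally show "(\<integral>\<^sup>+\<omega>. ennreal (?H \<omega>) \<partial>\<Q>)
        = (\<integral>\<^sup>+\<omega>. ennreal (?H \<omega>) \<partial>density \<W> (\<lambda>\<omega>. ennreal (normalised_weight \<W> \<mu> T \<omega>)))" ..
  qed (use pQ pW Q.finite_measure_axioms in simp_all)
qed

end

section \<open>Moments of the Brownian bridge\<close>

lemma abs_add_power_le:
  fixes u v :: real
  shows "\<bar>u + v\<bar> ^ q \<le> 2 ^ q * (\<bar>u\<bar> ^ q + \<bar>v\<bar> ^ q)"
proof -
  have "\<bar>u + v\<bar> ^ q \<le> (2 * max \<bar>u\<bar> \<bar>v\<bar>) ^ q" by (intro power_mono) auto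
  also have "\<dots> = 2 ^ q * max \<bar>u\<bar> \<bar>v\<bar> ^ q" by (rule power_mult_distrib)
  also have "max \<bar>u\<bar> \<bar>v\<bar> ^ q \<le> \<bar>u\<bar> ^ q + \<bar>v\<bar> ^ q" by (auto simp: max_def)
  finally show ?thesis by simp
qed

lemma normal_shifted_moment_finite:
  assumes "0 < v"
  shows "(\<integral>\<^sup>+w. ennreal (\<bar>x + w\<bar> ^ q) \<partial>centred_normal v) < \<infinity>"
proof -
  interpret prob_space "centred_normal v" by (rule prob_space_centred_normal[OF assms])
  have "integrable lborel (\<lambda>w. normal_density 0 (sqrt v) w * \<bar>w - 0\<bar> ^ q)"
    using assms by (intro integrable_normal_moment_abs) simp
  then have "integrable (centred_normal v) (\<lambda>w. \<bar>w\<bar> ^ q)"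
    by (subst integrable_density) auto
  then have "integrable (centred_normal v) (\<lambda>w. 2 ^ q * (\<bar>x\<bar> ^ q + \<bar>w\<bar> ^ q))" by simp
  then have "(\<integral>\<^sup>+w. ennreal (2 ^ q * (\<bar>x\<bar> ^ q + \<bar>w\<bar> ^ q)) \<partial>centred_normal v) < \<infinity>"
    by (subst nn_integral_eq_integral) auto
  then show ?thesis
    by (rule order.strict_trans1[rotated]) (intro nn_integral_mono ennreal_leI abs_add_power_le)
qed

text \<open>A Gaussian density never exceeds its peak, and Lebesgue measure is translation
  invariant.\<close>

lemma normal_translate_le:
  assumes v: "0 < v" and U: "U \<in> sets borel"
  shows "(\<integral>\<^sup>+w. indicator U (c + w) \<partial>centred_normal v) \<le> ennreal (1 / sqrt (2 * pi * v)) * emeasure lborel U"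
proof -
  have "(\<integral>\<^sup>+w. indicator U (c + w) \<partial>centred_normal v)
      = (\<integral>\<^sup>+w. ennreal (normal_density 0 (sqrt v) w) * indicator U (c + w) \<partial>lborel)"
    using U by (subst nn_integral_density) auto
  also have "\<dots> \<le> (\<integral>\<^sup>+w. ennreal (1 / sqrt (2 * pi * v)) * indicator U (c + w) \<partial>lborel)"
  proof (intro nn_integral_mono mult_right_mono ennreal_leI)
    fix w
    have "normal_density 0 (sqrt v) w = 1 / sqrt (2 * pi * v) * exp (- w\<^sup>2 / (2 * v))"
      using v by (simp add: normal_density_def)
    also have "\<dots> \<le> 1 / sqrt (2 * pi * v) * 1" using v by (intro mult_left_mono) auto
    finally show "normal_density 0 (sqrt v) w \<le> 1 / sqrt (2 * pi * v)" by simp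
  qed simp
  also have "\<dots> = ennreal (1 / sqrt (2 * pi * v)) * (\<integral>\<^sup>+w. indicator U (c + w) \<partial>lborel)"
    using U by (intro nn_integral_cmult) auto
  also have "(\<integral>\<^sup>+w. indicator U (c + w) \<partial>lborel) = (\<integral>\<^sup>+z. indicator U z \<partial>lborel)"
    using nn_integral_real_affine[of "indicator U :: real \<Rightarrow> ennreal" 1 c] U by simp
  finally show ?thesis using U by simp
qed

text \<open>Given the value at time s, the endpoint has a density bounded by 1 / sqrt (2 pi (T - s)).\<close>

lemma endpoint_moment_le:
  assumes B: "standard_brownian_motion \<Omega> T B" and s: "0 < s" "s < T" and U: "U \<in> sets borel"
  shows "(\<integral>\<^sup>+\<omega>. indicator U (x + B T \<omega>) * ennreal (\<bar>x + B s \<omega>\<bar> ^ q) \<partial>\<Omega>)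
    \<le> ennreal (1 / sqrt (2 * pi * (T - s))) * emeasure lborel U
      * (\<integral>\<^sup>+w. ennreal (\<bar>x + w\<bar> ^ q) \<partial>centred_normal s)"
proof -
  \<comment> \<open>The grid 0, \<open>s\<close>, \<open>T\<close> writes the endpoint with two
    independent increments, the first of which determines the value at \<open>s\<close>.\<close>
  define t where "t i = (if i = 0 then 0 else if i = 1 then s else T)" for i :: nat
  have t: "0 \<le> t 0" "\<And>i. i < 2 \<Longrightarrow> t i < t (Suc i)" "t 2 \<le> T"
    using s by (auto simp: t_def less_2_cases_iff)
  let ?N = "\<lambda>i. centred_normal (t (Suc i) - t i)"
  define f where "f w = indicator U (x + w 0 + w 1) * ennreal (\<bar>x + w 0\<bar> ^ q)" for w :: "nat \<Rightarrow> real"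
  have N: "prob_space (centred_normal s)" "prob_space (centred_normal (T - s))"
    using s by (auto intro: prob_space_centred_normal)
  have Nt: "?N 0 = centred_normal s" "?N 1 = centred_normal (T - s)" by (simp_all add: t_def)
  have B0: "AE \<omega> in \<Omega>. B 0 \<omega> = 0" using B by (auto simp: standard_brownian_motion_def)
  have f: "f \<in> borel_measurable (Pi\<^sub>M {..<2} (\<lambda>_. borel))"
    unfolding f_def using U by measurable
  have "(\<integral>\<^sup>+\<omega>. indicator U (x + B T \<omega>) * ennreal (\<bar>x + B s \<omega>\<bar> ^ q) \<partial>\<Omega>)
      = (\<integral>\<^sup>+\<omega>. f (\<lambda>i\<in>{..<2}. B (t (Suc i)) \<omega> - B (t i) \<omega>) \<partial>\<Omega>)"
    using B0 by (intro nn_integral_cong_AE) (auto simp: f_def t_def)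
  also have "\<dots> = (\<integral>\<^sup>+w. f w \<partial>Pi\<^sub>M {..<2} ?N)"
    by (rule nn_integral_increments[OF B t pos2 f])
  also have "\<dots> = (\<integral>\<^sup>+w0. \<integral>\<^sup>+w1. indicator U (x + w0 + w1) * ennreal (\<bar>x + w0\<bar> ^ q)
      \<partial>centred_normal (T - s) \<partial>centred_normal s)"
  proof -
    define N' where "N' i = (if i = (0::nat) then centred_normal s else centred_normal (T - s))" for i
    interpret product_sigma_finite N'
      using N by (auto simp: product_sigma_finite_def N'_def intro: prob_space_imp_sigma_finite)
    have eq: "Pi\<^sub>M {..<2} ?N = Pi\<^sub>M {0, 1} N'"
      by (intro PiM_cong) (auto simp: N'_def t_def less_2_cases_iff)
    have meas: "(\<lambda>(w0, w1). indicator U (x + w0 + w1) * ennreal (\<bar>x + w0\<bar> ^ q))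
        \<in> borel_measurable (N' 0 \<Otimes>\<^sub>M N' 1)"
      unfolding N'_def using U by simp
    have "(\<integral>\<^sup>+w. f w \<partial>Pi\<^sub>M {0, 1} N')
        = (\<integral>\<^sup>+p. indicator U (x + fst p + snd p) * ennreal (\<bar>x + fst p\<bar> ^ q) \<partial>(N' 0 \<Otimes>\<^sub>M N' 1))"
      unfolding f_def using meas by (intro product_nn_integral_pair) auto
    also have "\<dots> = (\<integral>\<^sup>+w0. \<integral>\<^sup>+w1. indicator U (x + w0 + w1) * ennreal (\<bar>x + w0\<bar> ^ q) \<partial>N' 1 \<partial>N' 0)"
      using sigma_finite_measure.nn_integral_fst[OF sigma_finite_measures[of 1] meas] by (simp add: case_prod_unfold)
    finally show ?thesis unfolding eq by (simp add: N'_def)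
  qed
  also have "\<dots> = (\<integral>\<^sup>+w0. (\<integral>\<^sup>+w1. indicator U (x + w0 + w1) \<partial>centred_normal (T - s)) * ennreal (\<bar>x + w0\<bar> ^ q) \<partial>centred_normal s)"
    using U by (intro nn_integral_cong nn_integral_multc) auto
  \<comment> \<open>The peak of the second Gaussian bounds the inner integral uniformly in
    \<open>w0\<close>.\<close>
  also have "\<dots> \<le> (\<integral>\<^sup>+w0. (ennreal (1 / sqrt (2 * pi * (T - s))) * emeasure lborel U) * ennreal (\<bar>x + w0\<bar> ^ q) \<partial>centred_normal s)"
    using s U by (intro nn_integral_mono mult_right_mono normal_translate_le) auto
  also have "\<dots> = ennreal (1 / sqrt (2 * pi * (T - s))) * emeasure lborel U
      * (\<integral>\<^sup>+w. ennreal (\<bar>x + w\<bar> ^ q) \<partial>centred_normal s)"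
    by (rule nn_integral_cmult) simp
  finally show ?thesis .
qed

text \<open>Otherwise \<open>g\<close> would exceed \<open>C\<close> by a fixed margin on a whole
  interval, against the bound on its integral there.\<close>

lemma continuous_density_le:
  fixes g :: "real \<Rightarrow> real"
  assumes cont: "continuous_on UNIV g" and C: "0 \<le> C"
    and le: "\<And>U. U \<in> sets borel \<Longrightarrow> (\<integral>\<^sup>+z. ennreal (g z) * indicator U z \<partial>lborel) \<le> ennreal C * emeasure lborel U"
  shows "g y \<le> C"
proof (rule ccontr)
  assume "\<not> g y \<le> C"
  define D where "D = (C + g y) / 2"
  have D: "C < D" "D < g y" using \<open>\<not> g y \<le> C\<close> by (auto simp: D_def)
  have "open {z. D < g z}" using cont by (intro open_Collect_less) auto
  then obtain d where d: "0 < d" "cball y d \<subseteq> {z. D < g z}" using D open_contains_cball by blast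
  let ?U = "{y - d..y + d}"
  have sub: "?U \<subseteq> {z. D < g z}" using d by (auto simp: cball_eq_atLeastAtMost)
  have "ennreal D * emeasure lborel ?U = (\<integral>\<^sup>+z. ennreal D * indicator ?U z \<partial>lborel)"
    by (subst nn_integral_cmult_indicator) auto
  also have "\<dots> \<le> (\<integral>\<^sup>+z. ennreal (g z) * indicator ?U z \<partial>lborel)"
  proof (intro nn_integral_mono)
    fix z
    show "ennreal D * indicator ?U z \<le> ennreal (g z) * indicator ?U z"
    proof (cases "z \<in> ?U")
      case True
      then have "D \<le> g z" using sub by force
      then show ?thesis by (intro mult_right_mono ennreal_leI) auto
    qed simp
  qed
  also have "\<dots> \<le> ennreal C * emeasure lborel ?U" by (rule le) simp
  finally have "ennreal (D * (2 * d)) \<le> ennreal (C * (2 * d))"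
    using d C D by (simp add: ennreal_mult)
  then have "D * (2 * d) \<le> C * (2 * d)" using d C by (subst (asm) ennreal_le_iff) auto
  then show False using d D by (simp add: mult_le_cancel_right)
qed

text \<open>Weak continuity covers bounded functionals only, so the power is truncated at
  \<open>n\<close>. The truncated moment times the endpoint density is continuous in the endpoint
  and bounded by \<open>C\<close>, uniformly in \<open>n\<close>. Dividing by the positive density
  at \<open>y\<close> and monotone convergence remove the truncation.\<close>

lemma bridge_moment:
  assumes W: "brownian_bridge_law \<Omega> B T x y \<W>" and s: "0 < s" "s < T"
  shows "integrable \<W> (\<lambda>\<omega>. \<bar>\<omega> s\<bar> ^ q)"
proof -
  obtain \<kappa> where B: "standard_brownian_motion \<Omega> T B"
    and \<kappa>: "endpoint_kernel T (path_law \<Omega> T (\<lambda>t \<omega>. x + B t \<omega>)) \<kappa>" "\<W> = \<kappa> y"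
    using W by (auto simp: brownian_bridge_law_def bridge_law_def)
  have T: "0 < T" using s by simp
  have sT: "s \<in> {0..T}" "T \<in> {0..T}" using s by auto
  let ?R = "path_law \<Omega> T (\<lambda>t \<omega>. x + B t \<omega>)"
  let ?\<rho> = "distr ?R borel (\<lambda>\<omega>. \<omega> T)"
  have xB: "continuous_process \<Omega> T (\<lambda>t \<omega>. x + B t \<omega>)"
    using B by (auto simp: standard_brownian_motion_def continuous_process_def intro!: continuous_intros)
  have \<rho>: "?\<rho> = density lborel (\<lambda>z. ennreal (normal_density x (sqrt T) z))" by (rule endpoint_law[OF B T])
  note p\<kappa> = endpoint_kernel_prob[OF \<kappa>(1)]
  have meas: "f \<in> borel_measurable (\<kappa> z) \<longleftrightarrow> f \<in> borel_measurable (path_space T)" for f :: "_ \<Rightarrow> 'c::topological_space" and z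
    by (simp add: measurable_cong_sets[OF p\<kappa>(2) refl])
  have cs [measurable]: "(\<lambda>\<omega>. \<omega> s) \<in> borel_measurable (path_space T)" "(\<lambda>\<omega>. \<omega> T) \<in> borel_measurable (path_space T)"
    using sT by (auto intro: coordinate_measurable)
  define m where "m = (\<integral>\<^sup>+w. ennreal (\<bar>x + w\<bar> ^ q) \<partial>centred_normal s)"
  have m: "m < \<infinity>" unfolding m_def by (rule normal_shifted_moment_finite[OF s(1)])
  \<comment> \<open>Peak density of the increment from \<open>s\<close> to \<open>T\<close> times
    the moment of the Gaussian value at \<open>s\<close>, as in
    \<open>endpoint_moment_le\<close>.\<close>
  define C where "C = 1 / sqrt (2 * pi * (T - s)) * enn2real m"
  have C: "0 \<le> C" using s by (simp add: C_def)
  have C_eq: "ennreal C = ennreal (1 / sqrt (2 * pi * (T - s))) * m"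
  proof -
    have "ennreal C = ennreal (1 / sqrt (2 * pi * (T - s))) * ennreal (enn2real m)"
      unfolding C_def using s by (intro ennreal_mult) auto
    then show ?thesis using m by simp
  qed
  define h where "h n \<omega> = min (real n) (\<bar>\<omega> s\<bar> ^ q)" for n and \<omega> :: "real \<Rightarrow> real"
  have h_meas [measurable]: "h n \<in> borel_measurable (path_space T)" for n
    unfolding h_def[abs_def] by measurable
  have h_bounds: "0 \<le> h n \<omega>" "h n \<omega> \<le> real n" "h n \<omega> \<le> \<bar>\<omega> s\<bar> ^ q" for n \<omega>
    by (auto simp: h_def)
  have h_cont: "continuous_map (mtopology_of (path_metric T)) euclideanreal (h n)" for n
    by (rule continuous_map_path_metricI[OF T], unfold h_def)
      (intro tendsto_intros uniform_limit_coordinate[OF _ sT(1)])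
  define g where "g n z = (\<integral>\<omega>. h n \<omega> \<partial>\<kappa> z)" for n z
  have g_cont: "continuous_on UNIV (g n)" for n
    unfolding g_def by (rule kernel_integral_continuous[OF \<kappa>(1) h_cont, where C = "real n"]) (use h_bounds in simp)
  have [measurable]: "g n \<in> borel_measurable borel" for n
    by (rule borel_measurable_continuous_onI[OF g_cont])
  have g_nn: "(\<integral>\<^sup>+\<omega>. ennreal (h n \<omega>) \<partial>\<kappa> z) = ennreal (g n z)" for n z
    unfolding g_def using h_bounds
    by (intro nn_integral_eq_integral prob_bounded_integrable[OF p\<kappa> h_meas, where C = "real n"]) auto
  have g0: "0 \<le> g n z" for n z unfolding g_def using h_bounds by (intro Bochner_Integration.integral_nonneg) auto
  let ?p = "normal_density x (sqrt T)"
  have le: "g n y * ?p y \<le> C" for n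
  proof (rule continuous_density_le[where g = "\<lambda>z. g n z * ?p z", OF _ C])
    show "continuous_on UNIV (\<lambda>z. g n z * ?p z)"
      unfolding normal_density_def by (intro continuous_intros g_cont) (use T in auto)
    fix U :: "real set" assume U: "U \<in> sets borel"
    \<comment> \<open>The integral over endpoints in \<open>U\<close> becomes an expectation over
      Brownian paths, where the joint bound applies.\<close>
    have "(\<integral>\<^sup>+z. ennreal (g n z * ?p z) * indicator U z \<partial>lborel)
        = (\<integral>\<^sup>+z. indicator U z * (\<integral>\<^sup>+\<omega>. ennreal (h n \<omega>) \<partial>\<kappa> z) \<partial>?\<rho>)"
      unfolding \<rho> g_nn using U g0
      by (subst nn_integral_density) (auto simp: ennreal_mult mult_ac)
    also have "\<dots> = (\<integral>\<^sup>+\<omega>. indicator U (\<omega> T) * ennreal (h n \<omega>) \<partial>?R)"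
      using U by (intro kernel_nn_integral[OF T sets_path_law \<kappa>(1), symmetric]) auto
    also have "\<dots> = (\<integral>\<^sup>+\<omega>. indicator U (x + B T \<omega>) * ennreal (h n (\<lambda>t\<in>{0..T}. x + B t \<omega>)) \<partial>\<Omega>)"
      unfolding path_law_def using U sT by (subst nn_integral_distr[OF measurable_path[OF xB]]) auto
    also have "\<dots> \<le> (\<integral>\<^sup>+\<omega>. indicator U (x + B T \<omega>) * ennreal (\<bar>x + B s \<omega>\<bar> ^ q) \<partial>\<Omega>)"
    proof (intro nn_integral_mono mult_left_mono ennreal_leI)
      fix \<omega>
      show "h n (\<lambda>t\<in>{0..T}. x + B t \<omega>) \<le> \<bar>x + B s \<omega>\<bar> ^ q"
        using h_bounds(3)[of n "\<lambda>t\<in>{0..T}. x + B t \<omega>"] sT by simp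
    qed simp
    also have "\<dots> \<le> ennreal (1 / sqrt (2 * pi * (T - s))) * emeasure lborel U * m"
      unfolding m_def by (rule endpoint_moment_le[OF B s U])
    also have "\<dots> = ennreal C * emeasure lborel U" unfolding C_eq by (simp only: mult_ac)
    finally show "(\<integral>\<^sup>+z. ennreal (g n z * ?p z) * indicator U z \<partial>lborel) \<le> ennreal C * emeasure lborel U" .
  qed
  have p: "0 < ?p y" using T by (intro normal_density_pos) simp
  have bound: "(\<integral>\<^sup>+\<omega>. ennreal (h n \<omega>) \<partial>\<W>) \<le> ennreal (C / ?p y)" for n
    using le[of n] p unfolding \<kappa>(2) g_nn by (intro ennreal_leI) (simp add: field_simps)
  have "(\<lambda>n. \<integral>\<^sup>+\<omega>. ennreal (h n \<omega>) \<partial>\<W>) \<longlonglongrightarrow> (\<integral>\<^sup>+\<omega>. ennreal (\<bar>\<omega> s\<bar> ^ q) \<partial>\<W>)"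
  proof (rule nn_integral_LIMSEQ)
    show "incseq (\<lambda>n \<omega>. ennreal (h n \<omega>))"
      by (intro monoI le_funI ennreal_leI) (auto simp: h_def)
    show "(\<lambda>\<omega>. ennreal (h n \<omega>)) \<in> borel_measurable \<W>" for n
      unfolding \<kappa>(2) meas by measurable
    fix \<omega> :: "real \<Rightarrow> real"
    obtain n0 :: nat where "\<bar>\<omega> s\<bar> ^ q \<le> real n0" using real_arch_simple by blast
    then have "\<forall>\<^sub>F n in sequentially. ennreal (h n \<omega>) = ennreal (\<bar>\<omega> s\<bar> ^ q)"
      by (intro eventually_sequentiallyI[of n0]) (auto simp: h_def min_def)
    then show "(\<lambda>n. ennreal (h n \<omega>)) \<longlonglongrightarrow> ennreal (\<bar>\<omega> s\<bar> ^ q)" by (rule tendsto_eventually)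
  qed
  then have "(\<integral>\<^sup>+\<omega>. ennreal (\<bar>\<omega> s\<bar> ^ q) \<partial>\<W>) \<le> ennreal (C / ?p y)"
    by (rule LIMSEQ_le_const2) (use bound in auto)
  also have "\<dots> < \<infinity>" by simp
  finally show ?thesis
    by (intro integrableI_bounded) (auto simp: \<kappa>(2) meas)
qed

section \<open>Square integrability and two inequalities in L2\<close>

lemma integrable_powers_add:
  fixes f g :: "'a \<Rightarrow> real"
  assumes "\<And>q. integrable M (\<lambda>x. \<bar>f x\<bar> ^ q)" "\<And>q. integrable M (\<lambda>x. \<bar>g x\<bar> ^ q)"
    and [measurable]: "f \<in> borel_measurable M" "g \<in> borel_measurable M"
  shows "integrable M (\<lambda>x. \<bar>f x + g x\<bar> ^ q)"
proof (rule Bochner_Integration.integrable_bound)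
  show "integrable M (\<lambda>x. 2 ^ q * (\<bar>f x\<bar> ^ q + \<bar>g x\<bar> ^ q))"
    using assms by (intro integrable_mult_right Bochner_Integration.integrable_add)
  show "AE x in M. norm (\<bar>f x + g x\<bar> ^ q) \<le> norm (2 ^ q * (\<bar>f x\<bar> ^ q + \<bar>g x\<bar> ^ q))"
    using abs_add_power_le by (intro AE_I2) simp
qed measurable

text \<open>The form \<open>1 + sum\<close> is that of the polynomial bound on \<open>G\<close> once
  the Euclidean norm is replaced by the sum of absolute values.\<close>

lemma integrable_powers_sum:
  fixes f :: "'i \<Rightarrow> 'a \<Rightarrow> real"
  assumes "finite_measure M" "finite I"
    and "\<And>i q. i \<in> I \<Longrightarrow> integrable M (\<lambda>x. \<bar>f i x\<bar> ^ q)" "\<And>i. i \<in> I \<Longrightarrow> f i \<in> borel_measurable M"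
  shows "integrable M (\<lambda>x. \<bar>1 + (\<Sum>i\<in>I. f i x)\<bar> ^ q)"
  using assms(2-)
proof (induction I arbitrary: q)
  case empty
  interpret finite_measure M by fact
  show ?case by simp
next
  case (insert i I)
  have "integrable M (\<lambda>x. \<bar>f i x + (1 + (\<Sum>i\<in>I. f i x))\<bar> ^ q)"
    by (rule integrable_powers_add) (use insert in auto)
  then show ?case using insert by (simp add: add.left_commute)
qed

lemma sample_functional_measurable:
  assumes "G \<in> borel_measurable (Pi\<^sub>M {1..M} (\<lambda>_. borel))" "\<And>i. i \<in> {1..M} \<Longrightarrow> t i \<in> {0..T}"
  shows "(\<lambda>\<omega>. G (sample M t \<omega>) :: real) \<in> borel_measurable (path_space T)"
  using assms unfolding sample_def
  by (intro measurable_compose[OF measurable_restrict assms(1)] coordinate_measurable) auto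

lemma sample_functional_square_integrable:
  assumes W: "brownian_bridge_law \<Omega> B T x y \<W>"
    and G: "G \<in> borel_measurable (Pi\<^sub>M {1..M} (\<lambda>_. borel))" "poly_bounded M G"
    and t: "admissible_times M T t"
  shows "integrable \<W> (\<lambda>\<omega>. (G (sample M t \<omega>))\<^sup>2)"
proof -
  have t': "0 < t i" "t i < T" "t i \<in> {0..T}" if "i \<in> {1..M}" for i
    using t that by (auto simp: admissible_times_def intro: less_imp_le)
  have W': "prob_space \<W>" "sets \<W> = sets (path_space T)"
    using W endpoint_kernel_prob by (auto simp: brownian_bridge_law_def bridge_law_def)
  interpret prob_space \<W> by fact
  have meas: "f \<in> borel_measurable \<W> \<longleftrightarrow> f \<in> borel_measurable (path_space T)" for f :: "_ \<Rightarrow> real"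
    by (simp add: measurable_cong_sets[OF W'(2) refl])
  obtain C p where Cp: "\<And>v. v \<in> {1..M} \<rightarrow>\<^sub>E UNIV \<Longrightarrow> \<bar>G v\<bar> \<le> C * (1 + L2_set v {1..M}) ^ p"
    using G(2) unfolding poly_bounded_def by blast
  show ?thesis
  proof (rule Bochner_Integration.integrable_bound)
    show "integrable \<W> (\<lambda>\<omega>. C\<^sup>2 * \<bar>1 + (\<Sum>i\<in>{1..M}. \<bar>\<omega> (t i)\<bar>)\<bar> ^ (p * 2))"
      using bridge_moment[OF W t'(1,2)] t'(3)
      by (intro integrable_mult_right integrable_powers_sum finite_measure_axioms)
        (auto simp: meas intro!: borel_measurable_abs coordinate_measurable)
    show "(\<lambda>\<omega>. (G (sample M t \<omega>))\<^sup>2) \<in> borel_measurable \<W>"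
      unfolding meas by (intro borel_measurable_power sample_functional_measurable G t')
    show "AE \<omega> in \<W>. norm ((G (sample M t \<omega>))\<^sup>2) \<le> norm (C\<^sup>2 * \<bar>1 + (\<Sum>i\<in>{1..M}. \<bar>\<omega> (t i)\<bar>)\<bar> ^ (p * 2))"
    proof (intro AE_I2)
      fix \<omega>
      have "\<bar>G (sample M t \<omega>)\<bar> \<le> C * (1 + L2_set (sample M t \<omega>) {1..M}) ^ p"
        by (rule Cp) (auto simp: sample_def)
      then have "\<bar>G (sample M t \<omega>)\<bar>\<^sup>2 \<le> (C * (1 + L2_set (sample M t \<omega>) {1..M}) ^ p)\<^sup>2"
        by (intro power_mono) auto
      also have "\<dots> = C\<^sup>2 * (1 + L2_set (sample M t \<omega>) {1..M}) ^ (p * 2)"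
        by (simp only: power_mult_distrib power_mult)
      also have "\<dots> \<le> C\<^sup>2 * \<bar>1 + (\<Sum>i\<in>{1..M}. \<bar>\<omega> (t i)\<bar>)\<bar> ^ (p * 2)"
      proof (intro mult_left_mono power_mono)
        have "L2_set (sample M t \<omega>) {1..M} \<le> (\<Sum>i\<in>{1..M}. \<bar>sample M t \<omega> i\<bar>)" by (rule L2_set_le_sum_abs)
        also have "\<dots> = (\<Sum>i\<in>{1..M}. \<bar>\<omega> (t i)\<bar>)" by (intro sum.cong) (auto simp: sample_def)
        finally show "1 + L2_set (sample M t \<omega>) {1..M} \<le> \<bar>1 + (\<Sum>i\<in>{1..M}. \<bar>\<omega> (t i)\<bar>)\<bar>" by linarith
      qed (auto simp: L2_set_nonneg)
      finally show "norm ((G (sample M t \<omega>))\<^sup>2) \<le> norm (C\<^sup>2 * \<bar>1 + (\<Sum>i\<in>{1..M}. \<bar>\<omega> (t i)\<bar>)\<bar> ^ (p * 2))"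
        by simp
    qed
  qed
qed

lemma integral_Cauchy_Schwarz:
  fixes f g :: "'a \<Rightarrow> real"
  assumes [measurable]: "f \<in> borel_measurable M" "g \<in> borel_measurable M"
    and f: "integrable M (\<lambda>x. (f x)\<^sup>2)" and g: "integrable M (\<lambda>x. (g x)\<^sup>2)"
  shows "integrable M (\<lambda>x. f x * g x)"
    and "(\<integral>x. f x * g x \<partial>M)\<^sup>2 \<le> (\<integral>x. (f x)\<^sup>2 \<partial>M) * (\<integral>x. (g x)\<^sup>2 \<partial>M)"
proof -
  show fg: "integrable M (\<lambda>x. f x * g x)"
  proof (rule Bochner_Integration.integrable_bound)
    show "integrable M (\<lambda>x. (f x)\<^sup>2 + (g x)\<^sup>2)" using f g by simp
    show "AE x in M. norm (f x * g x) \<le> norm ((f x)\<^sup>2 + (g x)\<^sup>2)"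
    proof (intro AE_I2)
      fix x
      have "2 * \<bar>f x * g x\<bar> \<le> (f x)\<^sup>2 + (g x)\<^sup>2"
        using sum_squares_bound[of "\<bar>f x\<bar>" "\<bar>g x\<bar>"] by (simp add: abs_mult)
      then show "norm (f x * g x) \<le> norm ((f x)\<^sup>2 + (g x)\<^sup>2)" by simp
    qed
  qed measurable
  have "(\<integral>\<^sup>+x. ennreal \<bar>f x\<bar> * ennreal \<bar>g x\<bar> \<partial>M)\<^sup>2 \<le> (\<integral>\<^sup>+x. ennreal \<bar>f x\<bar> ^ 2 \<partial>M) * (\<integral>\<^sup>+x. ennreal \<bar>g x\<bar> ^ 2 \<partial>M)"
    by (rule Cauchy_Schwarz_nn_integral) measurable
  also have "(\<integral>\<^sup>+x. ennreal \<bar>f x\<bar> ^ 2 \<partial>M) = ennreal (\<integral>x. (f x)\<^sup>2 \<partial>M)"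
    using f by (subst nn_integral_eq_integral[symmetric]) (auto simp: ennreal_power)
  also have "(\<integral>\<^sup>+x. ennreal \<bar>g x\<bar> ^ 2 \<partial>M) = ennreal (\<integral>x. (g x)\<^sup>2 \<partial>M)"
    using g by (subst nn_integral_eq_integral[symmetric]) (auto simp: ennreal_power)
  also have "(\<integral>\<^sup>+x. ennreal \<bar>f x\<bar> * ennreal \<bar>g x\<bar> \<partial>M) = ennreal (\<integral>x. \<bar>f x * g x\<bar> \<partial>M)"
    using integrable_abs[OF fg] by (subst nn_integral_eq_integral[symmetric]) (auto simp: abs_mult ennreal_mult)
  finally have "ennreal ((\<integral>x. \<bar>f x * g x\<bar> \<partial>M)\<^sup>2) \<le> ennreal ((\<integral>x. (f x)\<^sup>2 \<partial>M) * (\<integral>x. (g x)\<^sup>2 \<partial>M))"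
    by (simp add: ennreal_power ennreal_mult)
  then have "(\<integral>x. \<bar>f x * g x\<bar> \<partial>M)\<^sup>2 \<le> (\<integral>x. (f x)\<^sup>2 \<partial>M) * (\<integral>x. (g x)\<^sup>2 \<partial>M)"
    by (subst (asm) ennreal_le_iff) auto
  moreover have "(\<integral>x. f x * g x \<partial>M)\<^sup>2 \<le> (\<integral>x. \<bar>f x * g x\<bar> \<partial>M)\<^sup>2"
    using integral_abs_bound[of M "\<lambda>x. f x * g x"] by (metis abs_ge_zero power2_abs power_mono)
  ultimately show "(\<integral>x. f x * g x \<partial>M)\<^sup>2 \<le> (\<integral>x. (f x)\<^sup>2 \<partial>M) * (\<integral>x. (g x)\<^sup>2 \<partial>M)" by linarith
qed

text \<open>As the product of \<open>Z x - \<alpha>\<close> and \<open>\<beta> - Z x\<close> is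
  nonnegative, the square is at most an affine function of \<open>Z x - c\<close>. Its linear part
  has mean 0, and the constant \<open>(\<beta> - c) * (c - \<alpha>)\<close> is largest when
  \<open>c\<close> is the midpoint.\<close>

lemma (in prob_space) Popoviciu_variance_le:
  fixes Z :: "'a \<Rightarrow> real"
  assumes Z: "integrable M Z" "integrable M (\<lambda>x. (Z x - c)\<^sup>2)" "expectation Z = c"
    and range: "AE x in M. \<alpha> \<le> Z x \<and> Z x \<le> \<beta>"
  shows "expectation (\<lambda>x. (Z x - c)\<^sup>2) \<le> ((\<beta> - \<alpha>) / 2)\<^sup>2"
proof -
  have "expectation (\<lambda>x. (Z x - c)\<^sup>2) \<le> expectation (\<lambda>x. (\<alpha> + \<beta> - 2 * c) * (Z x - c) + (\<beta> - c) * (c - \<alpha>))"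
  proof (rule integral_mono_AE[OF Z(2)])
    show "integrable M (\<lambda>x. (\<alpha> + \<beta> - 2 * c) * (Z x - c) + (\<beta> - c) * (c - \<alpha>))" using Z by simp
    show "AE x in M. (Z x - c)\<^sup>2 \<le> (\<alpha> + \<beta> - 2 * c) * (Z x - c) + (\<beta> - c) * (c - \<alpha>)"
      using range
    proof eventually_elim
      case (elim x)
      then have "0 \<le> (Z x - \<alpha>) * (\<beta> - Z x)" by simp
      then show ?case by (simp add: power2_eq_square algebra_simps)
    qed
  qed
  also have "\<dots> = (\<beta> - c) * (c - \<alpha>)" using Z by (simp add: prob_space)
  also have "\<dots> \<le> ((\<beta> - \<alpha>) / 2)\<^sup>2"
  proof -
    have "((\<beta> - \<alpha>) / 2)\<^sup>2 - (\<beta> - c) * (c - \<alpha>) = ((\<alpha> + \<beta>) / 2 - c)\<^sup>2"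
      by (simp add: power2_eq_square field_simps)
    then show ?thesis using zero_le_power2[of "(\<alpha> + \<beta>) / 2 - c"] by linarith
  qed
  finally show ?thesis .
qed

section \<open>Comparison of the two bridges\<close>

context smooth_drift
begin

lemma weight_pos: "0 < weight \<mu> T \<omega>"
  by (simp add: weight_def)

lemma bdd_below_potential: "bdd_below (range (drift_potential \<mu>))"
  using potential_ge by (intro bdd_belowI[of _ "- K"]) auto

theorem bridge_comparison:
  assumes Q: "diffusion_bridge_law \<Omega> W X \<mu> T x y \<Q>"
    and W: "brownian_bridge_law \<Omega>' B T x y \<W>" and T: "0 < T"
    and G: "G \<in> borel_measurable (Pi\<^sub>M {1..M} (\<lambda>_. borel))" "poly_bounded M G"
  shows "absolutely_continuous \<W> \<Q>"
    and "AE \<omega> in \<W>. RN_deriv \<W> \<Q> \<omega> = ennreal (normalised_weight \<W> \<mu> T \<omega>)"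
    and "admissible_times M T t \<Longrightarrow> integrable \<Q> (\<lambda>\<omega>. G (sample M t \<omega>))"
    and "admissible_times M T t \<Longrightarrow> integrable \<W> (\<lambda>\<omega>. G (sample M t \<omega>))"
    and "integrable \<W> (\<lambda>\<omega>. (normalised_weight \<W> \<mu> T \<omega> - 1)\<^sup>2)"
    and "admissible_times M T t \<Longrightarrow>
      \<bar>(\<integral>\<omega>. G (sample M t \<omega>) \<partial>\<Q>) - (\<integral>\<omega>. G (sample M t \<omega>) \<partial>\<W>)\<bar>\<^sup>2
        \<le> (\<integral>\<omega>. (normalised_weight \<W> \<mu> T \<omega> - 1)\<^sup>2 \<partial>\<W>) * (L2_rv_norm \<W> (\<lambda>\<omega>. G (sample M t \<omega>)))\<^sup>2"
    and "bdd_above (range (drift_potential \<mu>)) \<Longrightarrow> admissible_times M T t \<Longrightarrow>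
      \<bar>(\<integral>\<omega>. G (sample M t \<omega>) \<partial>\<Q>) - (\<integral>\<omega>. G (sample M t \<omega>) \<partial>\<W>)\<bar>
        \<le> 1/2 * (exp (T / 2 * ((SUP z. drift_potential \<mu> z) - (INF z. drift_potential \<mu> z))) - 1)
          * L2_rv_norm \<W> (\<lambda>\<omega>. G (sample M t \<omega>))"
proof -
  let ?Z = "normalised_weight \<W> \<mu> T"
  let ?c = "\<integral>\<omega>. weight \<mu> T \<omega> \<partial>\<W>"
  note dens = bridge_density(1)[OF Q W T] and pos = bridge_density(2)[OF Q W T] and int = bridge_density(3)[OF Q W T]
  have W': "prob_space \<W>" "sets \<W> = sets (path_space T)"
    using W endpoint_kernel_prob by (auto simp: brownian_bridge_law_def bridge_law_def)
  interpret prob_space \<W> by fact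
  have space_W: "space \<W> = mspace (path_metric T)"
    using sets_eq_imp_space_eq[OF W'(2)] by (simp add: space_path_space)
  have meas: "f \<in> borel_measurable \<W> \<longleftrightarrow> f \<in> borel_measurable (path_space T)" for f :: "_ \<Rightarrow> real"
    by (simp add: measurable_cong_sets[OF W'(2) refl])
  have Z_meas [measurable]: "?Z \<in> borel_measurable \<W>"
    unfolding meas normalised_weight_def[abs_def]
    using weight_measurable[OF T] by (intro borel_measurable_divide) auto
  have Z0: "0 \<le> ?Z \<omega>" for \<omega>
    using pos weight_pos[of T \<omega>] by (simp add: normalised_weight_def)
  show "absolutely_continuous \<W> \<Q>"
    using absolutely_continuousI_density[of "\<lambda>\<omega>. ennreal (?Z \<omega>)" \<W>] unfolding dens by simp
  show "AE \<omega> in \<W>. RN_deriv \<W> \<Q> \<omega> = ennreal (?Z \<omega>)"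
    using RN_deriv_unique[OF _ dens] by (auto elim: eventually_mono)
  have Z_int: "integrable \<W> ?Z" and Z_mean: "expectation ?Z = 1"
    unfolding normalised_weight_def[abs_def] using int pos by simp_all
  \<comment> \<open>\<open>?Z\<close> lies between 0 and the first summand; adding 1 covers the
    deviation from 1 on either side.\<close>
  define b where "b = exp (T * K / 2) / ?c + 1"
  have Z_b: "\<bar>?Z \<omega> - 1\<bar> \<le> b" if "\<omega> \<in> space \<W>" for \<omega>
  proof -
    have "?Z \<omega> \<le> exp (T * K / 2) / ?c"
      using weight_bound[OF T] that pos unfolding normalised_weight_def space_W
      by (intro divide_right_mono) auto
    then show ?thesis using Z0[of \<omega>] by (simp add: b_def)
  qed
  show Z2: "integrable \<W> (\<lambda>\<omega>. (?Z \<omega> - 1)\<^sup>2)"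
  proof (rule integrable_const_bound[where B = "b\<^sup>2"])
    show "AE \<omega> in \<W>. norm ((?Z \<omega> - 1)\<^sup>2) \<le> b\<^sup>2"
    proof (rule AE_I2)
      fix \<omega> assume "\<omega> \<in> space \<W>"
      from power_mono[OF Z_b[OF this], of 2] show "norm ((?Z \<omega> - 1)\<^sup>2) \<le> b\<^sup>2" by simp
    qed
  qed measurable
  assume t: "admissible_times M T t"
  let ?G = "\<lambda>\<omega>. G (sample M t \<omega>)"
  have "t i \<in> {0..T}" if "i \<in> {1..M}" for i
    using t that by (auto simp: admissible_times_def intro: less_imp_le)
  then have G_meas [measurable]: "?G \<in> borel_measurable \<W>"
    unfolding meas by (rule sample_functional_measurable[OF G(1)])
  have G2: "integrable \<W> (\<lambda>\<omega>. (?G \<omega>)\<^sup>2)"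
    by (rule sample_functional_square_integrable[OF W G t])
  \<comment> \<open>Cauchy-Schwarz against the constant 1, which is square integrable for a
    probability measure.\<close>
  show G1: "integrable \<W> ?G" using integral_Cauchy_Schwarz(1)[of "\<lambda>_. 1" \<W> ?G] G2 by simp
  have ZG: "integrable \<W> (\<lambda>\<omega>. (?Z \<omega> - 1) * ?G \<omega>)"
    and CS: "(\<integral>\<omega>. (?Z \<omega> - 1) * ?G \<omega> \<partial>\<W>)\<^sup>2 \<le> (\<integral>\<omega>. (?Z \<omega> - 1)\<^sup>2 \<partial>\<W>) * (\<integral>\<omega>. (?G \<omega>)\<^sup>2 \<partial>\<W>)"
    using Z2 G2 by (intro integral_Cauchy_Schwarz; measurable)+
  have ZG': "integrable \<W> (\<lambda>\<omega>. ?Z \<omega> * ?G \<omega>)"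
    using Bochner_Integration.integrable_add[OF ZG G1] by (simp add: algebra_simps)
  show "integrable \<Q> ?G"
    unfolding dens[symmetric] using ZG' Z0 by (subst integrable_density) auto
  have "(\<integral>\<omega>. ?G \<omega> \<partial>\<Q>) = (\<integral>\<omega>. ?Z \<omega> * ?G \<omega> \<partial>\<W>)"
    unfolding dens[symmetric] using Z0 by (subst integral_density) auto
  then have diff: "(\<integral>\<omega>. ?G \<omega> \<partial>\<Q>) - (\<integral>\<omega>. ?G \<omega> \<partial>\<W>) = (\<integral>\<omega>. (?Z \<omega> - 1) * ?G \<omega> \<partial>\<W>)"
    using ZG' G1 by (simp add: left_diff_distrib)
  have norm: "(L2_rv_norm \<W> ?G)\<^sup>2 = (\<integral>\<omega>. (?G \<omega>)\<^sup>2 \<partial>\<W>)"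
    unfolding L2_rv_norm_def by (rule real_sqrt_pow2) simp
  show a: "\<bar>(\<integral>\<omega>. ?G \<omega> \<partial>\<Q>) - (\<integral>\<omega>. ?G \<omega> \<partial>\<W>)\<bar>\<^sup>2
      \<le> (\<integral>\<omega>. (?Z \<omega> - 1)\<^sup>2 \<partial>\<W>) * (L2_rv_norm \<W> ?G)\<^sup>2"
    using CS by (simp only: diff norm power2_abs)
  assume bdd: "bdd_above (range (drift_potential \<mu>))"
  define S where "S = (SUP z. drift_potential \<mu> z)"
  define I where "I = (INF z. drift_potential \<mu> z)"
  have SI: "I \<le> drift_potential \<mu> z" "drift_potential \<mu> z \<le> S" for z
    unfolding S_def I_def using bdd bdd_below_potential by (auto intro: cINF_lower cSUP_upper)
  define l where "l = exp (- (1/2) * (T * S))"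
  define u where "u = exp (- (1/2) * (T * I))"
  have range: "l \<le> weight \<mu> T \<omega>" "weight \<mu> T \<omega> \<le> u" if "\<omega> \<in> space \<W>" for \<omega>
    using weight_le[OF _ T SI(1)] weight_ge[OF _ T SI(2)] that
    by (auto simp: l_def u_def space_W mspace_path_metric)
  have l: "0 < l" "l \<le> ?c"
  proof -
    have "expectation (\<lambda>_. l) \<le> ?c" using int range by (intro integral_mono) auto
    then show "l \<le> ?c" by (simp add: prob_space)
  qed (simp add: l_def)
  have lu: "l \<le> u" using SI[of 0] T by (simp add: l_def u_def mult_left_mono)
  have ratio: "u / l = exp (T / 2 * (S - I))"
    unfolding l_def u_def by (simp only: exp_diff[symmetric]) (simp add: field_simps)
  \<comment> \<open>Halving the range in the variance bound produces the factor 1/2 of the final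
    estimate.\<close>
  have "(\<integral>\<omega>. (?Z \<omega> - 1)\<^sup>2 \<partial>\<W>) \<le> ((u / ?c - l / ?c) / 2)\<^sup>2"
  proof (rule Popoviciu_variance_le[OF Z_int Z2 Z_mean])
    show "AE \<omega> in \<W>. l / ?c \<le> ?Z \<omega> \<and> ?Z \<omega> \<le> u / ?c"
      using range pos unfolding normalised_weight_def by (intro AE_I2 conjI divide_right_mono) auto
  qed
  also have "\<dots> \<le> (1/2 * (exp (T / 2 * (S - I)) - 1))\<^sup>2"
  proof (rule power_mono)
    \<comment> \<open>The normalising constant is a mean of weights, hence at least
      \<open>l\<close>. Replacing it by \<open>l\<close> gives \<open>u / l - 1\<close>, in which
      only the oscillation \<open>S - I\<close> survives.\<close>
    have "(u - l) / ?c \<le> (u - l) / l" using l lu pos by (intro divide_left_mono) auto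
    also have "\<dots> = exp (T / 2 * (S - I)) - 1" unfolding ratio[symmetric] using l by (simp add: diff_divide_distrib)
    finally show "(u / ?c - l / ?c) / 2 \<le> 1/2 * (exp (T / 2 * (S - I)) - 1)" by (simp add: diff_divide_distrib)
    show "0 \<le> (u / ?c - l / ?c) / 2" using lu pos by (simp add: divide_right_mono)
  qed
  finally have "(\<integral>\<omega>. (?Z \<omega> - 1)\<^sup>2 \<partial>\<W>) * (L2_rv_norm \<W> ?G)\<^sup>2
      \<le> (1/2 * (exp (T / 2 * (S - I)) - 1))\<^sup>2 * (L2_rv_norm \<W> ?G)\<^sup>2"
    by (rule mult_right_mono) simp
  with a have "\<bar>(\<integral>\<omega>. ?G \<omega> \<partial>\<Q>) - (\<integral>\<omega>. ?G \<omega> \<partial>\<W>)\<bar>\<^sup>2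
      \<le> (1/2 * (exp (T / 2 * (S - I)) - 1) * L2_rv_norm \<W> ?G)\<^sup>2"
    unfolding power_mult_distrib by linarith
  then have "\<bar>(\<integral>\<omega>. ?G \<omega> \<partial>\<Q>) - (\<integral>\<omega>. ?G \<omega> \<partial>\<W>)\<bar>
      \<le> 1/2 * (exp (T / 2 * (S - I)) - 1) * L2_rv_norm \<W> ?G"
  proof (rule power2_le_imp_le)
    have "0 \<le> T / 2 * (S - I)" using SI[of 0] T by simp
    then show "0 \<le> 1/2 * (exp (T / 2 * (S - I)) - 1) * L2_rv_norm \<W> ?G"
      by (simp add: L2_rv_norm_def)
  qed
  then show "\<bar>(\<integral>\<omega>. ?G \<omega> \<partial>\<Q>) - (\<integral>\<omega>. ?G \<omega> \<partial>\<W>)\<bar>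
      \<le> 1/2 * (exp (T / 2 * ((SUP z. drift_potential \<mu> z) - (INF z. drift_potential \<mu> z))) - 1) * L2_rv_norm \<W> ?G"
    unfolding S_def I_def .
qed

end

section \<open>The given drift as an instance\<close>

lemma admissible_coefficient_bounds:
  assumes "admissible_coefficient h"
  obtains K where "\<And>u v. \<bar>h u - h v\<bar> \<le> K * \<bar>u - v\<bar>" "\<And>u. (h has_real_derivative deriv h u) (at u)"
    "\<And>u v. \<bar>deriv h u - deriv h v\<bar> \<le> K * \<bar>u - v\<bar>"
proof -
  obtain C where C: "C-lipschitz_on UNIV h" using assms by (auto simp: admissible_coefficient_def)
  obtain D where D: "\<And>u. \<bar>deriv (deriv h) u\<bar> \<le> D" using assms by (auto simp: admissible_coefficient_def)
  have h: "(h has_real_derivative deriv h u) (at u)"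
    and h': "(deriv h has_real_derivative deriv (deriv h) u) (at u)" for u
    using assms by (simp_all add: admissible_coefficient_def DERIV_deriv_iff_real_differentiable)
  have "\<bar>h u - h v\<bar> \<le> max C D * \<bar>u - v\<bar>" for u v
  proof -
    have "\<bar>h u - h v\<bar> \<le> C * \<bar>u - v\<bar>" using lipschitz_onD[OF C, of u v] by (simp add: dist_real_def)
    also have "\<dots> \<le> max C D * \<bar>u - v\<bar>" by (intro mult_right_mono) auto
    finally show ?thesis .
  qed
  moreover have "\<bar>deriv h u - deriv h v\<bar> \<le> max C D * \<bar>u - v\<bar>" for u v
  proof -
    \<comment> \<open>The mean value inequality turns the bounded second derivative into a Lipschitz
      bound.\<close>
    have "norm (deriv h u - deriv h v) \<le> D * norm (u - v)"
      using h' D by (intro field_differentiable_bound[of UNIV]) (auto intro: has_field_derivative_at_within)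
    also have "\<dots> \<le> max C D * norm (u - v)" by (intro mult_right_mono) auto
    finally show ?thesis by simp
  qed
  ultimately show ?thesis using that h by blast
qed

text \<open>The difference quotients are bounded by \<open>K\<close>, and so is their limit; the
  derivative bound of the locale thus holds with the Lipschitz constant itself.\<close>

lemma derivative_bounded_by_lipschitz:
  fixes h :: "real \<Rightarrow> real"
  assumes lip: "\<And>u v. \<bar>h u - h v\<bar> \<le> K * \<bar>u - v\<bar>" and h: "(h has_real_derivative d) (at u)"
  shows "\<bar>d\<bar> \<le> K"
proof -
  have "((\<lambda>v. \<bar>(h v - h u) / (v - u)\<bar>) \<longlongrightarrow> \<bar>d\<bar>) (at u)"
    using h by (intro tendsto_rabs) (simp add: has_field_derivative_iff)
  then show ?thesis
  proof (rule tendsto_upperbound)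
    show "\<forall>\<^sub>F v in at u. \<bar>(h v - h u) / (v - u)\<bar> \<le> K"
      using eventually_neq_at_within[of u]
    proof eventually_elim
      case (elim v)
      then show ?case using lip[of v u] by (simp add: abs_divide pos_divide_le_eq)
    qed
  qed simp
qed

lemma smooth_drift_drift:
  assumes g: "admissible_coefficient g" and f: "\<And>i. i \<le> N \<Longrightarrow> admissible_coefficient (f i)"
  obtains \<mu>' A K where "smooth_drift (drift g f N a) \<mu>' A K"
proof -
  \<comment> \<open>The predicate survives adding a multiple of another function, with constant
    \<open>K + \<bar>c\<bar> * L\<close>, so the finite sum can be treated by induction.\<close>
  define bounded_drift where "bounded_drift h h' K \<longleftrightarrow> (\<forall>u v. \<bar>h u - h v\<bar> \<le> K * \<bar>u - v\<bar>)
    \<and> (\<forall>u. (h has_real_derivative h' u) (at u)) \<and> (\<forall>u v. \<bar>h' u - h' v\<bar> \<le> K * \<bar>u - v\<bar>)"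
    for h h' :: "real \<Rightarrow> real" and K :: real
  have adm: "\<exists>K. bounded_drift h (deriv h) K" if "admissible_coefficient h" for h
    using admissible_coefficient_bounds[OF that] unfolding bounded_drift_def by metis
  have add: "bounded_drift (\<lambda>u. h u + c * k u) (\<lambda>u. h' u + c * k' u) (K + \<bar>c\<bar> * L)"
    if hk: "bounded_drift h h' K" "bounded_drift k k' L" for h h' k k' K L c
  proof -
    have comb: "\<bar>(p + c * q) - (p' + c * q')\<bar> \<le> (K + \<bar>c\<bar> * L) * d"
      if "\<bar>p - p'\<bar> \<le> K * d" "\<bar>q - q'\<bar> \<le> L * d" for p q p' q' d :: real
    proof -
      have "(p + c * q) - (p' + c * q') = (p - p') + c * (q - q')" by (simp add: algebra_simps)
      then have "\<bar>(p + c * q) - (p' + c * q')\<bar> \<le> \<bar>p - p'\<bar> + \<bar>c\<bar> * \<bar>q - q'\<bar>"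
        using abs_triangle_ineq[of "p - p'" "c * (q - q')"] by (simp add: abs_mult)
      also have "\<dots> \<le> K * d + \<bar>c\<bar> * (L * d)" using that by (intro add_mono mult_left_mono) auto
      finally show ?thesis by (simp add: algebra_simps)
    qed
    show ?thesis
      using hk unfolding bounded_drift_def
      by (intro conjI allI comb) (auto intro!: derivative_eq_intros)
  qed
  \<comment> \<open>The sum over \<open>i < n\<close> is empty at \<open>n = 0\<close>, leaving
    \<open>g\<close> alone, and gives the full drift at \<open>n = Suc N\<close>.\<close>
  have "\<exists>h' K. bounded_drift (\<lambda>x. g x + (\<Sum>i<n. a i * f i x)) h' K" if "n \<le> Suc N" for n
    using that
  proof (induction n)
    case 0
    then show ?case using adm[OF g] by auto
  next
    case (Suc n)
    then obtain h' K where 1: "bounded_drift (\<lambda>x. g x + (\<Sum>i<n. a i * f i x)) h' K" by auto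
    obtain L where 2: "bounded_drift (f n) (deriv (f n)) L" using adm f Suc.prems by force
    from add[OF 1 2, of "a n"] show ?case by (auto simp: add.assoc)
  qed
  from this[of "Suc N"] obtain \<mu>' K where \<mu>': "bounded_drift (drift g f N a) \<mu>' K"
    unfolding drift_def[abs_def] lessThan_Suc_atMost by auto
  have lip: "\<bar>drift g f N a u - drift g f N a v\<bar> \<le> K * \<bar>u - v\<bar>"
    and deriv: "(drift g f N a has_real_derivative \<mu>' u) (at u)"
    and lip': "\<bar>\<mu>' u - \<mu>' v\<bar> \<le> K * \<bar>u - v\<bar>" for u v
    using \<mu>' by (auto simp: bounded_drift_def)
  \<comment> \<open>The open interval with infinite ends is the whole line, so the continuous drift
    has a primitive everywhere.\<close>
  have "\<exists>A. \<forall>u :: real. -\<infinity> < ereal u \<longrightarrow> ereal u < \<infinity> \<longrightarrow> (A has_vector_derivative drift g f N a u) (at u)"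
    using DERIV_isCont[OF deriv] by (intro einterval_antiderivative) auto
  then obtain A where "\<And>u. (A has_real_derivative drift g f N a u) (at u)"
    by (auto simp: has_real_derivative_iff_has_vector_derivative)
  then have "smooth_drift (drift g f N a) \<mu>' A K"
    by unfold_locales (use lip deriv lip' derivative_bounded_by_lipschitz[OF lip deriv] in auto)
  then show ?thesis by (rule that)
qed

text \<open>\<open>bdd_above\<close> expresses that the supremum in part (b) is finite; a
  real-valued supremum has no meaning otherwise. The integrability claims guarantee that no
  expectation takes the default value 0 of a Bochner integral.\<close>

theorem theorem3:
  fixes N M :: nat
    and g :: "real \<Rightarrow> real" and f :: "nat \<Rightarrow> real \<Rightarrow> real"
    and a :: "nat \<Rightarrow> real" and \<mu> :: "real \<Rightarrow> real"
    and G :: "(nat \<Rightarrow> real) \<Rightarrow> real"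
    and \<Delta> x y :: real
    and \<Omega> :: "'a measure" and W X :: "real \<Rightarrow> 'a \<Rightarrow> real"
    and \<Omega>' :: "'b measure" and B :: "real \<Rightarrow> 'b \<Rightarrow> real"
    and \<Q> \<W> :: "(real \<Rightarrow> real) measure"
  assumes coeff_g: "admissible_coefficient g"
    and coeff_f: "\<And>i. i \<le> N \<Longrightarrow> admissible_coefficient (f i)"
    and indep: "lin_indep_family N f"
    and mu: "\<mu> = drift g f N a"
    and G_meas: "G \<in> borel_measurable (Pi\<^sub>M {1..M} (\<lambda>_. borel))"
    and G_poly: "poly_bounded M G"
    and Delta: "0 < \<Delta>"
    and Q: "diffusion_bridge_law \<Omega> W X \<mu> \<Delta> x y \<Q>"
    and W: "brownian_bridge_law \<Omega>' B \<Delta> x y \<W>"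
  shows "integrable \<W> (weight \<mu> \<Delta>)
    \<and> absolutely_continuous \<W> \<Q>
    \<and> (AE \<omega> in \<W>. RN_deriv \<W> \<Q> \<omega> = ennreal (normalised_weight \<W> \<mu> \<Delta> \<omega>))
    \<and> (\<forall>t. admissible_times M \<Delta> t \<longrightarrow>
         integrable \<Q> (\<lambda>\<omega>. G (sample M t \<omega>))
       \<and> integrable \<W> (\<lambda>\<omega>. G (sample M t \<omega>))
       \<and> integrable \<W> (\<lambda>\<omega>. (G (sample M t \<omega>))\<^sup>2)
       \<and> integrable \<W> (\<lambda>\<omega>. (normalised_weight \<W> \<mu> \<Delta> \<omega> - 1)\<^sup>2)
       \<and> \<bar>(\<integral>\<omega>. G (sample M t \<omega>) \<partial>\<Q>) - (\<integral>\<omega>. G (sample M t \<omega>) \<partial>\<W>)\<bar>\<^sup>2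
           \<le> (\<integral>\<omega>. (normalised_weight \<W> \<mu> \<Delta> \<omega> - 1)\<^sup>2 \<partial>\<W>)
              * (L2_rv_norm \<W> (\<lambda>\<omega>. G (sample M t \<omega>)))\<^sup>2)
    \<and> (\<forall>t. admissible_times M \<Delta> t \<longrightarrow> bdd_above (range (drift_potential \<mu>)) \<longrightarrow>
         \<bar>(\<integral>\<omega>. G (sample M t \<omega>) \<partial>\<Q>) - (\<integral>\<omega>. G (sample M t \<omega>) \<partial>\<W>)\<bar>
           \<le> 1/2 * (exp (\<Delta> / 2 * ((SUP z. drift_potential \<mu> z) - (INF z. drift_potential \<mu> z))) - 1)
              * L2_rv_norm \<W> (\<lambda>\<omega>. G (sample M t \<omega>)))"
proof -
  obtain \<mu>' A K where "smooth_drift \<mu> \<mu>' A K"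
    using smooth_drift_drift[of g N f, OF coeff_g coeff_f] unfolding mu by blast
  then interpret smooth_drift \<mu> \<mu>' A K .
  show ?thesis
    by (intro conjI allI impI)
      (rule bridge_density(3)[OF Q W Delta] sample_functional_square_integrable[OF W G_meas G_poly]
        bridge_comparison[OF Q W Delta G_meas G_poly] | assumption)+
qed

end
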